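(* Let $\mathcal E$ be a category with pullbacks, let $\mathcal K=\mathrm{Cat}(\mathcal E)$ be the 2-category of categories internal to $\mathcal E$, and let $X$ be a crossed internal category in $\mathcal K$. Then the codescent object of $X$ exists if and only if the codescent object of the internal 2-category of corners $\mathrm{Cnr}(X)$ exists, in which case $\mathrm{CoDesc}(X)=\mathrm{CoDesc}(\mathrm{Cnr}(X))$.
   Context: **Codescent objects.** A cocone for a simplicial object $X$ in a 2-category with vertex $Z$ is $(f_0,f_1)$ with $f_0:X_0\to Z$ and a 2-cell $f_1:f_0d_1\to f_0d_0$ such that $f_1s_0=1_{f_0}$ and $(f_1d_0)(f_1d_2)=f_1d_1$. A codescent object $\mathrm{CoDesc}(X)$ is an object with a cocone $(q_0,q_1)$ such that for each cocone $(f_0,f_1)$ with vertex $Z$ there is a unique $f':\mathrm{CoDesc}(X)\to Z$ with $f'q_0=f_0$, $f'q_1=f_1$, and for cocones $(f_0,f_1),(g_0,g_1)$ with vertex $Z$ and $\phi:f_0\to g_0$ with $(\phi d_0)f_1=g_1(\phi d_1)$ there is a unique $\phi':f'\to g'$ with $\phi'q_0=\phi$. **Split opfibrations.** A split opfibration structure on $f:A\to B$ in a 2-category $\mathcal K$ is a split (Grothendieck) opfibration structure on each functor $\mathcal K(Y,f):\mathcal K(Y,A)\to\mathcal K(Y,B)$, such that precomposition with any $Y'\to Y$ preserves chosen opcartesian arrows; the latter are called chosen $f$-opcartesian 2-cells. A morphism $f\to g$ of split opfibrations over $B$ is a map $u$ with $gu=f$ such that $u\circ-$ preserves chosen opcartesian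 2-cells. Split opfibrations compose and are stable under pullback. **Crossed internal categories.** A category object in $\mathcal K$ is a simplicial object $X$ such that for all $n$ the square $d_0d_{n+2}=d_{n+1}d_0:X_{n+2}\to X_n$ is a pullback (source $d_1$, target $d_0:X_1\to X_0$); equivalently a monad in the bicategory $\mathrm{Span}(\mathcal K)$ with underlying span $X_0\xleftarrow{d_1}X_1\xrightarrow{d_0}X_0$. A crossed internal category is a category object $X$ with a split opfibration structure on $d_0:X_1\to X_0$ such that $s_0:X_0\to X_1$ and $d_1:X_2\to X_1$ are morphisms of split opfibrations over $X_0$ from $1_{X_0}$, respectively $d_0d_0:X_2\to X_0$, to $d_0:X_1\to X_0$ (with $d_0:X_2\to X_1$ the pullback of $d_0:X_1\to X_0$ along $d_1:X_1\to X_0$). **The internal 2-category of corners.** Let $X$ be a crossed internal category in $\mathcal K=\mathrm{Cat}(\mathcal E)$. The cotensors of $X_0$ with $[n]=\{0<\dots<n\}$ form a category object with underlying span $X_0\xleftarrow{}X_0^{[1]}\xrightarrow{}X_0$ (domain, codomain), hence a monad in $\mathrm{Span}(\mathcal K)$. Composites of spans are by pullback; $X_0^{[1]}\circ X_1$ (first $X_1$, then $X_0^{[1]}$) is the comma object $d_0\downarrow1_{X_0}$, with projections $p_1$ to $X_1$, $q_1$ to $X_0$, and 2-cell $\lambda_1:d_0p_1\to q_1$, and legs $d_1p_1$, $q_1$; $X_1\circ X_0^{[1]}$ is the comma object $1_{X_0}\downarrow d_1$ with projections $p_2$ to $X_0$, $q_2$ to $X_1$, and 2-cell $\lambda_2:p_2\to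 d_1q_2$, and legs $p_2$, $d_0q_2$. Let $\lambda_3:p_1\to r$ be the chosen $d_0$-opcartesian 2-cell with $d_0\lambda_3=\lambda_1$. Then $\delta_X:X_0^{[1]}\circ X_1\to X_1\circ X_0^{[1]}$ is the unique arrow with $p_2\delta_X=d_1p_1$, $q_2\delta_X=r$, $\lambda_2\delta_X=d_1\lambda_3$; it is a distributive law between monads in $\mathrm{Span}(\mathcal K)$, so $X_1\circ X_0^{[1]}$ is a monad on $X_0$. Let $i:X_{00}\to X_0$ be the inclusion of the object of objects of $X_0$ (a discrete internal category), let $i^{\bullet}$ be the span $X_{00}\xleftarrow{1}X_{00}\xrightarrow{i}X_0$ and $i_{\bullet}$ the span $X_0\xleftarrow{i}X_{00}\xrightarrow{1}X_{00}$, so $i^{\bullet}\dashv i_{\bullet}$. Then $i_{\bullet}\circ X_1\circ X_0^{[1]}\circ i^{\bullet}$ is a monad on $X_{00}$ in $\mathrm{Span}(\mathcal K)$, and $\mathrm{Cnr}(X)$ is the corresponding category object in $\mathcal K$ (its object of objects $X_{00}$ is discrete, i.e. it is an internal 2-category). *)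

theory Defs
  imports Main
begin

section \<open>Categories with pullbacks\<close>

record ('o, 'm) cat =
  Ob :: "'o set"
  Ar :: "'m set"
  Src :: "'m \<Rightarrow> 'o"
  Trg :: "'m \<Rightarrow> 'o"
  Ide :: "'o \<Rightarrow> 'm"
  Cmp :: "'m \<Rightarrow> 'm \<Rightarrow> 'm"  (infixl "\<bullet>\<index>" 70)

definition arr :: "('o, 'm) cat \<Rightarrow> 'm \<Rightarrow> 'o \<Rightarrow> 'o \<Rightarrow> bool" where
  "arr E f a b \<longleftrightarrow> f \<in> Ar E \<and> a \<in> Ob E \<and> b \<in> Ob E \<and> Src E f = a \<and> Trg E f = b"

definition category :: "('o, 'm) cat \<Rightarrow> bool" where
  "category E \<longleftrightarrow>
     (\<forall>f\<in>Ar E. Src E f \<in> Ob E \<and> Trg E f \<in> Ob E) \<and>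
     (\<forall>a\<in>Ob E. arr E (Ide E a) a a) \<and>
     (\<forall>f g a b c. arr E f a b \<longrightarrow> arr E g b c \<longrightarrow> arr E (g \<bullet>\<^bsub>E\<^esub> f) a c) \<and>
     (\<forall>f a b. arr E f a b \<longrightarrow> f \<bullet>\<^bsub>E\<^esub> Ide E a = f \<and> Ide E b \<bullet>\<^bsub>E\<^esub> f = f) \<and>
     (\<forall>f g h a b c d. arr E f a b \<longrightarrow> arr E g b c \<longrightarrow> arr E h c d \<longrightarrow>
        h \<bullet>\<^bsub>E\<^esub> (g \<bullet>\<^bsub>E\<^esub> f) = (h \<bullet>\<^bsub>E\<^esub> g) \<bullet>\<^bsub>E\<^esub> f)"

text \<open>\<open>is_pb E f g p q\<close>: the square \<open>f p = g q\<close> is a pullback (of \<open>f\<close> and \<open>g\<close>).\<close>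

definition is_pb :: "('o, 'm) cat \<Rightarrow> 'm \<Rightarrow> 'm \<Rightarrow> 'm \<Rightarrow> 'm \<Rightarrow> bool" where
  "is_pb E f g p q \<longleftrightarrow>
     arr E f (Src E f) (Trg E f) \<and> arr E g (Src E g) (Trg E f) \<and>
     arr E p (Src E p) (Src E f) \<and> arr E q (Src E p) (Src E g) \<and>
     f \<bullet>\<^bsub>E\<^esub> p = g \<bullet>\<^bsub>E\<^esub> q \<and>
     (\<forall>y a b. arr E a y (Src E f) \<longrightarrow> arr E b y (Src E g) \<longrightarrow> f \<bullet>\<^bsub>E\<^esub> a = g \<bullet>\<^bsub>E\<^esub> b \<longrightarrow>
        (\<exists>!u. arr E u y (Src E p) \<and> p \<bullet>\<^bsub>E\<^esub> u = a \<and> q \<bullet>\<^bsub>E\<^esub> u = b))"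

definition has_pullbacks :: "('o, 'm) cat \<Rightarrow> bool" where
  "has_pullbacks E \<longleftrightarrow>
     (\<forall>f g a b c. arr E f a c \<longrightarrow> arr E g b c \<longrightarrow> (\<exists>p q. is_pb E f g p q))"


section \<open>Internal categories, functors and natural transformations\<close>

text \<open>
  The object of composable pairs is part of the data, so that no choice of pullbacks in the base
  category is needed: \<open>pr1, pr2 : C2 \<rightarrow> C1\<close> are the first and the second arrow of a pair.
\<close>

record ('o, 'm) icat =
  C0 :: 'o
  C1 :: 'o
  C2 :: 'o
  isrc :: 'm
  itrg :: 'm
  iunt :: 'm
  pr1 :: 'm
  pr2 :: 'm
  imul :: 'm

text \<open>
  Composite of the generalised arrows \<open>f, g : Y \<rightarrow> C1\<close> (first \<open>f\<close>, then \<open>g\<close>) of an internal category.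
\<close>

definition icomp :: "('o, 'm) cat \<Rightarrow> ('o, 'm) icat \<Rightarrow> 'm \<Rightarrow> 'm \<Rightarrow> 'm" where
  "icomp E A g f =
     imul A \<bullet>\<^bsub>E\<^esub> (THE u. arr E u (Src E f) (C2 A) \<and> pr1 A \<bullet>\<^bsub>E\<^esub> u = f \<and> pr2 A \<bullet>\<^bsub>E\<^esub> u = g)"

text \<open>
  The unit and associativity laws are stated on generalised elements; instantiating them at
  the objects of arrows and of composable triples gives the usual commuting diagrams.
\<close>

definition internal_category :: "('o, 'm) cat \<Rightarrow> ('o, 'm) icat \<Rightarrow> bool" where
  "internal_category E A \<longleftrightarrow>
     arr E (isrc A) (C1 A) (C0 A) \<and> arr E (itrg A) (C1 A) (C0 A) \<and>
     arr E (iunt A) (C0 A) (C1 A) \<and> arr E (imul A) (C2 A) (C1 A) \<and>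
     arr E (pr1 A) (C2 A) (C1 A) \<and> arr E (pr2 A) (C2 A) (C1 A) \<and>
     is_pb E (itrg A) (isrc A) (pr1 A) (pr2 A) \<and>
     isrc A \<bullet>\<^bsub>E\<^esub> iunt A = Ide E (C0 A) \<and> itrg A \<bullet>\<^bsub>E\<^esub> iunt A = Ide E (C0 A) \<and>
     isrc A \<bullet>\<^bsub>E\<^esub> imul A = isrc A \<bullet>\<^bsub>E\<^esub> pr1 A \<and> itrg A \<bullet>\<^bsub>E\<^esub> imul A = itrg A \<bullet>\<^bsub>E\<^esub> pr2 A \<and>
     (\<forall>y f. arr E f y (C1 A) \<longrightarrow>
        icomp E A f (iunt A \<bullet>\<^bsub>E\<^esub> (isrc A \<bullet>\<^bsub>E\<^esub> f)) = f \<and>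
        icomp E A (iunt A \<bullet>\<^bsub>E\<^esub> (itrg A \<bullet>\<^bsub>E\<^esub> f)) f = f) \<and>
     (\<forall>y f g h. arr E f y (C1 A) \<longrightarrow> arr E g y (C1 A) \<longrightarrow> arr E h y (C1 A) \<longrightarrow>
        itrg A \<bullet>\<^bsub>E\<^esub> f = isrc A \<bullet>\<^bsub>E\<^esub> g \<longrightarrow> itrg A \<bullet>\<^bsub>E\<^esub> g = isrc A \<bullet>\<^bsub>E\<^esub> h \<longrightarrow>
        icomp E A h (icomp E A g f) = icomp E A (icomp E A h g) f)"

record ('o, 'm) ifun =
  fdom :: "('o, 'm) icat"
  fcod :: "('o, 'm) icat"
  F0 :: 'm
  F1 :: 'm

definition internal_functor :: "('o, 'm) cat \<Rightarrow> ('o, 'm) ifun \<Rightarrow> bool" where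
  "internal_functor E F \<longleftrightarrow>
     (let A = fdom F; B = fcod F in
      internal_category E A \<and> internal_category E B \<and>
      arr E (F0 F) (C0 A) (C0 B) \<and> arr E (F1 F) (C1 A) (C1 B) \<and>
      isrc B \<bullet>\<^bsub>E\<^esub> F1 F = F0 F \<bullet>\<^bsub>E\<^esub> isrc A \<and> itrg B \<bullet>\<^bsub>E\<^esub> F1 F = F0 F \<bullet>\<^bsub>E\<^esub> itrg A \<and>
      F1 F \<bullet>\<^bsub>E\<^esub> iunt A = iunt B \<bullet>\<^bsub>E\<^esub> F0 F \<and>
      F1 F \<bullet>\<^bsub>E\<^esub> imul A = icomp E B (F1 F \<bullet>\<^bsub>E\<^esub> pr2 A) (F1 F \<bullet>\<^bsub>E\<^esub> pr1 A))"

record ('o, 'm) inat =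
  nsrc :: "('o, 'm) ifun"
  ntrg :: "('o, 'm) ifun"
  ncmp :: 'm

definition internal_nat :: "('o, 'm) cat \<Rightarrow> ('o, 'm) inat \<Rightarrow> bool" where
  "internal_nat E \<alpha> \<longleftrightarrow>
     (let F = nsrc \<alpha>; G = ntrg \<alpha>; A = fdom F; B = fcod F in
      internal_functor E F \<and> internal_functor E G \<and> fdom G = A \<and> fcod G = B \<and>
      arr E (ncmp \<alpha>) (C0 A) (C1 B) \<and>
      isrc B \<bullet>\<^bsub>E\<^esub> ncmp \<alpha> = F0 F \<and> itrg B \<bullet>\<^bsub>E\<^esub> ncmp \<alpha> = F0 G \<and>
      icomp E B (ncmp \<alpha> \<bullet>\<^bsub>E\<^esub> itrg A) (F1 F) = icomp E B (F1 G) (ncmp \<alpha> \<bullet>\<^bsub>E\<^esub> isrc A))"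


section \<open>2-categories\<close>

text \<open>
  Horizontal composition is given by the two whiskerings: \<open>f \<rhd> \<phi>\<close> is the 2-cell \<open>\<phi>\<close> followed
  by the 1-cell \<open>f\<close>, and \<open>\<phi> \<lhd> f\<close> is the 1-cell \<open>f\<close> followed by the 2-cell \<open>\<phi>\<close>.
  The vertical composite \<open>\<psi> \<odot> \<phi>\<close> is \<open>\<phi>\<close> followed by \<open>\<psi>\<close>.
\<close>

record ('a, 'f, 'c) two_cat =
  Obj :: "'a set"
  Mor :: "'f set"
  Cel :: "'c set"
  Dom :: "'f \<Rightarrow> 'a"
  Cod :: "'f \<Rightarrow> 'a"
  One :: "'a \<Rightarrow> 'f"
  cmp :: "'f \<Rightarrow> 'f \<Rightarrow> 'f"  (infixl "\<cdot>\<index>" 75)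
  csrc :: "'c \<Rightarrow> 'f"
  ctrg :: "'c \<Rightarrow> 'f"
  cone :: "'f \<Rightarrow> 'c"
  vcmp :: "'c \<Rightarrow> 'c \<Rightarrow> 'c"  (infixl "\<odot>\<index>" 65)
  lwhisk :: "'f \<Rightarrow> 'c \<Rightarrow> 'c"  (infixr "\<rhd>\<index>" 70)
  rwhisk :: "'c \<Rightarrow> 'f \<Rightarrow> 'c"  (infixl "\<lhd>\<index>" 70)

definition hom1 :: "('a, 'f, 'c) two_cat \<Rightarrow> 'f \<Rightarrow> 'a \<Rightarrow> 'a \<Rightarrow> bool" where
  "hom1 K f A B \<longleftrightarrow> f \<in> Mor K \<and> A \<in> Obj K \<and> B \<in> Obj K \<and> Dom K f = A \<and> Cod K f = B"

definition hom2 :: "('a, 'f, 'c) two_cat \<Rightarrow> 'c \<Rightarrow> 'f \<Rightarrow> 'f \<Rightarrow> bool" where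
  "hom2 K \<phi> f g \<longleftrightarrow> \<phi> \<in> Cel K \<and> f \<in> Mor K \<and> g \<in> Mor K \<and> csrc K \<phi> = f \<and> ctrg K \<phi> = g"

definition Cat ::
    "('o, 'm) cat \<Rightarrow> (('o, 'm) icat, ('o, 'm) ifun, ('o, 'm) inat) two_cat" where
  "Cat E = \<lparr>
     Obj = {A. internal_category E A},
     Mor = {F. internal_functor E F},
     Cel = {\<alpha>. internal_nat E \<alpha>},
     Dom = fdom,
     Cod = fcod,
     One = (\<lambda>A. \<lparr>fdom = A, fcod = A, F0 = Ide E (C0 A), F1 = Ide E (C1 A)\<rparr>),
     cmp = (\<lambda>G F. \<lparr>fdom = fdom F, fcod = fcod G, F0 = F0 G \<bullet>\<^bsub>E\<^esub> F0 F, F1 = F1 G \<bullet>\<^bsub>E\<^esub> F1 F\<rparr>),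
     csrc = nsrc,
     ctrg = ntrg,
     cone = (\<lambda>F. \<lparr>nsrc = F, ntrg = F, ncmp = iunt (fcod F) \<bullet>\<^bsub>E\<^esub> F0 F\<rparr>),
     vcmp = (\<lambda>\<beta> \<alpha>. \<lparr>nsrc = nsrc \<alpha>, ntrg = ntrg \<beta>,
               ncmp = icomp E (fcod (nsrc \<alpha>)) (ncmp \<beta>) (ncmp \<alpha>)\<rparr>),
     lwhisk = (\<lambda>G \<alpha>.
       \<lparr>nsrc = \<lparr>fdom = fdom (nsrc \<alpha>), fcod = fcod G,
                F0 = F0 G \<bullet>\<^bsub>E\<^esub> F0 (nsrc \<alpha>), F1 = F1 G \<bullet>\<^bsub>E\<^esub> F1 (nsrc \<alpha>)\<rparr>,
        ntrg = \<lparr>fdom = fdom (ntrg \<alpha>), fcod = fcod G,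
                F0 = F0 G \<bullet>\<^bsub>E\<^esub> F0 (ntrg \<alpha>), F1 = F1 G \<bullet>\<^bsub>E\<^esub> F1 (ntrg \<alpha>)\<rparr>,
        ncmp = F1 G \<bullet>\<^bsub>E\<^esub> ncmp \<alpha>\<rparr>),
     rwhisk = (\<lambda>\<alpha> F.
       \<lparr>nsrc = \<lparr>fdom = fdom F, fcod = fcod (nsrc \<alpha>),
                F0 = F0 (nsrc \<alpha>) \<bullet>\<^bsub>E\<^esub> F0 F, F1 = F1 (nsrc \<alpha>) \<bullet>\<^bsub>E\<^esub> F1 F\<rparr>,
        ntrg = \<lparr>fdom = fdom F, fcod = fcod (ntrg \<alpha>),
                F0 = F0 (ntrg \<alpha>) \<bullet>\<^bsub>E\<^esub> F0 F, F1 = F1 (ntrg \<alpha>) \<bullet>\<^bsub>E\<^esub> F1 F\<rparr>,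
        ncmp = ncmp \<alpha> \<bullet>\<^bsub>E\<^esub> F0 F\<rparr>)\<rparr>"

text \<open>The discrete internal category on an object, and the inclusion of the object of objects.\<close>

definition disc :: "('o, 'm) cat \<Rightarrow> 'o \<Rightarrow> ('o, 'm) icat" where
  "disc E a = \<lparr>C0 = a, C1 = a, C2 = a, isrc = Ide E a, itrg = Ide E a, iunt = Ide E a,
               pr1 = Ide E a, pr2 = Ide E a, imul = Ide E a\<rparr>"

definition obj_incl :: "('o, 'm) cat \<Rightarrow> ('o, 'm) icat \<Rightarrow> ('o, 'm) ifun" where
  "obj_incl E A = \<lparr>fdom = disc E (C0 A), fcod = A, F0 = Ide E (C0 A), F1 = iunt A\<rparr>"


section \<open>Limits in a 2-category\<close>

text \<open>
  All limits are strict, with their one- and two-dimensional universal property.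
  As above, \<open>pullback K f g p q\<close> refers to the square \<open>f p = g q\<close>.
\<close>

definition pullback :: "('a, 'f, 'c) two_cat \<Rightarrow> 'f \<Rightarrow> 'f \<Rightarrow> 'f \<Rightarrow> 'f \<Rightarrow> bool" where
  "pullback K f g p q \<longleftrightarrow>
     hom1 K f (Dom K f) (Cod K f) \<and> hom1 K g (Dom K g) (Cod K f) \<and>
     hom1 K p (Dom K p) (Dom K f) \<and> hom1 K q (Dom K p) (Dom K g) \<and>
     f \<cdot>\<^bsub>K\<^esub> p = g \<cdot>\<^bsub>K\<^esub> q \<and>
     (\<forall>Y a b. hom1 K a Y (Dom K f) \<longrightarrow> hom1 K b Y (Dom K g) \<longrightarrow> f \<cdot>\<^bsub>K\<^esub> a = g \<cdot>\<^bsub>K\<^esub> b \<longrightarrow>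
        (\<exists>!u. hom1 K u Y (Dom K p) \<and> p \<cdot>\<^bsub>K\<^esub> u = a \<and> q \<cdot>\<^bsub>K\<^esub> u = b)) \<and>
     (\<forall>Y u v \<alpha> \<beta>. hom1 K u Y (Dom K p) \<longrightarrow> hom1 K v Y (Dom K p) \<longrightarrow>
        hom2 K \<alpha> (p \<cdot>\<^bsub>K\<^esub> u) (p \<cdot>\<^bsub>K\<^esub> v) \<longrightarrow> hom2 K \<beta> (q \<cdot>\<^bsub>K\<^esub> u) (q \<cdot>\<^bsub>K\<^esub> v) \<longrightarrow>
        f \<rhd>\<^bsub>K\<^esub> \<alpha> = g \<rhd>\<^bsub>K\<^esub> \<beta> \<longrightarrow>
        (\<exists>!\<chi>. hom2 K \<chi> u v \<and> p \<rhd>\<^bsub>K\<^esub> \<chi> = \<alpha> \<and> q \<rhd>\<^bsub>K\<^esub> \<chi> = \<beta>))"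

text \<open>
  A functor from the ordinal \<open>[n] = {0 < \<dots> < n}\<close> to the hom-category \<open>K(Y, A)\<close>: \<open>c j k\<close> is the image
  of \<open>j \<le> k\<close>, so the image of the object \<open>j\<close> is \<open>csrc K (c j j)\<close>.
\<close>

definition ord_functor ::
    "('a, 'f, 'c) two_cat \<Rightarrow> nat \<Rightarrow> 'a \<Rightarrow> 'a \<Rightarrow> (nat \<Rightarrow> nat \<Rightarrow> 'c) \<Rightarrow> bool" where
  "ord_functor K n Y A c \<longleftrightarrow>
     (\<forall>j\<le>n. hom1 K (csrc K (c j j)) Y A \<and> c j j = cone K (csrc K (c j j))) \<and>
     (\<forall>j k. j \<le> k \<longrightarrow> k \<le> n \<longrightarrow> hom2 K (c j k) (csrc K (c j j)) (csrc K (c k k))) \<and>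
     (\<forall>j k l. j \<le> k \<longrightarrow> k \<le> l \<longrightarrow> l \<le> n \<longrightarrow> c k l \<odot>\<^bsub>K\<^esub> c j k = c j l)"

definition cotensor ::
    "('a, 'f, 'c) two_cat \<Rightarrow> nat \<Rightarrow> 'a \<Rightarrow> 'a \<Rightarrow> (nat \<Rightarrow> nat \<Rightarrow> 'c) \<Rightarrow> bool" where
  "cotensor K n A P c \<longleftrightarrow>
     ord_functor K n P A c \<and>
     (\<forall>Y e. ord_functor K n Y A e \<longrightarrow>
        (\<exists>!u. hom1 K u Y P \<and> (\<forall>j k. j \<le> k \<longrightarrow> k \<le> n \<longrightarrow> c j k \<lhd>\<^bsub>K\<^esub> u = e j k))) \<and>
     (\<forall>Y u v \<theta>. hom1 K u Y P \<longrightarrow> hom1 K v Y P \<longrightarrow>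
        (\<forall>j\<le>n. hom2 K (\<theta> j) (csrc K (c j j) \<cdot>\<^bsub>K\<^esub> u) (csrc K (c j j) \<cdot>\<^bsub>K\<^esub> v)) \<longrightarrow>
        (\<forall>j k. j \<le> k \<longrightarrow> k \<le> n \<longrightarrow>
           (c j k \<lhd>\<^bsub>K\<^esub> v) \<odot>\<^bsub>K\<^esub> \<theta> j = \<theta> k \<odot>\<^bsub>K\<^esub> (c j k \<lhd>\<^bsub>K\<^esub> u)) \<longrightarrow>
        (\<exists>!\<chi>. hom2 K \<chi> u v \<and> (\<forall>j\<le>n. csrc K (c j j) \<rhd>\<^bsub>K\<^esub> \<chi> = \<theta> j)))"


section \<open>Simplicial objects, category objects and codescent objects\<close>

text \<open>\<open>face X n i\<close> is \<open>d\<^sub>i : X\<^sub>n \<rightarrow> X\<^sub>n\<^sub>-\<^sub>1\<close> (for \<open>n \<ge> 1\<close>) and \<open>degen X n i\<close> is \<open>s\<^sub>i : X\<^sub>n \<rightarrow> X\<^sub>n\<^sub>+\<^sub>1\<close>.\<close>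

record ('a, 'f) simp =
  level :: "nat \<Rightarrow> 'a"
  face :: "nat \<Rightarrow> nat \<Rightarrow> 'f"
  degen :: "nat \<Rightarrow> nat \<Rightarrow> 'f"

definition simplicial_object :: "('a, 'f, 'c) two_cat \<Rightarrow> ('a, 'f) simp \<Rightarrow> bool" where
  "simplicial_object K X \<longleftrightarrow>
     (\<forall>n. level X n \<in> Obj K) \<and>
     (\<forall>n i. i \<le> Suc n \<longrightarrow> hom1 K (face X (Suc n) i) (level X (Suc n)) (level X n)) \<and>
     (\<forall>n i. i \<le> n \<longrightarrow> hom1 K (degen X n i) (level X n) (level X (Suc n))) \<and>
     (\<forall>n i j. i < j \<longrightarrow> j \<le> n + 2 \<longrightarrow>
        face X (n + 1) i \<cdot>\<^bsub>K\<^esub> face X (n + 2) j = face X (n + 1) (j - 1) \<cdot>\<^bsub>K\<^esub> face X (n + 2) i) \<and>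
     (\<forall>n i j. i < j \<longrightarrow> j \<le> n \<longrightarrow>
        face X (n + 1) i \<cdot>\<^bsub>K\<^esub> degen X n j = degen X (n - 1) (j - 1) \<cdot>\<^bsub>K\<^esub> face X n i) \<and>
     (\<forall>n j. j \<le> n \<longrightarrow>
        face X (n + 1) j \<cdot>\<^bsub>K\<^esub> degen X n j = One K (level X n) \<and>
        face X (n + 1) (j + 1) \<cdot>\<^bsub>K\<^esub> degen X n j = One K (level X n)) \<and>
     (\<forall>n i j. j + 1 < i \<longrightarrow> i \<le> n + 1 \<longrightarrow>
        face X (n + 1) i \<cdot>\<^bsub>K\<^esub> degen X n j = degen X (n - 1) j \<cdot>\<^bsub>K\<^esub> face X n (i - 1)) \<and>
     (\<forall>n i j. i \<le> j \<longrightarrow> j \<le> n \<longrightarrow>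
        degen X (n + 1) i \<cdot>\<^bsub>K\<^esub> degen X n j = degen X (n + 1) (j + 1) \<cdot>\<^bsub>K\<^esub> degen X n i)"

definition category_object :: "('a, 'f, 'c) two_cat \<Rightarrow> ('a, 'f) simp \<Rightarrow> bool" where
  "category_object K X \<longleftrightarrow>
     simplicial_object K X \<and>
     (\<forall>n. pullback K (face X (n + 1) 0) (face X (n + 1) (n + 1))
                     (face X (n + 2) (n + 2)) (face X (n + 2) 0))"

definition cocone ::
    "('a, 'f, 'c) two_cat \<Rightarrow> ('a, 'f) simp \<Rightarrow> 'a \<Rightarrow> 'f \<Rightarrow> 'c \<Rightarrow> bool" where
  "cocone K X Z f0 f1 \<longleftrightarrow>
     hom1 K f0 (level X 0) Z \<and>
     hom2 K f1 (f0 \<cdot>\<^bsub>K\<^esub> face X 1 1) (f0 \<cdot>\<^bsub>K\<^esub> face X 1 0) \<and>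
     f1 \<lhd>\<^bsub>K\<^esub> degen X 0 0 = cone K f0 \<and>
     (f1 \<lhd>\<^bsub>K\<^esub> face X 2 0) \<odot>\<^bsub>K\<^esub> (f1 \<lhd>\<^bsub>K\<^esub> face X 2 2) = f1 \<lhd>\<^bsub>K\<^esub> face X 2 1"

definition is_codescent ::
    "('a, 'f, 'c) two_cat \<Rightarrow> ('a, 'f) simp \<Rightarrow> 'a \<Rightarrow> 'f \<Rightarrow> 'c \<Rightarrow> bool" where
  "is_codescent K X Q q0 q1 \<longleftrightarrow>
     cocone K X Q q0 q1 \<and>
     (\<forall>Z f0 f1. cocone K X Z f0 f1 \<longrightarrow>
        (\<exists>!f'. hom1 K f' Q Z \<and> f' \<cdot>\<^bsub>K\<^esub> q0 = f0 \<and> f' \<rhd>\<^bsub>K\<^esub> q1 = f1)) \<and>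
     (\<forall>Z f0 f1 g0 g1 \<phi> f' g'. cocone K X Z f0 f1 \<longrightarrow> cocone K X Z g0 g1 \<longrightarrow> hom2 K \<phi> f0 g0 \<longrightarrow>
        (\<phi> \<lhd>\<^bsub>K\<^esub> face X 1 0) \<odot>\<^bsub>K\<^esub> f1 = g1 \<odot>\<^bsub>K\<^esub> (\<phi> \<lhd>\<^bsub>K\<^esub> face X 1 1) \<longrightarrow>
        hom1 K f' Q Z \<longrightarrow> f' \<cdot>\<^bsub>K\<^esub> q0 = f0 \<longrightarrow> f' \<rhd>\<^bsub>K\<^esub> q1 = f1 \<longrightarrow>
        hom1 K g' Q Z \<longrightarrow> g' \<cdot>\<^bsub>K\<^esub> q0 = g0 \<longrightarrow> g' \<rhd>\<^bsub>K\<^esub> q1 = g1 \<longrightarrow>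
        (\<exists>!\<phi>'. hom2 K \<phi>' f' g' \<and> \<phi>' \<lhd>\<^bsub>K\<^esub> q0 = \<phi>))"

definition codescent_object ::
    "('a, 'f, 'c) two_cat \<Rightarrow> ('a, 'f) simp \<Rightarrow> 'a \<Rightarrow> bool" where
  "codescent_object K X Q \<longleftrightarrow> (\<exists>q0 q1. is_codescent K X Q q0 q1)"


section \<open>Split opfibrations\<close>

definition opcartesian :: "('a, 'f, 'c) two_cat \<Rightarrow> 'f \<Rightarrow> 'c \<Rightarrow> bool" where
  "opcartesian K f \<phi> \<longleftrightarrow>
     (\<forall>a \<psi> \<gamma>. hom2 K \<psi> (csrc K \<phi>) a \<longrightarrow> hom2 K \<gamma> (f \<cdot>\<^bsub>K\<^esub> ctrg K \<phi>) (f \<cdot>\<^bsub>K\<^esub> a) \<longrightarrow>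
        \<gamma> \<odot>\<^bsub>K\<^esub> (f \<rhd>\<^bsub>K\<^esub> \<phi>) = f \<rhd>\<^bsub>K\<^esub> \<psi> \<longrightarrow>
        (\<exists>!\<chi>. hom2 K \<chi> (ctrg K \<phi>) a \<and> f \<rhd>\<^bsub>K\<^esub> \<chi> = \<gamma> \<and> \<chi> \<odot>\<^bsub>K\<^esub> \<phi> = \<psi>))"

definition cells_into :: "('a, 'f, 'c) two_cat \<Rightarrow> 'a \<Rightarrow> 'c set" where
  "cells_into K A = {\<phi> \<in> Cel K. Cod K (csrc K \<phi>) = A}"

text \<open>
  A split opfibration structure on \<open>f : A \<rightarrow> B\<close> is represented by the set \<open>\<Phi>\<close> of its chosen
  \<open>f\<close>-opcartesian 2-cells, for all domains \<open>Y\<close> at once: each \<open>a : Y \<rightarrow> A\<close> and \<open>\<beta> : f a \<rightarrow> b\<close> has exactly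
  one chosen lift, the chosen lifts contain the identities and are closed under composition
  (splitness), and they are preserved by precomposition.
\<close>

definition split_opfibration ::
    "('a, 'f, 'c) two_cat \<Rightarrow> 'f \<Rightarrow> 'c set \<Rightarrow> bool" where
  "split_opfibration K f \<Phi> \<longleftrightarrow>
     hom1 K f (Dom K f) (Cod K f) \<and>
     \<Phi> \<subseteq> cells_into K (Dom K f) \<and>
     (\<forall>\<phi>\<in>\<Phi>. opcartesian K f \<phi>) \<and>
     (\<forall>Y a b \<beta>. hom1 K a Y (Dom K f) \<longrightarrow> hom2 K \<beta> (f \<cdot>\<^bsub>K\<^esub> a) b \<longrightarrow>
        (\<exists>!\<phi>. \<phi> \<in> \<Phi> \<and> csrc K \<phi> = a \<and> f \<rhd>\<^bsub>K\<^esub> \<phi> = \<beta>)) \<and>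
     (\<forall>Y a. hom1 K a Y (Dom K f) \<longrightarrow> cone K a \<in> \<Phi>) \<and>
     (\<forall>\<phi>\<in>\<Phi>. \<forall>\<psi>\<in>\<Phi>. ctrg K \<phi> = csrc K \<psi> \<longrightarrow> \<psi> \<odot>\<^bsub>K\<^esub> \<phi> \<in> \<Phi>) \<and>
     (\<forall>\<phi>\<in>\<Phi>. \<forall>Y' y. hom1 K y Y' (Dom K (csrc K \<phi>)) \<longrightarrow> \<phi> \<lhd>\<^bsub>K\<^esub> y \<in> \<Phi>)"

definition opfib_morphism ::
    "('a, 'f, 'c) two_cat \<Rightarrow> 'f \<Rightarrow> 'c set \<Rightarrow> 'f \<Rightarrow> 'c set \<Rightarrow> 'f \<Rightarrow> bool" where
  "opfib_morphism K f \<Phi> g \<Psi> u \<longleftrightarrow>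
     hom1 K u (Dom K f) (Dom K g) \<and> g \<cdot>\<^bsub>K\<^esub> u = f \<and> (\<forall>\<phi>\<in>\<Phi>. u \<rhd>\<^bsub>K\<^esub> \<phi> \<in> \<Psi>)"

text \<open>
  The chosen 2-cells of the identity on \<open>A\<close> are \<open>cells_into K A\<close>. For the composite of \<open>f\<close> followed by a
  split opfibration with chosen 2-cells \<open>\<Psi>\<close>, and for the pullback of a split opfibration with
  chosen 2-cells \<open>\<Phi>\<close> (with \<open>h\<close> the projection from the pullback \<open>P\<close> to its domain), they are as follows.
\<close>

definition opfib_comp ::
    "('a, 'f, 'c) two_cat \<Rightarrow> 'c set \<Rightarrow> 'f \<Rightarrow> 'c set \<Rightarrow> 'c set" where
  "opfib_comp K \<Psi> f \<Phi> = {\<phi> \<in> \<Phi>. f \<rhd>\<^bsub>K\<^esub> \<phi> \<in> \<Psi>}"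

definition opfib_pullback :: "('a, 'f, 'c) two_cat \<Rightarrow> 'f \<Rightarrow> 'c set \<Rightarrow> 'c set" where
  "opfib_pullback K h \<Phi> = {\<phi> \<in> cells_into K (Dom K h). h \<rhd>\<^bsub>K\<^esub> \<phi> \<in> \<Phi>}"


section \<open>Crossed internal categories\<close>

text \<open>
  The pullback square exhibiting \<open>d\<^sub>0 : X\<^sub>2 \<rightarrow> X\<^sub>1\<close> as the pullback of \<open>d\<^sub>0 : X\<^sub>1 \<rightarrow> X\<^sub>0\<close> along
  \<open>d\<^sub>1 : X\<^sub>1 \<rightarrow> X\<^sub>0\<close> has \<open>d\<^sub>2 : X\<^sub>2 \<rightarrow> X\<^sub>1\<close> as its other projection.
\<close>

definition crossed_internal_category ::
    "('a, 'f, 'c) two_cat \<Rightarrow> ('a, 'f) simp \<Rightarrow> 'c set \<Rightarrow> bool" where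
  "crossed_internal_category K X \<Phi> \<longleftrightarrow>
     category_object K X \<and>
     split_opfibration K (face X 1 0) \<Phi> \<and>
     opfib_morphism K (One K (level X 0)) (cells_into K (level X 0)) (face X 1 0) \<Phi> (degen X 0 0) \<and>
     opfib_morphism K
       (face X 1 0 \<cdot>\<^bsub>K\<^esub> face X 2 0)
       (opfib_comp K \<Phi> (face X 2 0) (opfib_pullback K (face X 2 2) \<Phi>))
       (face X 1 0) \<Phi> (face X 2 1)"


section \<open>Monads in the bicategory of spans\<close>

text \<open>
  A monad on \<open>B\<close> with underlying span \<open>lleg, rleg : M \<rightarrow> B\<close>. The composite span \<open>M \<circ> M\<close> is the pullback
  of \<open>rleg\<close> and \<open>lleg\<close>, and \<open>mfst, msnd : M \<circ> M \<rightarrow> M\<close> project to the factor applied first, respectively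
  second.
\<close>

record 'f span_monad =
  lleg :: 'f
  rleg :: 'f
  mfst :: 'f
  msnd :: 'f
  munit :: 'f
  mmult :: 'f

definition monad_of :: "('a, 'f) simp \<Rightarrow> 'f span_monad" where
  "monad_of X = \<lparr>lleg = face X 1 1, rleg = face X 1 0, mfst = face X 2 2, msnd = face X 2 0,
                 munit = degen X 0 0, mmult = face X 2 1\<rparr>"

text \<open>
  Given monads \<open>T\<close> and \<open>S\<close> on \<open>B\<close>, the composite span \<open>T \<circ> S\<close> (first \<open>S\<close>, then \<open>T\<close>) is given by a pullback
  with projections \<open>x\<close> to \<open>S\<close> and \<open>a\<close> to \<open>T\<close>, and \<open>S \<circ> T\<close> by one with projections \<open>a'\<close> to \<open>T\<close> and
  \<open>x'\<close> to \<open>S\<close>. For a distributive law \<open>\<delta> : T \<circ> S \<rightarrow> S \<circ> T\<close>, this says that \<open>M\<close> is the composite monad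
  on \<open>S \<circ> T\<close>: its unit is built from the two units, and its multiplication is
  \<open>S T S T \<rightarrow> S S T T \<rightarrow> S T\<close>, where \<open>\<delta>\<close> is applied to the middle factors \<open>w\<close> and then the
  multiplications of \<open>T\<close> and \<open>S\<close> to the pairs \<open>u\<close> and \<open>v\<close>.
\<close>

definition composite_monad ::
    "('a, 'f, 'c) two_cat \<Rightarrow> 'f span_monad \<Rightarrow> 'f span_monad \<Rightarrow> 'f \<Rightarrow> 'f \<Rightarrow> 'f \<Rightarrow> 'f \<Rightarrow> 'f \<Rightarrow>
     'f span_monad \<Rightarrow> bool" where
  "composite_monad K T S x a a' x' \<delta> M \<longleftrightarrow>
     pullback K (rleg S) (lleg T) x a \<and>
     pullback K (rleg T) (lleg S) a' x' \<and>
     hom1 K \<delta> (Dom K x) (Dom K a') \<and>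
     lleg M = lleg T \<cdot>\<^bsub>K\<^esub> a' \<and> rleg M = rleg S \<cdot>\<^bsub>K\<^esub> x' \<and>
     pullback K (rleg M) (lleg M) (mfst M) (msnd M) \<and>
     hom1 K (munit M) (Cod K (lleg T)) (Dom K a') \<and>
     a' \<cdot>\<^bsub>K\<^esub> munit M = munit T \<and> x' \<cdot>\<^bsub>K\<^esub> munit M = munit S \<and>
     hom1 K (mmult M) (Dom K (mfst M)) (Dom K a') \<and>
     (\<exists>w u v.
        hom1 K w (Dom K (mfst M)) (Dom K x) \<and>
        x \<cdot>\<^bsub>K\<^esub> w = x' \<cdot>\<^bsub>K\<^esub> mfst M \<and> a \<cdot>\<^bsub>K\<^esub> w = a' \<cdot>\<^bsub>K\<^esub> msnd M \<and>
        hom1 K u (Dom K (mfst M)) (Dom K (mfst T)) \<and>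
        mfst T \<cdot>\<^bsub>K\<^esub> u = a' \<cdot>\<^bsub>K\<^esub> mfst M \<and> msnd T \<cdot>\<^bsub>K\<^esub> u = a' \<cdot>\<^bsub>K\<^esub> (\<delta> \<cdot>\<^bsub>K\<^esub> w) \<and>
        hom1 K v (Dom K (mfst M)) (Dom K (mfst S)) \<and>
        mfst S \<cdot>\<^bsub>K\<^esub> v = x' \<cdot>\<^bsub>K\<^esub> (\<delta> \<cdot>\<^bsub>K\<^esub> w) \<and> msnd S \<cdot>\<^bsub>K\<^esub> v = x' \<cdot>\<^bsub>K\<^esub> msnd M \<and>
        a' \<cdot>\<^bsub>K\<^esub> mmult M = mmult T \<cdot>\<^bsub>K\<^esub> u \<and> x' \<cdot>\<^bsub>K\<^esub> mmult M = mmult S \<cdot>\<^bsub>K\<^esub> v)"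

text \<open>
  For \<open>i : B' \<rightarrow> B\<close> and a monad \<open>M\<close> on \<open>B\<close>, this says that \<open>R\<close> is the monad \<open>i\<^sub>\<bullet> \<circ> M \<circ> i\<^sup>\<bullet>\<close> on \<open>B'\<close>
  obtained from the adjunction between \<open>i\<^sup>\<bullet>\<close> and \<open>i\<^sub>\<bullet>\<close>. Here \<open>b, m\<close> are the projections of \<open>M \<circ> i\<^sup>\<bullet>\<close>, and
  \<open>c, e\<close> those of \<open>i\<^sub>\<bullet> \<circ> (M \<circ> i\<^sup>\<bullet>)\<close>. The counit \<open>i\<^sup>\<bullet> \<circ> i\<^sub>\<bullet> \<rightarrow> 1\<close> is \<open>i\<close> itself, so it
  induces the map \<open>z : R \<circ> R \<rightarrow> M \<circ> M\<close> whose components are the projections to \<open>M\<close>.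
\<close>

definition restricted_monad ::
    "('a, 'f, 'c) two_cat \<Rightarrow> 'f \<Rightarrow> 'f span_monad \<Rightarrow> 'f span_monad \<Rightarrow> bool" where
  "restricted_monad K i M R \<longleftrightarrow>
     (\<exists>b m c e z.
        pullback K i (lleg M) b m \<and>
        pullback K (rleg M \<cdot>\<^bsub>K\<^esub> m) i c e \<and>
        lleg R = b \<cdot>\<^bsub>K\<^esub> c \<and> rleg R = e \<and>
        pullback K (rleg R) (lleg R) (mfst R) (msnd R) \<and>
        hom1 K (munit R) (Dom K i) (Dom K c) \<and>
        lleg R \<cdot>\<^bsub>K\<^esub> munit R = One K (Dom K i) \<and> rleg R \<cdot>\<^bsub>K\<^esub> munit R = One K (Dom K i) \<and>
        m \<cdot>\<^bsub>K\<^esub> (c \<cdot>\<^bsub>K\<^esub> munit R) = munit M \<cdot>\<^bsub>K\<^esub> i \<and>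
        hom1 K (mmult R) (Dom K (mfst R)) (Dom K c) \<and>
        lleg R \<cdot>\<^bsub>K\<^esub> mmult R = lleg R \<cdot>\<^bsub>K\<^esub> mfst R \<and> rleg R \<cdot>\<^bsub>K\<^esub> mmult R = rleg R \<cdot>\<^bsub>K\<^esub> msnd R \<and>
        hom1 K z (Dom K (mfst R)) (Dom K (mfst M)) \<and>
        mfst M \<cdot>\<^bsub>K\<^esub> z = m \<cdot>\<^bsub>K\<^esub> (c \<cdot>\<^bsub>K\<^esub> mfst R) \<and> msnd M \<cdot>\<^bsub>K\<^esub> z = m \<cdot>\<^bsub>K\<^esub> (c \<cdot>\<^bsub>K\<^esub> msnd R) \<and>
        m \<cdot>\<^bsub>K\<^esub> (c \<cdot>\<^bsub>K\<^esub> mmult R) = mmult M \<cdot>\<^bsub>K\<^esub> z)"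


section \<open>The internal 2-category of corners\<close>

text \<open>
  The category object \<open>n \<mapsto> A\<^sup>[\<^sup>n\<^sup>]\<close> of cotensors of \<open>A\<close>, whose simplicial structure is induced by the coface
  and codegeneracy maps between the ordinals, and where \<open>A\<^sup>[\<^sup>0\<^sup>] = A\<close>.
\<close>

definition coface :: "nat \<Rightarrow> nat \<Rightarrow> nat" where
  "coface i j = (if j < i then j else j + 1)"

definition codegen :: "nat \<Rightarrow> nat \<Rightarrow> nat" where
  "codegen i j = (if j \<le> i then j else j - 1)"

definition cotensor_nerve ::
    "('a, 'f, 'c) two_cat \<Rightarrow> 'a \<Rightarrow> ('a, 'f) simp \<Rightarrow> (nat \<Rightarrow> nat \<Rightarrow> nat \<Rightarrow> 'c) \<Rightarrow> bool" where
  "cotensor_nerve K A N c \<longleftrightarrow>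
     category_object K N \<and>
     level N 0 = A \<and> c 0 0 0 = cone K (One K A) \<and>
     (\<forall>n. cotensor K n A (level N n) (c n)) \<and>
     (\<forall>n i j k. i \<le> n + 1 \<longrightarrow> j \<le> k \<longrightarrow> k \<le> n \<longrightarrow>
        c n j k \<lhd>\<^bsub>K\<^esub> face N (n + 1) i = c (n + 1) (coface i j) (coface i k)) \<and>
     (\<forall>n i j k. i \<le> n \<longrightarrow> j \<le> k \<longrightarrow> k \<le> n + 1 \<longrightarrow>
        c (n + 1) j k \<lhd>\<^bsub>K\<^esub> degen N n i = c n (codegen i j) (codegen i k))"

text \<open>
  The map \<open>\<delta>\<^sub>X : X\<^sub>0\<^sup>[\<^sup>1\<^sup>] \<circ> X\<^sub>1 \<rightarrow> X\<^sub>1 \<circ> X\<^sub>0\<^sup>[\<^sup>1\<^sup>]\<close>. The projections of the two composite spans to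
  \<open>X\<^sub>0\<^sup>[\<^sup>1\<^sup>]\<close> are \<open>a1\<close> and \<open>a2\<close>. Whiskering them with the universal 2-cell \<open>c 1 0 1\<close> turns the composite
  spans into the comma objects \<open>d\<^sub>0 \<down> 1\<close> and \<open>1 \<down> d\<^sub>1\<close>, with 2-cells \<open>l1\<close> and \<open>l2\<close> below.
\<close>

definition crossing ::
    "('a, 'f, 'c) two_cat \<Rightarrow> ('a, 'f) simp \<Rightarrow> 'c set \<Rightarrow> ('a, 'f) simp \<Rightarrow>
     (nat \<Rightarrow> nat \<Rightarrow> nat \<Rightarrow> 'c) \<Rightarrow> 'f \<Rightarrow> 'f \<Rightarrow> 'f \<Rightarrow> 'f \<Rightarrow> 'f \<Rightarrow> bool" where
  "crossing K X \<Phi> N c p1 a1 a2 q2 \<delta> \<longleftrightarrow>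
     pullback K (face X 1 0) (face N 1 1) p1 a1 \<and>
     pullback K (face N 1 0) (face X 1 1) a2 q2 \<and>
     hom1 K \<delta> (Dom K p1) (Dom K a2) \<and>
     (let l1 = c 1 0 1 \<lhd>\<^bsub>K\<^esub> a1; p2 = face N 1 1 \<cdot>\<^bsub>K\<^esub> a2; l2 = c 1 0 1 \<lhd>\<^bsub>K\<^esub> a2 in
      \<exists>l3\<in>\<Phi>. csrc K l3 = p1 \<and> face X 1 0 \<rhd>\<^bsub>K\<^esub> l3 = l1 \<and>
        p2 \<cdot>\<^bsub>K\<^esub> \<delta> = face X 1 1 \<cdot>\<^bsub>K\<^esub> p1 \<and>
        q2 \<cdot>\<^bsub>K\<^esub> \<delta> = ctrg K l3 \<and>
        l2 \<lhd>\<^bsub>K\<^esub> \<delta> = face X 1 1 \<rhd>\<^bsub>K\<^esub> l3)"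

text \<open>
  Limits, hence \<open>Cnr(X)\<close>, are only determined up to isomorphism. So \<open>is_Cnr E X \<Phi> C\<close> says that
  the category object \<open>C\<close> in \<open>Cat E\<close> is \<open>Cnr(X)\<close> for some choice of the limits involved.
\<close>

definition is_Cnr ::
    "('o, 'm) cat \<Rightarrow> (('o, 'm) icat, ('o, 'm) ifun) simp \<Rightarrow> ('o, 'm) inat set \<Rightarrow>
     (('o, 'm) icat, ('o, 'm) ifun) simp \<Rightarrow> bool" where
  "is_Cnr E X \<Phi> C \<longleftrightarrow>
     category_object (Cat E) C \<and>
     level C 0 = disc E (C0 (level X 0)) \<and>
     (\<exists>N c p1 a1 a2 q2 \<delta> M.
        cotensor_nerve (Cat E) (level X 0) N c \<and>
        crossing (Cat E) X \<Phi> N c p1 a1 a2 q2 \<delta> \<and>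
        composite_monad (Cat E) (monad_of N) (monad_of X) p1 a1 a2 q2 \<delta> M \<and>
        restricted_monad (Cat E) (obj_incl E (level X 0)) M (monad_of C))"

end

theory Submission
  imports Defs
begin

text \<open>
  Codescent objects represent cocones and their morphisms, so it suffices to find a bijection between
  cocones of \<open>X\<close> and of \<open>Cnr(X)\<close> with a given vertex that is compatible with postcomposition and extends to
  morphisms of cocones. A cocone \<open>(f, \<phi>)\<close> of \<open>X\<close> restricts to the one sending a corner
  \<open>(a : x \<rightarrow> d\<^sub>1 h, h)\<close> to \<open>\<phi>(h) \<circ> f(a)\<close>. Conversely a cocone \<open>\<gamma>\<close> of \<open>Cnr(X)\<close> yields
  \<open>f(a : x \<rightarrow> x') = \<gamma>(a, s\<^sub>0 x')\<close> and \<open>\<phi>(h) = \<gamma>(1, h)\<close>. Functoriality of \<open>f\<close> holds because \<open>s\<^sub>0\<close>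
  preserves chosen opcartesian arrows. For the naturality of \<open>\<phi>\<close> at \<open>\<kappa> : h \<rightarrow> h'\<close> one factors \<open>\<kappa>\<close> through
  the chosen lift of \<open>d\<^sub>0 \<kappa>\<close>: the crossing computes the composite of \<open>(1, h)\<close> with the corner of \<open>d\<^sub>0 \<kappa>\<close>, and
  the remaining vertical factor is a 2-cell of \<open>Cnr(X)\<close>, which \<open>\<gamma>\<close> does not see.
\<close>

section \<open>Generalised elements of internal categories\<close>

text \<open>The two constructions are mutually inverse because a corner \<open>(a, h)\<close> is
  \<open>(a, s\<^sub>0)\<close> followed by \<open>(1, h)\<close>: crossing these two lifts an
  identity, and the chosen lift of an identity is an identity. That restriction respects composition
  of corners is the naturality of \<open>\<phi>\<close> at the chosen lift. The opcartesian property
  itself enters at one point, the vertical factor of \<open>\<kappa>\<close>. The base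
  \<open>E\<close> has no points, and \<open>Cnr(X)\<close> is known only through universal
  properties. Calculations are therefore made with arrows out of an arbitrary object of
  \<open>E\<close>: discrete internal categories as test objects turn strict 2-limits into
  statements about such arrows, and a map is recovered by evaluation at an identity. Since
  \<open>obj_incl\<close> is the identity on objects, a cocone and its restriction have the same
  object part, and a morphism of cocones keeps its component. The bijection fixes the vertex, so one
  and the same \<open>Q\<close> serves on both sides.\<close>

locale base =
  fixes E :: "('o, 'm) cat" (structure)
  assumes cat: "category E"
begin

lemma arr_iff: "arr E f a b \<longleftrightarrow> f \<in> Ar E \<and> Src E f = a \<and> Trg E f = b"
  using cat by (auto simp: arr_def category_def)

lemma Src_Ob [simp]: "f \<in> Ar E \<Longrightarrow> Src E f \<in> Ob E"
  and Trg_Ob [simp]: "f \<in> Ar E \<Longrightarrow> Trg E f \<in> Ob E"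
  using cat by (auto simp: category_def)

lemma Ide_simps [simp]:
  assumes "a \<in> Ob E"
  shows "Ide E a \<in> Ar E" "Src E (Ide E a) = a" "Trg E (Ide E a) = a"
  using cat assms unfolding category_def arr_def by blast+

lemma comp_simps [simp]:
  assumes "f \<in> Ar E" "g \<in> Ar E" "Src E g = Trg E f"
  shows "g \<bullet> f \<in> Ar E" "Src E (g \<bullet> f) = Src E f" "Trg E (g \<bullet> f) = Trg E g"
proof -
  have "arr E f (Src E f) (Trg E f)" "arr E g (Trg E f) (Trg E g)"
    using assms by (auto simp: arr_iff)
  then have "arr E (g \<bullet> f) (Src E f) (Trg E g)"
    using cat unfolding category_def by blast
  then show "g \<bullet> f \<in> Ar E" "Src E (g \<bullet> f) = Src E f" "Trg E (g \<bullet> f) = Trg E g"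
    by (auto simp: arr_iff)
qed

lemma comp_Ide [simp]:
  assumes "f \<in> Ar E"
  shows "Src E f = a \<Longrightarrow> f \<bullet> Ide E a = f" "Trg E f = b \<Longrightarrow> Ide E b \<bullet> f = f"
proof -
  have "arr E f (Src E f) (Trg E f)"
    using assms by (auto simp: arr_iff)
  then show "Src E f = a \<Longrightarrow> f \<bullet> Ide E a = f" "Trg E f = b \<Longrightarrow> Ide E b \<bullet> f = f"
    using cat unfolding category_def by blast+
qed

lemma comp_assoc [simp]:
  assumes "f \<in> Ar E" "g \<in> Ar E" "h \<in> Ar E" "Src E g = Trg E f" "Src E h = Trg E g"
  shows "(h \<bullet> g) \<bullet> f = h \<bullet> (g \<bullet> f)"
proof -
  have "arr E f (Src E f) (Trg E f)" "arr E g (Trg E f) (Trg E g)" "arr E h (Trg E g) (Trg E h)"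
    using assms by (auto simp: arr_iff)
  then show ?thesis
    using cat unfolding category_def by metis
qed

text \<open>Right-nested composites are the simp normal form, in which
  \<open>g \<bullet> f = h\<close> no longer matches once a further factor follows. This form
  carries the equation past such a factor.\<close>

lemma comp_reassoc:
  assumes "g \<bullet> f = h" "f \<in> Ar E" "g \<in> Ar E" "Src E g = Trg E f" "x \<in> Ar E" "Trg E x = Src E f"
  shows "g \<bullet> (f \<bullet> x) = h \<bullet> x"
  using assms comp_assoc[of x f g] by auto

text \<open>
  For an object \<open>t\<close> of the base category the arrows \<open>t \<rightarrow> C0 A\<close> and \<open>t \<rightarrow> C1 A\<close> are the objects and
  arrows of a category, with composition \<open>icomp\<close>. All calculations below take place there.
\<close>

context
  fixes A :: "('o, 'm) icat"
  assumes icat: "internal_category E A"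
begin

lemma pb: "is_pb E (itrg A) (isrc A) (pr1 A) (pr2 A)"
  using icat by (simp add: internal_category_def)

lemma structure_simps [simp]:
  "isrc A \<in> Ar E" "Src E (isrc A) = C1 A" "Trg E (isrc A) = C0 A"
  "itrg A \<in> Ar E" "Src E (itrg A) = C1 A" "Trg E (itrg A) = C0 A"
  "iunt A \<in> Ar E" "Src E (iunt A) = C0 A" "Trg E (iunt A) = C1 A"
  "imul A \<in> Ar E" "Src E (imul A) = C2 A" "Trg E (imul A) = C1 A"
  "pr1 A \<in> Ar E" "Src E (pr1 A) = C2 A" "Trg E (pr1 A) = C1 A"
  "pr2 A \<in> Ar E" "Src E (pr2 A) = C2 A" "Trg E (pr2 A) = C1 A"
  "C0 A \<in> Ob E" "C1 A \<in> Ob E" "C2 A \<in> Ob E"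
  using icat by (auto simp: internal_category_def arr_def)

lemma pr_eq: "itrg A \<bullet> pr1 A = isrc A \<bullet> pr2 A"
  using pb by (simp add: is_pb_def)

lemma structure_eqs [simp]:
  "isrc A \<bullet> iunt A = Ide E (C0 A)" "itrg A \<bullet> iunt A = Ide E (C0 A)"
  using icat by (auto simp: internal_category_def)

lemma iunt_eqs [simp]:
  assumes "x \<in> Ar E" "Trg E x = C0 A"
  shows "isrc A \<bullet> (iunt A \<bullet> x) = x" "itrg A \<bullet> (iunt A \<bullet> x) = x"
  using assms comp_reassoc[OF structure_eqs(1), of x] comp_reassoc[OF structure_eqs(2), of x]
  by auto

lemma pair_ex1:
  assumes "f \<in> Ar E" "g \<in> Ar E" "Trg E f = C1 A" "Trg E g = C1 A" "Src E g = Src E f"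
    and "itrg A \<bullet> f = isrc A \<bullet> g"
  shows "\<exists>!u. arr E u (Src E f) (C2 A) \<and> pr1 A \<bullet> u = f \<and> pr2 A \<bullet> u = g"
  using pb assms unfolding is_pb_def by (auto simp: arr_iff)

text \<open>By uniqueness of pairings any arrow with the two projections will do; this resolves the
  definite description in \<open>icomp\<close>.\<close>

lemma icomp_eqI:
  assumes "u \<in> Ar E" "Trg E u = C2 A" "pr1 A \<bullet> u = f" "pr2 A \<bullet> u = g"
  shows "icomp E A g f = imul A \<bullet> u"
proof -
  have f: "f \<in> Ar E" "Trg E f = C1 A" "Src E f = Src E u"
    and g: "g \<in> Ar E" "Trg E g = C1 A" "Src E g = Src E u"
    using assms by auto
  have "itrg A \<bullet> f = isrc A \<bullet> g"
    using comp_reassoc[OF pr_eq, of u] assms by auto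
  from pair_ex1[OF _ _ _ _ _ this] f g assms
  show ?thesis
    unfolding icomp_def by (auto intro!: arg_cong[where f = "(\<bullet>) (imul A)"] the1_equality simp: arr_iff)
qed

lemma icomp_pair:
  assumes "f \<in> Ar E" "g \<in> Ar E" "Trg E f = C1 A" "Trg E g = C1 A" "Src E g = Src E f"
    and "itrg A \<bullet> f = isrc A \<bullet> g"
  obtains u where "u \<in> Ar E" "Src E u = Src E f" "Trg E u = C2 A" "pr1 A \<bullet> u = f" "pr2 A \<bullet> u = g"
    "icomp E A g f = imul A \<bullet> u"
  using pair_ex1[OF assms] icomp_eqI by (auto simp: arr_iff)

lemma icomp_simps [simp]:
  assumes "f \<in> Ar E" "g \<in> Ar E" "Trg E f = C1 A" "Trg E g = C1 A" "Src E g = Src E f"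
    and "itrg A \<bullet> f = isrc A \<bullet> g"
  shows "icomp E A g f \<in> Ar E" "Src E (icomp E A g f) = Src E f" "Trg E (icomp E A g f) = C1 A"
    "isrc A \<bullet> icomp E A g f = isrc A \<bullet> f" "itrg A \<bullet> icomp E A g f = itrg A \<bullet> g"
proof -
  obtain u where u: "u \<in> Ar E" "Src E u = Src E f" "Trg E u = C2 A" "pr1 A \<bullet> u = f" "pr2 A \<bullet> u = g"
    "icomp E A g f = imul A \<bullet> u"
    using icomp_pair[OF assms] .
  then show "icomp E A g f \<in> Ar E" "Src E (icomp E A g f) = Src E f" "Trg E (icomp E A g f) = C1 A"
    by auto
  have "isrc A \<bullet> imul A = isrc A \<bullet> pr1 A" "itrg A \<bullet> imul A = itrg A \<bullet> pr2 A"
    using icat by (auto simp: internal_category_def)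
  from this[THEN comp_reassoc, of u] u
  show "isrc A \<bullet> icomp E A g f = isrc A \<bullet> f" "itrg A \<bullet> icomp E A g f = itrg A \<bullet> g"
    by auto
qed

text \<open>The pairing of \<open>f\<close> and \<open>g\<close> precomposed with \<open>x\<close>
  is the pairing of \<open>f \<bullet> x\<close> and \<open>g \<bullet> x\<close>. So equations move
  between stages, and it suffices to test them at generic elements.\<close>

lemma icomp_stage:
  assumes "f \<in> Ar E" "g \<in> Ar E" "Trg E f = C1 A" "Trg E g = C1 A" "Src E g = Src E f"
    and "itrg A \<bullet> f = isrc A \<bullet> g" and "x \<in> Ar E" "Trg E x = Src E f"
  shows "icomp E A g f \<bullet> x = icomp E A (g \<bullet> x) (f \<bullet> x)"
proof -
  obtain u where u: "u \<in> Ar E" "Src E u = Src E f" "Trg E u = C2 A" "pr1 A \<bullet> u = f" "pr2 A \<bullet> u = g"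
    "icomp E A g f = imul A \<bullet> u"
    using icomp_pair[OF assms(1-6)] .
  have "icomp E A (g \<bullet> x) (f \<bullet> x) = imul A \<bullet> (u \<bullet> x)"
    using u assms comp_reassoc[OF u(4), of x] comp_reassoc[OF u(5), of x] by (intro icomp_eqI) auto
  then show ?thesis
    using u assms by simp
qed

lemma icomp_unit:
  assumes "f \<in> Ar E" "Trg E f = C1 A"
  shows "isrc A \<bullet> f = x \<Longrightarrow> icomp E A f (iunt A \<bullet> x) = f"
    and "itrg A \<bullet> f = y \<Longrightarrow> icomp E A (iunt A \<bullet> y) f = f"
  using icat assms unfolding internal_category_def by (auto simp: arr_iff)

lemma icomp_assoc:
  assumes "f \<in> Ar E" "g \<in> Ar E" "h \<in> Ar E" "Trg E f = C1 A" "Trg E g = C1 A" "Trg E h = C1 A"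
    and "Src E g = Src E f" "Src E h = Src E f"
    and "itrg A \<bullet> f = isrc A \<bullet> g" "itrg A \<bullet> g = isrc A \<bullet> h"
  shows "icomp E A h (icomp E A g f) = icomp E A (icomp E A h g) f"
  using icat assms unfolding internal_category_def by (auto simp: arr_iff)

text \<open>The identity on \<open>C2 A\<close> is the pairing of the two projections, the generic
  composable pair.\<close>

lemma imul_eq: "imul A = icomp E A (pr2 A) (pr1 A)"
  using icomp_eqI[of "Ide E (C2 A)"] by simp

end

text \<open>Moves the brackets onto the two inner factors, which are the ones that a crossing
  exchanges in a composite of two corners.\<close>

lemma icomp_middle:
  assumes "internal_category E Z"
    and "a \<in> Ar E" "b \<in> Ar E" "c \<in> Ar E" "d \<in> Ar E"
    and "Trg E a = C1 Z" "Trg E b = C1 Z" "Trg E c = C1 Z" "Trg E d = C1 Z"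
    and "Src E b = Src E a" "Src E c = Src E a" "Src E d = Src E a"
    and "itrg Z \<bullet> a = isrc Z \<bullet> b" "itrg Z \<bullet> b = isrc Z \<bullet> c" "itrg Z \<bullet> c = isrc Z \<bullet> d"
  shows "icomp E Z (icomp E Z d c) (icomp E Z b a) = icomp E Z d (icomp E Z (icomp E Z c b) a)"
  using assms icomp_assoc[of Z a b c] icomp_assoc[of Z "icomp E Z b a" c d] by simp

section \<open>Internal functors on generalised elements\<close>

context
  fixes F :: "('o, 'm) ifun"
  assumes func: "internal_functor E F"
begin

lemma functor_simps [simp]:
  "internal_category E (fdom F)" "internal_category E (fcod F)"
  "F0 F \<in> Ar E" "Src E (F0 F) = C0 (fdom F)" "Trg E (F0 F) = C0 (fcod F)"
  "F1 F \<in> Ar E" "Src E (F1 F) = C1 (fdom F)" "Trg E (F1 F) = C1 (fcod F)"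
  using func by (auto simp: internal_functor_def Let_def arr_def)

lemma functor_eqs:
  "isrc (fcod F) \<bullet> F1 F = F0 F \<bullet> isrc (fdom F)" "itrg (fcod F) \<bullet> F1 F = F0 F \<bullet> itrg (fdom F)"
  "F1 F \<bullet> iunt (fdom F) = iunt (fcod F) \<bullet> F0 F"
  using func by (auto simp: internal_functor_def Let_def)

lemma functor_src_trg [simp]:
  assumes "fcod F = B" "f \<in> Ar E" "Trg E f = C1 (fdom F)"
  shows "isrc B \<bullet> (F1 F \<bullet> f) = F0 F \<bullet> (isrc (fdom F) \<bullet> f)"
    "itrg B \<bullet> (F1 F \<bullet> f) = F0 F \<bullet> (itrg (fdom F) \<bullet> f)"
  using assms comp_reassoc[OF functor_eqs(1), of f] comp_reassoc[OF functor_eqs(2), of f] by auto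

lemma functor_iunt [simp]:
  assumes "fdom F = A" "x \<in> Ar E" "Trg E x = C0 A"
  shows "F1 F \<bullet> (iunt A \<bullet> x) = iunt (fcod F) \<bullet> (F0 F \<bullet> x)"
  using assms comp_reassoc[OF functor_eqs(3), of x] by auto

lemma functor_icomp:
  assumes A: "fdom F = A" and f: "f \<in> Ar E" "g \<in> Ar E" "Trg E f = C1 A" "Trg E g = C1 A"
    "Src E g = Src E f" "itrg A \<bullet> f = isrc A \<bullet> g"
  shows "F1 F \<bullet> icomp E A g f = icomp E (fcod F) (F1 F \<bullet> g) (F1 F \<bullet> f)"
proof -
  have A': "internal_category E A"
    using A by auto
  obtain u where u: "u \<in> Ar E" "Src E u = Src E f" "Trg E u = C2 A" "pr1 A \<bullet> u = f" "pr2 A \<bullet> u = g"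
    "icomp E A g f = imul A \<bullet> u"
    using icomp_pair[OF A' f] .
  have "F1 F \<bullet> imul A = icomp E (fcod F) (F1 F \<bullet> pr2 A) (F1 F \<bullet> pr1 A)"
    using func A by (simp add: internal_functor_def Let_def)
  from comp_reassoc[OF this, of u]
  have "F1 F \<bullet> (imul A \<bullet> u) = icomp E (fcod F) (F1 F \<bullet> pr2 A) (F1 F \<bullet> pr1 A) \<bullet> u"
    using u A A' by auto
  also have "\<dots> = icomp E (fcod F) (F1 F \<bullet> g) (F1 F \<bullet> f)"
    using u A A' pr_eq[OF A'] by (subst icomp_stage) auto
  finally show ?thesis
    using u by simp
qed

end

text \<open>At the two projections the last premise becomes the composition law of the
  definition.\<close>

lemma internal_functorI:
  assumes AB: "internal_category E (fdom F)" "internal_category E (fcod F)"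
    and t: "F0 F \<in> Ar E" "Src E (F0 F) = C0 (fdom F)" "Trg E (F0 F) = C0 (fcod F)"
      "F1 F \<in> Ar E" "Src E (F1 F) = C1 (fdom F)" "Trg E (F1 F) = C1 (fcod F)"
    and e: "isrc (fcod F) \<bullet> F1 F = F0 F \<bullet> isrc (fdom F)"
      "itrg (fcod F) \<bullet> F1 F = F0 F \<bullet> itrg (fdom F)" "F1 F \<bullet> iunt (fdom F) = iunt (fcod F) \<bullet> F0 F"
    and c: "\<And>f g. f \<in> Ar E \<Longrightarrow> g \<in> Ar E \<Longrightarrow> Trg E f = C1 (fdom F) \<Longrightarrow> Trg E g = C1 (fdom F) \<Longrightarrow>
      Src E g = Src E f \<Longrightarrow> itrg (fdom F) \<bullet> f = isrc (fdom F) \<bullet> g \<Longrightarrow>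
      F1 F \<bullet> icomp E (fdom F) g f = icomp E (fcod F) (F1 F \<bullet> g) (F1 F \<bullet> f)"
  shows "internal_functor E F"
  using assms(1-11) c[of "pr1 (fdom F)" "pr2 (fdom F)"] imul_eq[of "fdom F"] pr_eq[of "fdom F"]
  unfolding internal_functor_def Let_def arr_iff by simp

section \<open>Internal natural transformations on generalised elements\<close>

context
  fixes \<alpha> :: "('o, 'm) inat"
  assumes nat: "internal_nat E \<alpha>"
begin

lemma nat_simps [simp]:
  "internal_functor E (nsrc \<alpha>)" "internal_functor E (ntrg \<alpha>)"
  "fdom (ntrg \<alpha>) = fdom (nsrc \<alpha>)" "fcod (ntrg \<alpha>) = fcod (nsrc \<alpha>)"
  "ncmp \<alpha> \<in> Ar E" "Src E (ncmp \<alpha>) = C0 (fdom (nsrc \<alpha>))" "Trg E (ncmp \<alpha>) = C1 (fcod (nsrc \<alpha>))"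
  using nat by (auto simp: internal_nat_def Let_def arr_def)

lemma nat_eqs:
  "isrc (fcod (nsrc \<alpha>)) \<bullet> ncmp \<alpha> = F0 (nsrc \<alpha>)" "itrg (fcod (nsrc \<alpha>)) \<bullet> ncmp \<alpha> = F0 (ntrg \<alpha>)"
  using nat by (auto simp: internal_nat_def Let_def)

lemma nat_src_trg [simp]:
  assumes "fcod (nsrc \<alpha>) = B" "x \<in> Ar E" "Trg E x = C0 (fdom (nsrc \<alpha>))"
  shows "isrc B \<bullet> (ncmp \<alpha> \<bullet> x) = F0 (nsrc \<alpha>) \<bullet> x" "itrg B \<bullet> (ncmp \<alpha> \<bullet> x) = F0 (ntrg \<alpha>) \<bullet> x"
  using assms comp_reassoc[OF nat_eqs(1), of x] comp_reassoc[OF nat_eqs(2), of x] by auto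

lemma nat_src_trg' [simp]:
  assumes "fcod (nsrc \<alpha>) = B"
  shows "isrc B \<bullet> ncmp \<alpha> = F0 (nsrc \<alpha>)" "itrg B \<bullet> ncmp \<alpha> = F0 (ntrg \<alpha>)"
  using assms nat_eqs by auto

text \<open>The square of the definition lives at the generic arrow; precomposition with
  \<open>f\<close> moves it to \<open>f\<close>. The endpoints are given by equations so that they
  can be supplied in simplified form.\<close>

lemma naturality:
  assumes AB: "fdom (nsrc \<alpha>) = A" "fcod (nsrc \<alpha>) = B" and f: "f \<in> Ar E" "Trg E f = C1 A"
    and xy: "isrc A \<bullet> f = x" "itrg A \<bullet> f = y"
  shows "icomp E B (ncmp \<alpha> \<bullet> y) (F1 (nsrc \<alpha>) \<bullet> f) = icomp E B (F1 (ntrg \<alpha>) \<bullet> f) (ncmp \<alpha> \<bullet> x)"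
proof -
  have A: "internal_category E A" "internal_category E B"
    using AB by auto
  have "icomp E B (ncmp \<alpha> \<bullet> itrg A) (F1 (nsrc \<alpha>)) = icomp E B (F1 (ntrg \<alpha>)) (ncmp \<alpha> \<bullet> isrc A)"
    using nat AB by (simp add: internal_nat_def Let_def)
  then have "icomp E B (ncmp \<alpha> \<bullet> itrg A) (F1 (nsrc \<alpha>)) \<bullet> f =
      icomp E B (F1 (ntrg \<alpha>)) (ncmp \<alpha> \<bullet> isrc A) \<bullet> f"
    by simp
  then show ?thesis
    using AB A f functor_eqs(1)[of "ntrg \<alpha>"] functor_eqs(2)[of "nsrc \<alpha>"]
    by (simp add: icomp_stage xy)
qed

end

lemma internal_natI:
  assumes "internal_functor E (nsrc \<alpha>)" "internal_functor E (ntrg \<alpha>)"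
    "fdom (ntrg \<alpha>) = fdom (nsrc \<alpha>)" "fcod (ntrg \<alpha>) = fcod (nsrc \<alpha>)"
    "ncmp \<alpha> \<in> Ar E" "Src E (ncmp \<alpha>) = C0 (fdom (nsrc \<alpha>))" "Trg E (ncmp \<alpha>) = C1 (fcod (nsrc \<alpha>))"
    "isrc (fcod (nsrc \<alpha>)) \<bullet> ncmp \<alpha> = F0 (nsrc \<alpha>)" "itrg (fcod (nsrc \<alpha>)) \<bullet> ncmp \<alpha> = F0 (ntrg \<alpha>)"
    and n: "\<And>f. f \<in> Ar E \<Longrightarrow> Trg E f = C1 (fdom (nsrc \<alpha>)) \<Longrightarrow>
      icomp E (fcod (nsrc \<alpha>)) (ncmp \<alpha> \<bullet> (itrg (fdom (nsrc \<alpha>)) \<bullet> f)) (F1 (nsrc \<alpha>) \<bullet> f) =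
      icomp E (fcod (nsrc \<alpha>)) (F1 (ntrg \<alpha>) \<bullet> f) (ncmp \<alpha> \<bullet> (isrc (fdom (nsrc \<alpha>)) \<bullet> f))"
  shows "internal_nat E \<alpha>"
  using assms(1-9) n[of "Ide E (C1 (fdom (nsrc \<alpha>)))"]
  unfolding internal_nat_def Let_def arr_iff by simp

section \<open>The 2-category of internal categories\<close>

lemma Cat_simps [simp]:
  "Obj (Cat E) = {A. internal_category E A}" "Mor (Cat E) = {F. internal_functor E F}"
  "Cel (Cat E) = {\<alpha>. internal_nat E \<alpha>}" "Dom (Cat E) = fdom" "Cod (Cat E) = fcod"
  "csrc (Cat E) = nsrc" "ctrg (Cat E) = ntrg"
  by (auto simp: Cat_def)

lemma hom1_Cat [simp]:
  "hom1 (Cat E) F A B \<longleftrightarrow> internal_functor E F \<and> fdom F = A \<and> fcod F = B"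
  by (auto simp: hom1_def)

lemma hom2_Cat [simp]:
  "hom2 (Cat E) \<phi> F G \<longleftrightarrow> internal_nat E \<phi> \<and> nsrc \<phi> = F \<and> ntrg \<phi> = G"
  by (auto simp: hom2_def)

lemma One_Cat_simps [simp]:
  "fdom (One (Cat E) A) = A" "fcod (One (Cat E) A) = A"
  "F0 (One (Cat E) A) = Ide E (C0 A)" "F1 (One (Cat E) A) = Ide E (C1 A)"
  by (auto simp: Cat_def)

lemma cmp_Cat_simps [simp]:
  "fdom (G \<cdot>\<^bsub>Cat E\<^esub> F) = fdom F" "fcod (G \<cdot>\<^bsub>Cat E\<^esub> F) = fcod G"
  "F0 (G \<cdot>\<^bsub>Cat E\<^esub> F) = F0 G \<bullet> F0 F" "F1 (G \<cdot>\<^bsub>Cat E\<^esub> F) = F1 G \<bullet> F1 F"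
  by (auto simp: Cat_def)

lemma cone_Cat_simps [simp]:
  "nsrc (cone (Cat E) F) = F" "ntrg (cone (Cat E) F) = F"
  "ncmp (cone (Cat E) F) = iunt (fcod F) \<bullet> F0 F"
  by (auto simp: Cat_def)

lemma vcmp_Cat_simps [simp]:
  "nsrc (\<beta> \<odot>\<^bsub>Cat E\<^esub> \<alpha>) = nsrc \<alpha>" "ntrg (\<beta> \<odot>\<^bsub>Cat E\<^esub> \<alpha>) = ntrg \<beta>"
  "ncmp (\<beta> \<odot>\<^bsub>Cat E\<^esub> \<alpha>) = icomp E (fcod (nsrc \<alpha>)) (ncmp \<beta>) (ncmp \<alpha>)"
  by (auto simp: Cat_def)

lemma lwhisk_Cat_simps [simp]:
  "nsrc (G \<rhd>\<^bsub>Cat E\<^esub> \<alpha>) = G \<cdot>\<^bsub>Cat E\<^esub> nsrc \<alpha>" "ntrg (G \<rhd>\<^bsub>Cat E\<^esub> \<alpha>) = G \<cdot>\<^bsub>Cat E\<^esub> ntrg \<alpha>"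
  "ncmp (G \<rhd>\<^bsub>Cat E\<^esub> \<alpha>) = F1 G \<bullet> ncmp \<alpha>"
  by (auto simp: Cat_def)

lemma rwhisk_Cat_simps [simp]:
  "nsrc (\<alpha> \<lhd>\<^bsub>Cat E\<^esub> F) = nsrc \<alpha> \<cdot>\<^bsub>Cat E\<^esub> F" "ntrg (\<alpha> \<lhd>\<^bsub>Cat E\<^esub> F) = ntrg \<alpha> \<cdot>\<^bsub>Cat E\<^esub> F"
  "ncmp (\<alpha> \<lhd>\<^bsub>Cat E\<^esub> F) = ncmp \<alpha> \<bullet> F0 F"
  by (auto simp: Cat_def)

lemma internal_functor_cmp [simp]:
  assumes "internal_functor E F" "internal_functor E G" "fdom G = fcod F"
  shows "internal_functor E (G \<cdot>\<^bsub>Cat E\<^esub> F)"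
  using assms
  by (intro internal_functorI) (auto simp: functor_eqs functor_icomp functor_eqs[THEN comp_reassoc])

lemma internal_nat_vcmp [simp]:
  assumes \<alpha>: "internal_nat E \<alpha>" and \<beta>: "internal_nat E \<beta>" and m: "nsrc \<beta> = ntrg \<alpha>"
  shows "internal_nat E (\<beta> \<odot>\<^bsub>Cat E\<^esub> \<alpha>)"
proof (rule internal_natI, goal_cases)
  \<comment> \<open>The tenth premise of \<open>internal_natI\<close> is naturality; the square is
    pasted from those of \<open>\<alpha>\<close> and \<open>\<beta>\<close>.\<close>
  case (10 f)
  let ?A = "fdom (nsrc \<alpha>)" and ?B = "fcod (nsrc \<alpha>)"
  have B: "internal_category E ?A" "internal_category E ?B"
    using \<alpha> by auto
  have f: "f \<in> Ar E" "Trg E f = C1 ?A"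
    using 10 by auto
  define x y where "x = isrc ?A \<bullet> f" "y = itrg ?A \<bullet> f"
  have "icomp E ?B (icomp E ?B (ncmp \<beta> \<bullet> y) (ncmp \<alpha> \<bullet> y)) (F1 (nsrc \<alpha>) \<bullet> f) =
      icomp E ?B (ncmp \<beta> \<bullet> y) (icomp E ?B (ncmp \<alpha> \<bullet> y) (F1 (nsrc \<alpha>) \<bullet> f))"
    using \<alpha> \<beta> m B f by (subst icomp_assoc) (auto simp: x_y_def)
  also have "icomp E ?B (ncmp \<alpha> \<bullet> y) (F1 (nsrc \<alpha>) \<bullet> f) = icomp E ?B (F1 (ntrg \<alpha>) \<bullet> f) (ncmp \<alpha> \<bullet> x)"
    using naturality[OF \<alpha> refl refl f] by (simp add: x_y_def)
  also have "icomp E ?B (ncmp \<beta> \<bullet> y) \<dots> =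
      icomp E ?B (icomp E ?B (ncmp \<beta> \<bullet> y) (F1 (ntrg \<alpha>) \<bullet> f)) (ncmp \<alpha> \<bullet> x)"
    using \<alpha> \<beta> m B f by (intro icomp_assoc) (auto simp: x_y_def)
  also have "icomp E ?B (ncmp \<beta> \<bullet> y) (F1 (ntrg \<alpha>) \<bullet> f) =
      icomp E ?B (F1 (ntrg \<beta>) \<bullet> f) (ncmp \<beta> \<bullet> x)"
    using naturality[OF \<beta>, of ?A ?B f x y] \<alpha> m f by (simp add: x_y_def)
  also have "icomp E ?B \<dots> (ncmp \<alpha> \<bullet> x) =
      icomp E ?B (F1 (ntrg \<beta>) \<bullet> f) (icomp E ?B (ncmp \<beta> \<bullet> x) (ncmp \<alpha> \<bullet> x))"
    using \<alpha> \<beta> m B f nat_simps(3,4)[OF \<beta>] by (subst icomp_assoc) (auto simp: x_y_def)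
  finally show ?case
    using \<alpha> \<beta> m B f by (simp add: icomp_stage x_y_def)
qed (use \<alpha> \<beta> m nat_simps(3,4)[OF \<beta>] in auto)

lemma internal_nat_lwhisk [simp]:
  assumes "internal_nat E \<alpha>" "internal_functor E G" "fdom G = fcod (nsrc \<alpha>)"
  shows "internal_nat E (G \<rhd>\<^bsub>Cat E\<^esub> \<alpha>)"
proof (rule internal_natI, goal_cases)
  case (10 f)
  let ?A = "fdom (nsrc \<alpha>)" and ?B = "fcod (nsrc \<alpha>)"
  have f: "f \<in> Ar E" "Trg E f = C1 ?A"
    using 10 by auto
  from naturality[OF assms(1) refl refl f]
  have "F1 G \<bullet> icomp E ?B (ncmp \<alpha> \<bullet> (itrg ?A \<bullet> f)) (F1 (nsrc \<alpha>) \<bullet> f) =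
      F1 G \<bullet> icomp E ?B (F1 (ntrg \<alpha>) \<bullet> f) (ncmp \<alpha> \<bullet> (isrc ?A \<bullet> f))"
    by simp
  then show ?case
    using assms f by (simp add: functor_icomp)
qed (use assms in \<open>auto simp: functor_eqs\<close>)

lemma internal_nat_rwhisk [simp]:
  assumes "internal_nat E \<alpha>" "internal_functor E F" "fcod F = fdom (nsrc \<alpha>)"
  shows "internal_nat E (\<alpha> \<lhd>\<^bsub>Cat E\<^esub> F)"
proof (rule internal_natI, goal_cases)
  case (10 f)
  then show ?case
    using assms naturality[OF assms(1) refl refl, of "F1 F \<bullet> f"] by simp
qed (use assms in auto)

end

lemma ifun_eqI:
  fixes F G :: "('o, 'm) ifun"
  assumes "fdom F = fdom G" "fcod F = fcod G" "F0 F = F0 G" "F1 F = F1 G"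
  shows "F = G"
  using assms by (cases F; cases G) auto

lemma inat_eqI:
  fixes \<alpha> \<beta> :: "('o, 'm) inat"
  assumes "nsrc \<alpha> = nsrc \<beta>" "ntrg \<alpha> = ntrg \<beta>" "ncmp \<alpha> = ncmp \<beta>"
  shows "\<alpha> = \<beta>"
  using assms by (cases \<alpha>; cases \<beta>) auto

lemma ex1_unique: "\<exists>!x. P x \<Longrightarrow> P x \<Longrightarrow> P y \<Longrightarrow> x = y"
  by blast

context base
begin

lemma disc_simps [simp]:
  "C0 (disc E a) = a" "C1 (disc E a) = a" "C2 (disc E a) = a"
  "isrc (disc E a) = Ide E a" "itrg (disc E a) = Ide E a" "iunt (disc E a) = Ide E a"
  "pr1 (disc E a) = Ide E a" "pr2 (disc E a) = Ide E a" "imul (disc E a) = Ide E a"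
  by (auto simp: disc_def)

lemma icomp_disc [simp]:
  assumes "f \<in> Ar E" "Trg E f = a"
  shows "icomp E (disc E a) f f = f"
proof -
  have "(THE u. arr E u (Src E f) a \<and> Ide E a \<bullet> u = f) = f"
    using assms by (intro the_equality) (auto simp: arr_iff)
  then show ?thesis
    using assms by (simp add: icomp_def)
qed

lemma internal_category_disc [simp]:
  assumes "a \<in> Ob E"
  shows "internal_category E (disc E a)"
proof -
  have "is_pb E (Ide E a) (Ide E a) (Ide E a) (Ide E a)"
    using assms by (auto simp: is_pb_def arr_iff)
  then show ?thesis
    using assms by (auto simp: internal_category_def arr_iff)
qed

text \<open>An object, respectively an arrow, of \<open>A\<close> at stage \<open>t\<close> is the same thing as a functor from the
  discrete category on \<open>t\<close> to \<open>A\<close>, respectively a natural transformation between such functors.\<close>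

definition pt :: "('o, 'm) icat \<Rightarrow> 'm \<Rightarrow> ('o, 'm) ifun" where
  "pt A x = \<lparr>fdom = disc E (Src E x), fcod = A, F0 = x, F1 = iunt A \<bullet> x\<rparr>"

definition cell :: "('o, 'm) icat \<Rightarrow> 'm \<Rightarrow> ('o, 'm) inat" where
  "cell A f = \<lparr>nsrc = pt A (isrc A \<bullet> f), ntrg = pt A (itrg A \<bullet> f), ncmp = f\<rparr>"

lemma pt_simps [simp]:
  "fdom (pt A x) = disc E (Src E x)" "fcod (pt A x) = A" "F0 (pt A x) = x" "F1 (pt A x) = iunt A \<bullet> x"
  by (auto simp: pt_def)

lemma pt_eq_iff [simp]: "pt A x = pt A y \<longleftrightarrow> x = y"
  by (metis pt_simps(3))

lemma cell_simps [simp]: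
  "nsrc (cell A f) = pt A (isrc A \<bullet> f)" "ntrg (cell A f) = pt A (itrg A \<bullet> f)" "ncmp (cell A f) = f"
  by (auto simp: cell_def)

lemma cell_eq_iff [simp]: "cell A f = cell A g \<longleftrightarrow> f = g"
  by (metis cell_simps(3))

lemma internal_functor_pt [simp]:
  assumes "internal_category E A" "x \<in> Ar E" "Trg E x = C0 A"
  shows "internal_functor E (pt A x)"
proof (rule internal_functorI, goal_cases)
  case (12 f g)
  \<comment> \<open>Source and target of \<open>disc\<close> are identities, so composable arrows
    coincide.\<close>
  then have "g = f"
    using assms by simp
  then show ?case
    using assms 12 icomp_unit(1)[OF assms(1), of "iunt A \<bullet> (x \<bullet> f)" "x \<bullet> f"] by simp
qed (use assms in auto)

lemma internal_nat_cell [simp]: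
  assumes "internal_category E A" "f \<in> Ar E" "Trg E f = C1 A"
  shows "internal_nat E (cell A f)"
  using assms by (intro internal_natI) (auto simp: icomp_unit)

text \<open>The unit map of \<open>disc E t\<close> is an identity, so preservation of units already
  forces the arrow part.\<close>

lemma functor_disc_eq:
  assumes "internal_functor E G" "fdom G = disc E t"
  shows "G = pt (fcod G) (F0 G)"
proof (rule ifun_eqI)
  have t: "Src E (F1 G) = t"
    using assms by auto
  then have "t \<in> Ob E"
    using assms(1) functor_simps(6) Src_Ob by blast
  then show "F1 G = F1 (pt (fcod G) (F0 G))"
    using functor_eqs(3)[OF assms(1)] assms by simp
qed (use assms in auto)

lemma nat_disc_eq:
  assumes "internal_nat E \<alpha>" "fdom (nsrc \<alpha>) = disc E t" "fcod (nsrc \<alpha>) = A"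
  shows "\<alpha> = cell A (ncmp \<alpha>)"
proof (rule inat_eqI)
  show "nsrc \<alpha> = nsrc (cell A (ncmp \<alpha>))" "ntrg \<alpha> = ntrg (cell A (ncmp \<alpha>))"
    using functor_disc_eq[of "nsrc \<alpha>"] functor_disc_eq[of "ntrg \<alpha>"] assms by auto
qed simp

lemma cmp_pt [simp]:
  assumes "internal_functor E G" "fdom G = A" "x \<in> Ar E" "Trg E x = C0 A"
  shows "G \<cdot>\<^bsub>Cat E\<^esub> pt A x = pt (fcod G) (F0 G \<bullet> x)"
  using assms by (intro ifun_eqI) auto

lemma lwhisk_cell [simp]:
  assumes "internal_functor E G" "fdom G = A" "f \<in> Ar E" "Trg E f = C1 A"
  shows "G \<rhd>\<^bsub>Cat E\<^esub> cell A f = cell (fcod G) (F1 G \<bullet> f)"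
  using assms by (intro inat_eqI) auto

lemma rwhisk_pt [simp]:
  assumes "internal_nat E \<alpha>" "fdom (nsrc \<alpha>) = A" "x \<in> Ar E" "Trg E x = C0 A"
  shows "\<alpha> \<lhd>\<^bsub>Cat E\<^esub> pt A x = cell (fcod (nsrc \<alpha>)) (ncmp \<alpha> \<bullet> x)"
  using assms by (intro inat_eqI) auto

lemma vcmp_cell [simp]:
  assumes "internal_category E A" "f \<in> Ar E" "g \<in> Ar E" "Trg E f = C1 A" "Trg E g = C1 A"
    "Src E g = Src E f" "itrg A \<bullet> f = isrc A \<bullet> g"
  shows "cell A g \<odot>\<^bsub>Cat E\<^esub> cell A f = cell A (icomp E A g f)"
  using assms by (intro inat_eqI) auto

lemma cone_pt [simp]:
  assumes "internal_category E A" "x \<in> Ar E" "Trg E x = C0 A"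
  shows "cone (Cat E) (pt A x) = cell A (iunt A \<bullet> x)"
  using assms by (intro inat_eqI) auto

lemma obj_incl_eq:
  assumes "internal_category E A"
  shows "obj_incl E A = pt A (Ide E (C0 A))"
  using assms by (auto simp: obj_incl_def pt_def)

section \<open>Limits in terms of generalised elements\<close>

context
  fixes f g p q
  assumes pullb: "pullback (Cat E) f g p q"
begin

lemma pullback_simps:
  "internal_functor E f" "internal_functor E g" "internal_functor E p" "internal_functor E q"
  "fcod g = fcod f" "fcod p = fdom f" "fdom q = fdom p" "fcod q = fdom g"
  using pullb by (simp_all add: pullback_def)

lemma pullback_eqs: "F0 f \<bullet> F0 p = F0 g \<bullet> F0 q" "F1 f \<bullet> F1 p = F1 g \<bullet> F1 q"
proof -
  have "f \<cdot>\<^bsub>Cat E\<^esub> p = g \<cdot>\<^bsub>Cat E\<^esub> q"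
    using pullb by (simp add: pullback_def)
  then show "F0 f \<bullet> F0 p = F0 g \<bullet> F0 q" "F1 f \<bullet> F1 p = F1 g \<bullet> F1 q"
    by (metis cmp_Cat_simps)+
qed

text \<open>The one-dimensional universal property, tested on the discrete category of the
  stage.\<close>

lemma pullback_obj:
  assumes "x \<in> Ar E" "y \<in> Ar E" "Trg E x = C0 (fdom f)" "Trg E y = C0 (fdom g)" "Src E y = Src E x"
    and "F0 f \<bullet> x = F0 g \<bullet> y"
  obtains u where "u \<in> Ar E" "Src E u = Src E x" "Trg E u = C0 (fdom p)" "F0 p \<bullet> u = x" "F0 q \<bullet> u = y"
proof -
  note [simp] = pullback_simps
  have "\<forall>Y a b. hom1 (Cat E) a Y (fdom f) \<longrightarrow> hom1 (Cat E) b Y (fdom g) \<longrightarrow>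
      f \<cdot>\<^bsub>Cat E\<^esub> a = g \<cdot>\<^bsub>Cat E\<^esub> b \<longrightarrow>
      (\<exists>!u. hom1 (Cat E) u Y (fdom p) \<and> p \<cdot>\<^bsub>Cat E\<^esub> u = a \<and> q \<cdot>\<^bsub>Cat E\<^esub> u = b)"
    using pullb unfolding pullback_def Cat_simps by blast
  from this[rule_format, of "pt (fdom f) x" "disc E (Src E x)" "pt (fdom g) y"] assms
  obtain w where w: "internal_functor E w" "fdom w = disc E (Src E x)" "fcod w = fdom p"
    "p \<cdot>\<^bsub>Cat E\<^esub> w = pt (fdom f) x" "q \<cdot>\<^bsub>Cat E\<^esub> w = pt (fdom g) y"
    by auto
  have "F0 p \<bullet> F0 w = x" "F0 q \<bullet> F0 w = y"
    using w(4,5) by (metis cmp_Cat_simps(3) pt_simps(3))+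
  then show ?thesis
    using that[of "F0 w"] w by simp
qed

lemma pullback_obj_eq:
  assumes "u \<in> Ar E" "v \<in> Ar E" "Trg E u = C0 (fdom p)" "Trg E v = C0 (fdom p)" "Src E u = Src E v"
    and "F0 p \<bullet> u = F0 p \<bullet> v" "F0 q \<bullet> u = F0 q \<bullet> v"
  shows "u = v"
proof -
  note [simp] = pullback_simps
  have *: "\<forall>Y a b. hom1 (Cat E) a Y (fdom f) \<longrightarrow> hom1 (Cat E) b Y (fdom g) \<longrightarrow>
      f \<cdot>\<^bsub>Cat E\<^esub> a = g \<cdot>\<^bsub>Cat E\<^esub> b \<longrightarrow>
      (\<exists>!u. hom1 (Cat E) u Y (fdom p) \<and> p \<cdot>\<^bsub>Cat E\<^esub> u = a \<and> q \<cdot>\<^bsub>Cat E\<^esub> u = b)"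
    using pullb unfolding pullback_def Cat_simps by blast
  have "\<exists>!w. hom1 (Cat E) w (disc E (Src E u)) (fdom p) \<and>
      p \<cdot>\<^bsub>Cat E\<^esub> w = pt (fdom f) (F0 p \<bullet> u) \<and> q \<cdot>\<^bsub>Cat E\<^esub> w = pt (fdom g) (F0 q \<bullet> u)"
    using assms(1,3) pullback_eqs(1)[THEN comp_reassoc, of u] by (intro *[rule_format]) simp_all
  then have "pt (fdom p) u = pt (fdom p) v"
    by (rule ex1_unique) (use assms in simp_all)
  then show ?thesis
    by simp
qed

text \<open>The two-dimensional universal property, tested on a discrete category: the 2-cell it
  provides is a generalised arrow between the prescribed objects.\<close>

lemma pullback_arr:
  assumes "a \<in> Ar E" "b \<in> Ar E" "Trg E a = C1 (fdom f)" "Trg E b = C1 (fdom g)" "Src E b = Src E a"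
    and "F1 f \<bullet> a = F1 g \<bullet> b"
    and "u \<in> Ar E" "Src E u = Src E a" "Trg E u = C0 (fdom p)"
    and "v \<in> Ar E" "Src E v = Src E a" "Trg E v = C0 (fdom p)"
    and "isrc (fdom f) \<bullet> a = F0 p \<bullet> u" "itrg (fdom f) \<bullet> a = F0 p \<bullet> v"
    and "isrc (fdom g) \<bullet> b = F0 q \<bullet> u" "itrg (fdom g) \<bullet> b = F0 q \<bullet> v"
  obtains \<chi> where "\<chi> \<in> Ar E" "Src E \<chi> = Src E a" "Trg E \<chi> = C1 (fdom p)"
    "isrc (fdom p) \<bullet> \<chi> = u" "itrg (fdom p) \<bullet> \<chi> = v" "F1 p \<bullet> \<chi> = a" "F1 q \<bullet> \<chi> = b"
proof -
  note [simp] = pullback_simps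
  have *: "\<forall>Y u v \<alpha> \<beta>. hom1 (Cat E) u Y (fdom p) \<longrightarrow> hom1 (Cat E) v Y (fdom p) \<longrightarrow>
        hom2 (Cat E) \<alpha> (p \<cdot>\<^bsub>Cat E\<^esub> u) (p \<cdot>\<^bsub>Cat E\<^esub> v) \<longrightarrow> hom2 (Cat E) \<beta> (q \<cdot>\<^bsub>Cat E\<^esub> u) (q \<cdot>\<^bsub>Cat E\<^esub> v) \<longrightarrow>
        f \<rhd>\<^bsub>Cat E\<^esub> \<alpha> = g \<rhd>\<^bsub>Cat E\<^esub> \<beta> \<longrightarrow>
        (\<exists>!\<chi>. hom2 (Cat E) \<chi> u v \<and> p \<rhd>\<^bsub>Cat E\<^esub> \<chi> = \<alpha> \<and> q \<rhd>\<^bsub>Cat E\<^esub> \<chi> = \<beta>)"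
    using pullb unfolding pullback_def Cat_simps by blast
  have "\<exists>!\<chi>. hom2 (Cat E) \<chi> (pt (fdom p) u) (pt (fdom p) v) \<and>
      p \<rhd>\<^bsub>Cat E\<^esub> \<chi> = cell (fdom f) a \<and> q \<rhd>\<^bsub>Cat E\<^esub> \<chi> = cell (fdom g) b"
    by (rule *[rule_format, of "pt (fdom p) u" "disc E (Src E a)"]) (use assms in simp_all)
  then obtain \<chi> where \<chi>: "internal_nat E \<chi>" "nsrc \<chi> = pt (fdom p) u" "ntrg \<chi> = pt (fdom p) v"
      "p \<rhd>\<^bsub>Cat E\<^esub> \<chi> = cell (fdom f) a" "q \<rhd>\<^bsub>Cat E\<^esub> \<chi> = cell (fdom g) b"
    by auto
  have "F1 p \<bullet> ncmp \<chi> = a" "F1 q \<bullet> ncmp \<chi> = b"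
    using \<chi>(4,5) by (metis lwhisk_Cat_simps(3) cell_simps(3))+
  then show ?thesis
    by (intro that[of "ncmp \<chi>"]) (use \<chi>(1-3) assms(7-12) in simp_all)
qed

end

section \<open>The cotensor with \<open>[1]\<close> as an object of arrows\<close>

context
  fixes A P c
  assumes cot: "cotensor (Cat E) 1 A P c"
begin

lemma cotensor_simps:
  "internal_nat E (c 0 1)" "nsrc (c 0 1) = nsrc (c 0 0)" "ntrg (c 0 1) = nsrc (c 1 1)"
  "internal_functor E (nsrc (c 0 0))" "fdom (nsrc (c 0 0)) = P" "fcod (nsrc (c 0 0)) = A"
  "internal_functor E (nsrc (c 1 1))" "fdom (nsrc (c 1 1)) = P" "fcod (nsrc (c 1 1)) = A"
  "internal_category E A" "internal_category E P"
  "c 0 0 = cone (Cat E) (nsrc (c 0 0))" "c 1 1 = cone (Cat E) (nsrc (c 1 1))"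
proof -
  have 1: "\<forall>j\<le>1. hom1 (Cat E) (csrc (Cat E) (c j j)) P A \<and> c j j = cone (Cat E) (csrc (Cat E) (c j j))"
    and 2: "\<forall>j k. j \<le> k \<longrightarrow> k \<le> 1 \<longrightarrow>
      hom2 (Cat E) (c j k) (csrc (Cat E) (c j j)) (csrc (Cat E) (c k k))"
    using cot[unfolded cotensor_def ord_functor_def, THEN conjunct1, THEN conjunct1]
      cot[unfolded cotensor_def ord_functor_def, THEN conjunct1, THEN conjunct2, THEN conjunct1]
    by - assumption+
  show "internal_nat E (c 0 1)" "nsrc (c 0 1) = nsrc (c 0 0)" "ntrg (c 0 1) = nsrc (c 1 1)"
    "internal_functor E (nsrc (c 0 0))" "fdom (nsrc (c 0 0)) = P" "fcod (nsrc (c 0 0)) = A"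
    "internal_functor E (nsrc (c 1 1))" "fdom (nsrc (c 1 1)) = P" "fcod (nsrc (c 1 1)) = A"
    using 1[rule_format, of 0] 1[rule_format, of 1] 2[rule_format, of 0 1] by auto
  then show "internal_category E A" "internal_category E P"
    using functor_simps(1,2)[of "nsrc (c 0 0)"] by auto
  show "c 0 0 = cone (Cat E) (nsrc (c 0 0))" "c 1 1 = cone (Cat E) (nsrc (c 1 1))"
    using 1[rule_format, of 0] 1[rule_format, of 1] by auto
qed

text \<open>A functor from \<open>[1]\<close> into the hom-category out of a discrete test object
  amounts to a generalised arrow \<open>a\<close>; \<open>e\<close> sends the two identities of
  \<open>[1]\<close> to the units at the ends of \<open>a\<close>.\<close>

lemma cotensor_ex1:
  assumes "a \<in> Ar E" "Trg E a = C1 A"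
  defines "x \<equiv> isrc A \<bullet> a" and "y \<equiv> itrg A \<bullet> a"
  shows "\<exists>!u. internal_functor E u \<and> fdom u = disc E (Src E a) \<and> fcod u = P \<and>
    c 0 0 \<lhd>\<^bsub>Cat E\<^esub> u = cell A (iunt A \<bullet> x) \<and> c 0 1 \<lhd>\<^bsub>Cat E\<^esub> u = cell A a \<and>
    c 1 1 \<lhd>\<^bsub>Cat E\<^esub> u = cell A (iunt A \<bullet> y)"
proof -
  \<comment> \<open>Rewriting the index \<open>1\<close> to \<open>Suc 0\<close> would keep the
    facts about \<open>c 0 1\<close> and \<open>c 1 1\<close> from matching.\<close>
  note [simp] = cotensor_simps(1-11) and [simp del] = One_nat_def
  define e where "e = (\<lambda>j k::nat. cell A (if j = k then iunt A \<bullet> (if j = 0 then x else y) else a))"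
  have le: "j \<le> k \<and> k \<le> 1 \<longleftrightarrow> (j, k) \<in> {(0, 0), (0, 1), (1, 1)}" for j k :: nat
    by auto
  have xy: "x \<in> Ar E" "y \<in> Ar E" "Trg E x = C0 A" "Trg E y = C0 A" "Src E x = Src E a" "Src E y = Src E a"
    using assms by auto
  have "ord_functor (Cat E) 1 (disc E (Src E a)) A e"
    unfolding ord_functor_def
  proof (intro conjI allI impI)
    fix j :: nat assume "j \<le> 1"
    then show "hom1 (Cat E) (csrc (Cat E) (e j j)) (disc E (Src E a)) A"
      and "e j j = cone (Cat E) (csrc (Cat E) (e j j))"
      using xy by (auto simp: e_def)
  next
    fix j k :: nat assume "j \<le> k" "k \<le> 1"
    with le have "(j, k) \<in> {(0, 0), (0, 1), (1, 1)}"
      by blast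
    then show "hom2 (Cat E) (e j k) (csrc (Cat E) (e j j)) (csrc (Cat E) (e k k))"
      using xy assms by (auto simp: e_def)
  next
    fix j k l :: nat assume "j \<le> k" "k \<le> l" "l \<le> 1"
    then have "(j, k, l) \<in> {(0, 0, 0), (0, 0, 1), (0, 1, 1), (1, 1, 1)}"
      by auto
    moreover have "isrc A \<bullet> a = x" "itrg A \<bullet> a = y"
      by (simp_all add: x_def y_def)
    moreover from this have "icomp E A a (iunt A \<bullet> x) = a" "icomp E A (iunt A \<bullet> y) a = a"
      using assms(1,2) icomp_unit[of A a] by auto
    moreover have "icomp E A (iunt A \<bullet> x) (iunt A \<bullet> x) = iunt A \<bullet> x"
      "icomp E A (iunt A \<bullet> y) (iunt A \<bullet> y) = iunt A \<bullet> y"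
      using xy icomp_unit[of A "iunt A \<bullet> x" x] icomp_unit[of A "iunt A \<bullet> y" y] by auto
    ultimately show "e k l \<odot>\<^bsub>Cat E\<^esub> e j k = e j l"
      using xy assms(1,2) by (elim insertE) (simp_all add: e_def)
  qed
  from cot[unfolded cotensor_def, THEN conjunct2, THEN conjunct1, rule_format, OF this]
  have "\<exists>!u. hom1 (Cat E) u (disc E (Src E a)) P \<and>
      (\<forall>j k. j \<le> k \<longrightarrow> k \<le> 1 \<longrightarrow> c j k \<lhd>\<^bsub>Cat E\<^esub> u = e j k)"
    by simp
  moreover have "(\<forall>j k. j \<le> k \<longrightarrow> k \<le> 1 \<longrightarrow> c j k \<lhd>\<^bsub>Cat E\<^esub> u = e j k) \<longleftrightarrow>
      c 0 0 \<lhd>\<^bsub>Cat E\<^esub> u = e 0 0 \<and> c 0 1 \<lhd>\<^bsub>Cat E\<^esub> u = e 0 1 \<and> c 1 1 \<lhd>\<^bsub>Cat E\<^esub> u = e 1 1" for u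
  proof (intro iffI allI impI conjI)
    fix j k :: nat
    assume "c 0 0 \<lhd>\<^bsub>Cat E\<^esub> u = e 0 0 \<and> c 0 1 \<lhd>\<^bsub>Cat E\<^esub> u = e 0 1 \<and> c 1 1 \<lhd>\<^bsub>Cat E\<^esub> u = e 1 1" "j \<le> k" "k \<le> 1"
    with le[of j k] show "c j k \<lhd>\<^bsub>Cat E\<^esub> u = e j k"
      by fastforce
  qed auto
  ultimately show ?thesis
    by (simp add: e_def)
qed

lemma cotensor_obj:
  assumes "a \<in> Ar E" "Trg E a = C1 A"
  obtains u where "u \<in> Ar E" "Src E u = Src E a" "Trg E u = C0 P" "ncmp (c 0 1) \<bullet> u = a"
proof -
  note [simp] = cotensor_simps(1-11) and [simp del] = One_nat_def
  obtain w where w: "internal_functor E w" "fdom w = disc E (Src E a)" "fcod w = P"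
    "c 0 1 \<lhd>\<^bsub>Cat E\<^esub> w = cell A a"
    using cotensor_ex1[OF assms] by blast
  have "ncmp (c 0 1) \<bullet> F0 w = a"
    using w(4) by (metis rwhisk_Cat_simps(3) cell_simps(3))
  then show ?thesis
    using that[of "F0 w"] w by simp
qed

lemma cotensor_obj_eq:
  assumes "u \<in> Ar E" "v \<in> Ar E" "Trg E u = C0 P" "Trg E v = C0 P" "Src E v = Src E u"
    and eq: "ncmp (c 0 1) \<bullet> u = ncmp (c 0 1) \<bullet> v"
  shows "u = v"
proof -
  note [simp] = cotensor_simps(1-11) and [simp del] = One_nat_def
  let ?a = "ncmp (c 0 1) \<bullet> u"
  have a: "?a \<in> Ar E" "Trg E ?a = C1 A"
    using assms by auto
  \<comment> \<open>Agreement on the universal 2-cell includes agreement on its source and target,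
    so all three conditions of \<open>cotensor_ex1\<close> hold for both objects.\<close>
  have eq': "F0 (nsrc (c 0 0)) \<bullet> v = F0 (nsrc (c 0 0)) \<bullet> u"
    "F0 (nsrc (c 1 1)) \<bullet> v = F0 (nsrc (c 1 1)) \<bullet> u"
    using nat_src_trg[of "c 0 1" A u] nat_src_trg[of "c 0 1" A v] assms(1-4) by (simp_all add: eq)
  have *: "internal_functor E (pt P w) \<and> fdom (pt P w) = disc E (Src E ?a) \<and> fcod (pt P w) = P \<and>
      c 0 0 \<lhd>\<^bsub>Cat E\<^esub> pt P w = cell A (iunt A \<bullet> (isrc A \<bullet> ?a)) \<and> c 0 1 \<lhd>\<^bsub>Cat E\<^esub> pt P w = cell A ?a \<and>
      c 1 1 \<lhd>\<^bsub>Cat E\<^esub> pt P w = cell A (iunt A \<bullet> (itrg A \<bullet> ?a))" if "w = u \<or> w = v" for w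
    using that assms(1-5) eq eq' by (subst cotensor_simps(12), subst cotensor_simps(13)) auto
  have "pt P u = pt P v"
    using cotensor_ex1[OF a] by (rule ex1_unique) (use *[of u] *[of v] in blast)+
  then show ?thesis
    by simp
qed

text \<open>An arrow of the cotensor is a commutative square in \<open>A\<close>: \<open>a\<close>
  and \<open>b\<close> are its sides over \<open>0\<close> and \<open>1\<close>, and
  \<open>sq\<close> says that it commutes.\<close>

lemma cotensor_arr:
  assumes "u \<in> Ar E" "v \<in> Ar E" "Trg E u = C0 P" "Trg E v = C0 P" "Src E v = Src E u"
    and "a \<in> Ar E" "b \<in> Ar E" "Trg E a = C1 A" "Trg E b = C1 A" "Src E a = Src E u" "Src E b = Src E u"
    and "isrc A \<bullet> a = F0 (nsrc (c 0 0)) \<bullet> u" "itrg A \<bullet> a = F0 (nsrc (c 0 0)) \<bullet> v"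
    and "isrc A \<bullet> b = F0 (nsrc (c 1 1)) \<bullet> u" "itrg A \<bullet> b = F0 (nsrc (c 1 1)) \<bullet> v"
    and sq: "icomp E A (ncmp (c 0 1) \<bullet> v) a = icomp E A b (ncmp (c 0 1) \<bullet> u)"
  obtains \<chi> where "\<chi> \<in> Ar E" "Src E \<chi> = Src E u" "Trg E \<chi> = C1 P" "isrc P \<bullet> \<chi> = u" "itrg P \<bullet> \<chi> = v"
    "F1 (nsrc (c 0 0)) \<bullet> \<chi> = a" "F1 (nsrc (c 1 1)) \<bullet> \<chi> = b"
proof -
  note [simp] = cotensor_simps(1-11) and [simp del] = One_nat_def
  define \<theta> where "\<theta> = (\<lambda>j::nat. cell A (if j = 0 then a else b))"
  have le: "j \<le> k \<and> k \<le> 1 \<longleftrightarrow> (j, k) \<in> {(0, 0), (0, 1), (1, 1)}" for j k :: nat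
    by auto
  have *: "\<forall>Y u v \<theta>. hom1 (Cat E) u Y P \<longrightarrow> hom1 (Cat E) v Y P \<longrightarrow>
        (\<forall>j\<le>1. hom2 (Cat E) (\<theta> j) (csrc (Cat E) (c j j) \<cdot>\<^bsub>Cat E\<^esub> u) (csrc (Cat E) (c j j) \<cdot>\<^bsub>Cat E\<^esub> v)) \<longrightarrow>
        (\<forall>j k. j \<le> k \<longrightarrow> k \<le> 1 \<longrightarrow>
           (c j k \<lhd>\<^bsub>Cat E\<^esub> v) \<odot>\<^bsub>Cat E\<^esub> \<theta> j = \<theta> k \<odot>\<^bsub>Cat E\<^esub> (c j k \<lhd>\<^bsub>Cat E\<^esub> u)) \<longrightarrow>
        (\<exists>!\<chi>. hom2 (Cat E) \<chi> u v \<and> (\<forall>j\<le>1. csrc (Cat E) (c j j) \<rhd>\<^bsub>Cat E\<^esub> \<chi> = \<theta> j))"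
    using cot[unfolded cotensor_def, THEN conjunct2, THEN conjunct2] .
  have "\<exists>!\<chi>. hom2 (Cat E) \<chi> (pt P u) (pt P v) \<and> (\<forall>j\<le>1. csrc (Cat E) (c j j) \<rhd>\<^bsub>Cat E\<^esub> \<chi> = \<theta> j)"
  proof (intro *[rule_format, of _ "disc E (Src E u)"])
    fix j :: nat assume "j \<le> 1"
    then have "j = 0 \<or> j = 1"
      by auto
    then show "hom2 (Cat E) (\<theta> j) (csrc (Cat E) (c j j) \<cdot>\<^bsub>Cat E\<^esub> pt P u) (csrc (Cat E) (c j j) \<cdot>\<^bsub>Cat E\<^esub> pt P v)"
      using assms(1-15) by (auto simp: \<theta>_def)
  next
    fix j k :: nat assume "j \<le> k" "k \<le> 1"
    with le have jk: "(j, k) \<in> {(0, 0), (0, 1), (1, 1)}"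
      by blast
    \<comment> \<open>The squares over the identities of \<open>[1]\<close> commute by the unit
      laws; only the one over \<open>0 \<le> 1\<close> needs \<open>sq\<close>.\<close>
    have "(c j j \<lhd>\<^bsub>Cat E\<^esub> pt P v) \<odot>\<^bsub>Cat E\<^esub> \<theta> j = \<theta> j \<odot>\<^bsub>Cat E\<^esub> (c j j \<lhd>\<^bsub>Cat E\<^esub> pt P u)"
      if "j = 0 \<or> j = 1" for j
    proof -
      have "c j j = cone (Cat E) (nsrc (c j j))"
        using that cotensor_simps(12,13) by blast
      moreover have "(cone (Cat E) (nsrc (c j j)) \<lhd>\<^bsub>Cat E\<^esub> pt P v) \<odot>\<^bsub>Cat E\<^esub> \<theta> j =
          \<theta> j \<odot>\<^bsub>Cat E\<^esub> (cone (Cat E) (nsrc (c j j)) \<lhd>\<^bsub>Cat E\<^esub> pt P u)"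
        using that assms(1-15) by (auto simp: \<theta>_def icomp_unit)
      ultimately show ?thesis
        by metis
    qed
    moreover have "(c 0 1 \<lhd>\<^bsub>Cat E\<^esub> pt P v) \<odot>\<^bsub>Cat E\<^esub> \<theta> 0 = \<theta> 1 \<odot>\<^bsub>Cat E\<^esub> (c 0 1 \<lhd>\<^bsub>Cat E\<^esub> pt P u)"
      using sq assms(1-15) by (auto simp: \<theta>_def)
    ultimately show "(c j k \<lhd>\<^bsub>Cat E\<^esub> pt P v) \<odot>\<^bsub>Cat E\<^esub> \<theta> j = \<theta> k \<odot>\<^bsub>Cat E\<^esub> (c j k \<lhd>\<^bsub>Cat E\<^esub> pt P u)"
      using jk cotensor_simps(12,13) by (auto)
  qed (use assms(1-5) in simp_all)
  then obtain \<chi> where \<chi>: "internal_nat E \<chi>" "nsrc \<chi> = pt P u" "ntrg \<chi> = pt P v"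
      "\<forall>j\<le>1. nsrc (c j j) \<rhd>\<^bsub>Cat E\<^esub> \<chi> = \<theta> j"
    by auto
  have "nsrc (c 0 0) \<rhd>\<^bsub>Cat E\<^esub> \<chi> = cell A a" "nsrc (c 1 1) \<rhd>\<^bsub>Cat E\<^esub> \<chi> = cell A b"
    using \<chi>(4)[rule_format, of 0] \<chi>(4)[rule_format, of 1] by (simp_all add: \<theta>_def)
  then have "F1 (nsrc (c 0 0)) \<bullet> ncmp \<chi> = a" "F1 (nsrc (c 1 1)) \<bullet> ncmp \<chi> = b"
    by (metis lwhisk_Cat_simps(3) cell_simps(3))+
  then show ?thesis
    using that[of "ncmp \<chi>"] \<chi>(1-3) assms(1-5) by simp
qed

end

lemma obj_incl_simps [simp]:
  "fdom (obj_incl E A) = disc E (C0 A)" "fcod (obj_incl E A) = A"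
  "F0 (obj_incl E A) = Ide E (C0 A)" "F1 (obj_incl E A) = iunt A"
  by (auto simp: obj_incl_def)

lemma internal_functor_obj_incl [simp]:
  "internal_category E A \<Longrightarrow> internal_functor E (obj_incl E A)"
  by (simp add: obj_incl_eq)

section \<open>Cocones\<close>

text \<open>Cocones for a simplicial object with \<open>d\<^sub>1, d\<^sub>0 = s, t\<close> and \<open>s\<^sub>0 = u\<close> in the lowest degree,
  and with \<open>d\<^sub>2, d\<^sub>0, d\<^sub>1 = p, q, m\<close> in the next one.\<close>

definition cocone_on where
  "cocone_on A s t u p q m Z f0 f1 \<longleftrightarrow>
     internal_functor E f0 \<and> fdom f0 = A \<and> fcod f0 = Z \<and>
     internal_nat E f1 \<and> nsrc f1 = f0 \<cdot>\<^bsub>Cat E\<^esub> s \<and> ntrg f1 = f0 \<cdot>\<^bsub>Cat E\<^esub> t \<and>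
     f1 \<lhd>\<^bsub>Cat E\<^esub> u = cone (Cat E) f0 \<and>
     (f1 \<lhd>\<^bsub>Cat E\<^esub> q) \<odot>\<^bsub>Cat E\<^esub> (f1 \<lhd>\<^bsub>Cat E\<^esub> p) = f1 \<lhd>\<^bsub>Cat E\<^esub> m"

definition compatible where
  "compatible s t f0 f1 g0 g1 \<phi> \<longleftrightarrow> internal_nat E \<phi> \<and> nsrc \<phi> = f0 \<and> ntrg \<phi> = g0 \<and>
     (\<phi> \<lhd>\<^bsub>Cat E\<^esub> t) \<odot>\<^bsub>Cat E\<^esub> f1 = g1 \<odot>\<^bsub>Cat E\<^esub> (\<phi> \<lhd>\<^bsub>Cat E\<^esub> s)"

text \<open>The conditions involve levels 0 to 2 only. With the structure maps as parameters the
  same predicate serves for \<open>X\<close> and for \<open>Cnr(X)\<close>.\<close>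

definition codescent_on where
  "codescent_on A s t u p q m Q q0 q1 \<longleftrightarrow>
     cocone_on A s t u p q m Q q0 q1 \<and>
     (\<forall>Z f0 f1. cocone_on A s t u p q m Z f0 f1 \<longrightarrow>
        (\<exists>!f'. hom1 (Cat E) f' Q Z \<and> f' \<cdot>\<^bsub>Cat E\<^esub> q0 = f0 \<and> f' \<rhd>\<^bsub>Cat E\<^esub> q1 = f1)) \<and>
     (\<forall>Z f0 f1 g0 g1 \<phi> f' g'. cocone_on A s t u p q m Z f0 f1 \<longrightarrow> cocone_on A s t u p q m Z g0 g1 \<longrightarrow>
        compatible s t f0 f1 g0 g1 \<phi> \<longrightarrow>
        hom1 (Cat E) f' Q Z \<longrightarrow> f' \<cdot>\<^bsub>Cat E\<^esub> q0 = f0 \<longrightarrow> f' \<rhd>\<^bsub>Cat E\<^esub> q1 = f1 \<longrightarrow>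
        hom1 (Cat E) g' Q Z \<longrightarrow> g' \<cdot>\<^bsub>Cat E\<^esub> q0 = g0 \<longrightarrow> g' \<rhd>\<^bsub>Cat E\<^esub> q1 = g1 \<longrightarrow>
        (\<exists>!\<phi>'. hom2 (Cat E) \<phi>' f' g' \<and> \<phi>' \<lhd>\<^bsub>Cat E\<^esub> q0 = \<phi>))"

lemma cocone_iff_cocone_on:
  "cocone (Cat E) X Z f0 f1 \<longleftrightarrow> cocone_on (level X 0) (face X 1 1) (face X 1 0) (degen X 0 0)
     (face X 2 2) (face X 2 0) (face X 2 1) Z f0 f1"
  by (auto simp: cocone_def cocone_on_def)

lemma is_codescent_iff_codescent_on:
  "is_codescent (Cat E) X Q q0 q1 \<longleftrightarrow> codescent_on (level X 0) (face X 1 1) (face X 1 0) (degen X 0 0)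
     (face X 2 2) (face X 2 0) (face X 2 1) Q q0 q1"
proof -
  have "compatible (face X 1 1) (face X 1 0) f0 f1 g0 g1 \<phi> \<longleftrightarrow> hom2 (Cat E) \<phi> f0 g0 \<and>
     (\<phi> \<lhd>\<^bsub>Cat E\<^esub> face X 1 0) \<odot>\<^bsub>Cat E\<^esub> f1 = g1 \<odot>\<^bsub>Cat E\<^esub> (\<phi> \<lhd>\<^bsub>Cat E\<^esub> face X 1 1)" for f0 f1 g0 g1 \<phi>
    by (simp add: compatible_def)
  then show ?thesis
    unfolding is_codescent_def codescent_on_def cocone_iff_cocone_on
    by (simp only: conj_imp_eq_imp_imp imp_conjL)
qed

end

text \<open>The simplicial identities listed are those that make the unit and multiplication
  equations of a cocone well typed. The locale is used for \<open>X\<close>, for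
  \<open>Cnr(X)\<close> and for the cotensor nerve.\<close>

locale truncated_category = base E for E :: "('o, 'm) cat" (structure) +
  fixes A A1 A2 :: "('o, 'm) icat" and s t u p q m :: "('o, 'm) ifun"
  assumes category_simps [simp]:
    "internal_category E A" "internal_category E A1" "internal_category E A2"
    and face_simps [simp]:
    "internal_functor E s" "fdom s = A1" "fcod s = A"
    "internal_functor E t" "fdom t = A1" "fcod t = A"
    "internal_functor E u" "fdom u = A" "fcod u = A1"
    "internal_functor E p" "fdom p = A2" "fcod p = A1"
    "internal_functor E q" "fdom q = A2" "fcod q = A1"
    "internal_functor E m" "fdom m = A2" "fcod m = A1"
    and simplicial_eqs:
    "s \<cdot>\<^bsub>Cat E\<^esub> u = One (Cat E) A" "t \<cdot>\<^bsub>Cat E\<^esub> u = One (Cat E) A"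
    "t \<cdot>\<^bsub>Cat E\<^esub> p = s \<cdot>\<^bsub>Cat E\<^esub> q" "s \<cdot>\<^bsub>Cat E\<^esub> m = s \<cdot>\<^bsub>Cat E\<^esub> p" "t \<cdot>\<^bsub>Cat E\<^esub> m = t \<cdot>\<^bsub>Cat E\<^esub> q"
begin

lemma F0_eqs:
  "F0 s \<bullet> F0 u = Ide E (C0 A)" "F0 t \<bullet> F0 u = Ide E (C0 A)"
  "F0 t \<bullet> F0 p = F0 s \<bullet> F0 q" "F0 s \<bullet> F0 m = F0 s \<bullet> F0 p" "F0 t \<bullet> F0 m = F0 t \<bullet> F0 q"
  and F1_eqs:
  "F1 s \<bullet> F1 u = Ide E (C1 A)" "F1 t \<bullet> F1 u = Ide E (C1 A)"
  "F1 t \<bullet> F1 p = F1 s \<bullet> F1 q" "F1 s \<bullet> F1 m = F1 s \<bullet> F1 p" "F1 t \<bullet> F1 m = F1 t \<bullet> F1 q"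
  using simplicial_eqs[THEN arg_cong[where f = F0]] simplicial_eqs[THEN arg_cong[where f = F1]]
  by simp_all

lemma unit_eqs [simp]:
  assumes "x \<in> Ar E"
  shows "Trg E x = C0 A \<Longrightarrow> F0 s \<bullet> (F0 u \<bullet> x) = x" "Trg E x = C0 A \<Longrightarrow> F0 t \<bullet> (F0 u \<bullet> x) = x"
    "Trg E x = C1 A \<Longrightarrow> F1 s \<bullet> (F1 u \<bullet> x) = x" "Trg E x = C1 A \<Longrightarrow> F1 t \<bullet> (F1 u \<bullet> x) = x"
  using assms F0_eqs(1,2)[THEN comp_reassoc, of x] F1_eqs(1,2)[THEN comp_reassoc, of x] by auto

lemma mult_eqs [simp]:
  assumes "y \<in> Ar E" "Trg E y = C0 A2"
  shows "F0 t \<bullet> (F0 p \<bullet> y) = F0 s \<bullet> (F0 q \<bullet> y)" "F0 s \<bullet> (F0 m \<bullet> y) = F0 s \<bullet> (F0 p \<bullet> y)"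
    "F0 t \<bullet> (F0 m \<bullet> y) = F0 t \<bullet> (F0 q \<bullet> y)"
  using assms F0_eqs(3-5)[THEN comp_reassoc, of y] by auto

abbreviation "coc \<equiv> cocone_on A s t u p q m"

lemma cocone_simps:
  assumes "coc Z f0 f1"
  shows "internal_functor E f0" "fdom f0 = A" "fcod f0 = Z" "internal_category E Z"
  "internal_nat E f1" "nsrc f1 = f0 \<cdot>\<^bsub>Cat E\<^esub> s" "ntrg f1 = f0 \<cdot>\<^bsub>Cat E\<^esub> t"
  "ncmp f1 \<in> Ar E" "Src E (ncmp f1) = C0 A1" "Trg E (ncmp f1) = C1 Z"
  using assms nat_simps(5-7)[of f1] functor_simps(2)[of f0] by (auto simp: cocone_on_def)

context
  fixes Z f0 f1
  assumes coc: "coc Z f0 f1"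
  notes [simp] = cocone_simps[OF coc]
begin

lemma cocone_unit:
  assumes "x \<in> Ar E" "Trg E x = C0 A"
  shows "ncmp f1 \<bullet> (F0 u \<bullet> x) = iunt Z \<bullet> (F0 f0 \<bullet> x)"
proof -
  have "ncmp (f1 \<lhd>\<^bsub>Cat E\<^esub> u) = ncmp (cone (Cat E) f0)"
    using coc by (simp only: cocone_on_def)
  then have "ncmp f1 \<bullet> F0 u = iunt Z \<bullet> F0 f0"
    by simp
  from comp_reassoc[OF this, of x] show ?thesis
    using assms by simp
qed

lemma cocone_mult:
  assumes "y \<in> Ar E" "Trg E y = C0 A2"
  shows "icomp E Z (ncmp f1 \<bullet> (F0 q \<bullet> y)) (ncmp f1 \<bullet> (F0 p \<bullet> y)) = ncmp f1 \<bullet> (F0 m \<bullet> y)"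
proof -
  have "ncmp ((f1 \<lhd>\<^bsub>Cat E\<^esub> q) \<odot>\<^bsub>Cat E\<^esub> (f1 \<lhd>\<^bsub>Cat E\<^esub> p)) = ncmp (f1 \<lhd>\<^bsub>Cat E\<^esub> m)"
    using coc by (simp only: cocone_on_def)
  then have "icomp E Z (ncmp f1 \<bullet> F0 q) (ncmp f1 \<bullet> F0 p) \<bullet> y = (ncmp f1 \<bullet> F0 m) \<bullet> y"
    by simp
  then show ?thesis
    using assms F0_eqs(3) by (simp add: icomp_stage)
qed

lemma cocone_postcompose:
  assumes "internal_functor E h" "fdom h = Z"
  shows "coc (fcod h) (h \<cdot>\<^bsub>Cat E\<^esub> f0) (h \<rhd>\<^bsub>Cat E\<^esub> f1)"
proof -
  have "(h \<rhd>\<^bsub>Cat E\<^esub> f1) \<lhd>\<^bsub>Cat E\<^esub> u = cone (Cat E) (h \<cdot>\<^bsub>Cat E\<^esub> f0)"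
    using assms cocone_unit[of "Ide E (C0 A)"] F0_eqs F1_eqs by (intro inat_eqI ifun_eqI) simp_all
  moreover have "((h \<rhd>\<^bsub>Cat E\<^esub> f1) \<lhd>\<^bsub>Cat E\<^esub> q) \<odot>\<^bsub>Cat E\<^esub> ((h \<rhd>\<^bsub>Cat E\<^esub> f1) \<lhd>\<^bsub>Cat E\<^esub> p) =
      (h \<rhd>\<^bsub>Cat E\<^esub> f1) \<lhd>\<^bsub>Cat E\<^esub> m"
    using assms cocone_mult[of "Ide E (C0 A2)"] F0_eqs F1_eqs
    by (intro inat_eqI ifun_eqI) (simp_all add: functor_icomp[symmetric])
  moreover have "nsrc (h \<rhd>\<^bsub>Cat E\<^esub> f1) = (h \<cdot>\<^bsub>Cat E\<^esub> f0) \<cdot>\<^bsub>Cat E\<^esub> s" "ntrg (h \<rhd>\<^bsub>Cat E\<^esub> f1) = (h \<cdot>\<^bsub>Cat E\<^esub> f0) \<cdot>\<^bsub>Cat E\<^esub> t"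
    using assms by (auto intro!: ifun_eqI)
  ultimately show ?thesis
    using assms unfolding cocone_on_def by simp
qed

end

text \<open>A 2-cell is determined by its component and its boundary functors. The boundaries agree
  by the simplicial identities, so two equations between components remain.\<close>

lemma coconeI:
  assumes f0: "internal_functor E f0" "fdom f0 = A" "fcod f0 = Z"
    and f1: "internal_nat E f1" "nsrc f1 = f0 \<cdot>\<^bsub>Cat E\<^esub> s" "ntrg f1 = f0 \<cdot>\<^bsub>Cat E\<^esub> t"
    and unit: "ncmp f1 \<bullet> F0 u = iunt Z \<bullet> F0 f0"
    and mult: "icomp E Z (ncmp f1 \<bullet> F0 q) (ncmp f1 \<bullet> F0 p) = ncmp f1 \<bullet> F0 m"
  shows "coc Z f0 f1"
proof -
  have "f1 \<lhd>\<^bsub>Cat E\<^esub> u = cone (Cat E) f0"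
    using f0 f1 unit F0_eqs F1_eqs by (intro inat_eqI ifun_eqI) simp_all
  moreover have "(f1 \<lhd>\<^bsub>Cat E\<^esub> q) \<odot>\<^bsub>Cat E\<^esub> (f1 \<lhd>\<^bsub>Cat E\<^esub> p) = f1 \<lhd>\<^bsub>Cat E\<^esub> m"
    using f0 f1 mult F0_eqs F1_eqs by (intro inat_eqI ifun_eqI) simp_all
  ultimately show ?thesis
    using assms unfolding cocone_on_def by simp
qed

end

section \<open>Corners\<close>

text \<open>The interface to \<open>Cnr(X)\<close>: a generalised object of \<open>J = Cnr(X)\<^sub>1\<close> is a corner \<open>(a, h)\<close>, consisting of
  an arrow \<open>a\<close> of \<open>X\<^sub>0\<close> followed by an object \<open>h\<close> of \<open>X\<^sub>1\<close>. The two components are given by the 2-cell \<open>\<theta>\<close> and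
  by \<open>k\<close>. In \<open>corner_mult\<close>, \<open>f\<close> is the chosen lift by which the inner two of the four factors are crossed.\<close>

locale corners = base E +
  X: truncated_category E X0 X1 X2 s t u p q m +
  C: truncated_category E "disc E (C0 X0)" J J2 \<sigma> \<tau> \<epsilon> \<pi> \<rho> \<mu>
  for E :: "('o, 'm) cat" (structure) and X0 X1 X2 J J2 :: "('o, 'm) icat"
    and s t u p q m \<sigma> \<tau> \<epsilon> \<pi> \<rho> \<mu> :: "('o, 'm) ifun" +
  fixes \<Phi> :: "('o, 'm) inat set" and l r k :: "('o, 'm) ifun" and \<theta> :: "('o, 'm) inat"
  assumes degen_simps [simp]:
    "internal_functor E l" "fdom l = X1" "fcod l = X2"
    "internal_functor E r" "fdom r = X1" "fcod r = X2"
    and l_eqs: "p \<cdot>\<^bsub>Cat E\<^esub> l = u \<cdot>\<^bsub>Cat E\<^esub> s" "q \<cdot>\<^bsub>Cat E\<^esub> l = One (Cat E) X1" "m \<cdot>\<^bsub>Cat E\<^esub> l = One (Cat E) X1"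
    and r_eqs: "p \<cdot>\<^bsub>Cat E\<^esub> r = One (Cat E) X1" "q \<cdot>\<^bsub>Cat E\<^esub> r = u \<cdot>\<^bsub>Cat E\<^esub> t" "m \<cdot>\<^bsub>Cat E\<^esub> r = One (Cat E) X1"
    and X2_pullback: "pullback (Cat E) t s p q"
    and J2_pullback: "pullback (Cat E) \<tau> \<sigma> \<pi> \<rho>"
    and opfib: "split_opfibration (Cat E) t \<Phi>"
    and unit_opfib: "opfib_morphism (Cat E) (One (Cat E) X0) (cells_into (Cat E) X0) t \<Phi> u"
    and k_simps [simp]: "internal_functor E k" "fdom k = J" "fcod k = X1"
    and \<theta>_simps [simp]: "internal_nat E \<theta>" "nsrc \<theta> = obj_incl E X0 \<cdot>\<^bsub>Cat E\<^esub> \<sigma>" "ntrg \<theta> = s \<cdot>\<^bsub>Cat E\<^esub> k"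
    and t_k: "t \<cdot>\<^bsub>Cat E\<^esub> k = obj_incl E X0 \<cdot>\<^bsub>Cat E\<^esub> \<tau>"
    and corner_exists: "\<lbrakk>a \<in> Ar E; h \<in> Ar E; Trg E a = C1 X0; Trg E h = C0 X1; Src E h = Src E a;
      itrg X0 \<bullet> a = F0 s \<bullet> h\<rbrakk> \<Longrightarrow>
      \<exists>c. c \<in> Ar E \<and> Src E c = Src E a \<and> Trg E c = C0 J \<and> ncmp \<theta> \<bullet> c = a \<and> F0 k \<bullet> c = h"
    and corner_unique: "\<lbrakk>c \<in> Ar E; c' \<in> Ar E; Trg E c = C0 J; Trg E c' = C0 J; Src E c' = Src E c;
      ncmp \<theta> \<bullet> c = ncmp \<theta> \<bullet> c'; F0 k \<bullet> c = F0 k \<bullet> c'\<rbrakk> \<Longrightarrow> c = c'"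
    and corner_arrow: "\<lbrakk>c \<in> Ar E; c' \<in> Ar E; Trg E c = C0 J; Trg E c' = C0 J; Src E c' = Src E c;
      \<kappa> \<in> Ar E; Trg E \<kappa> = C1 X1; Src E \<kappa> = Src E c; isrc X1 \<bullet> \<kappa> = F0 k \<bullet> c; itrg X1 \<bullet> \<kappa> = F0 k \<bullet> c';
      F1 t \<bullet> \<kappa> = iunt X0 \<bullet> (F0 \<tau> \<bullet> c);
      icomp E X0 (F1 s \<bullet> \<kappa>) (ncmp \<theta> \<bullet> c) = ncmp \<theta> \<bullet> c'\<rbrakk> \<Longrightarrow>
      \<exists>\<chi>. \<chi> \<in> Ar E \<and> Src E \<chi> = Src E c \<and> Trg E \<chi> = C1 J \<and> isrc J \<bullet> \<chi> = c \<and> itrg J \<bullet> \<chi> = c'"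
    and corner_unit: "ncmp \<theta> \<bullet> F0 \<epsilon> = iunt X0" "F0 k \<bullet> F0 \<epsilon> = F0 u"
    and corner_mult: "\<lbrakk>w \<in> Ar E; Trg E w = C0 J2\<rbrakk> \<Longrightarrow>
      \<exists>f y. f \<in> Ar E \<and> Src E f = Src E w \<and> Trg E f = C1 X1 \<and> cell X1 f \<in> \<Phi> \<and>
        isrc X1 \<bullet> f = F0 k \<bullet> (F0 \<pi> \<bullet> w) \<and> F1 t \<bullet> f = ncmp \<theta> \<bullet> (F0 \<rho> \<bullet> w) \<and>
        y \<in> Ar E \<and> Src E y = Src E w \<and> Trg E y = C0 X2 \<and>
        F0 p \<bullet> y = itrg X1 \<bullet> f \<and> F0 q \<bullet> y = F0 k \<bullet> (F0 \<rho> \<bullet> w) \<and> F0 m \<bullet> y = F0 k \<bullet> (F0 \<mu> \<bullet> w) \<and>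
        icomp E X0 (F1 s \<bullet> f) (ncmp \<theta> \<bullet> (F0 \<pi> \<bullet> w)) = ncmp \<theta> \<bullet> (F0 \<mu> \<bullet> w)"
begin

text \<open>\<open>l\<close> and \<open>r\<close> are the degeneracies from \<open>X1\<close> to
  \<open>X2\<close>: they put a unit before, respectively after, \<open>h\<close>. They provide the
  composable pairs in which one factor is trivial.\<close>

lemma degen_eqs [simp]:
  assumes "h \<in> Ar E" "Trg E h = C0 X1"
  shows "F0 p \<bullet> (F0 l \<bullet> h) = F0 u \<bullet> (F0 s \<bullet> h)" "F0 q \<bullet> (F0 l \<bullet> h) = h" "F0 m \<bullet> (F0 l \<bullet> h) = h"
    "F0 p \<bullet> (F0 r \<bullet> h) = h" "F0 q \<bullet> (F0 r \<bullet> h) = F0 u \<bullet> (F0 t \<bullet> h)" "F0 m \<bullet> (F0 r \<bullet> h) = h"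
proof -
  have "F0 p \<bullet> F0 l = F0 u \<bullet> F0 s" "F0 q \<bullet> F0 l = Ide E (C0 X1)" "F0 m \<bullet> F0 l = Ide E (C0 X1)"
    "F0 p \<bullet> F0 r = Ide E (C0 X1)" "F0 q \<bullet> F0 r = F0 u \<bullet> F0 t" "F0 m \<bullet> F0 r = Ide E (C0 X1)"
    using l_eqs[THEN arg_cong[where f = F0]] r_eqs[THEN arg_cong[where f = F0]] by simp_all
  from this[THEN comp_reassoc, of h] assms
  show "F0 p \<bullet> (F0 l \<bullet> h) = F0 u \<bullet> (F0 s \<bullet> h)" "F0 q \<bullet> (F0 l \<bullet> h) = h" "F0 m \<bullet> (F0 l \<bullet> h) = h"
    "F0 p \<bullet> (F0 r \<bullet> h) = h" "F0 q \<bullet> (F0 r \<bullet> h) = F0 u \<bullet> (F0 t \<bullet> h)" "F0 m \<bullet> (F0 r \<bullet> h) = h"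
    by auto
qed

lemma \<theta>_typing [simp]:
  "ncmp \<theta> \<in> Ar E" "Src E (ncmp \<theta>) = C0 J" "Trg E (ncmp \<theta>) = C1 X0"
  using nat_simps(5-7)[OF \<theta>_simps(1)] by auto

lemma F0_t_k: "F0 t \<bullet> F0 k = F0 \<tau>" and F1_t_k: "F1 t \<bullet> F1 k = iunt X0 \<bullet> F1 \<tau>"
  using t_k[THEN arg_cong[where f = F0]] t_k[THEN arg_cong[where f = F1]] by simp_all

lemma t_k_eqs [simp]:
  assumes "x \<in> Ar E"
  shows "Trg E x = C0 J \<Longrightarrow> F0 t \<bullet> (F0 k \<bullet> x) = F0 \<tau> \<bullet> x"
    "Trg E x = C1 J \<Longrightarrow> F1 t \<bullet> (F1 k \<bullet> x) = iunt X0 \<bullet> (F1 \<tau> \<bullet> x)"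
  using assms F0_t_k[THEN comp_reassoc, of x] F1_t_k[THEN comp_reassoc, of x] by auto

text \<open>Only existence is available as a fact, hence the choice operator; by
  \<open>corner_unique\<close> the result does not depend on the choice.\<close>

definition corner :: "'m \<Rightarrow> 'm \<Rightarrow> 'm" where
  "corner a h = (SOME c. c \<in> Ar E \<and> Src E c = Src E a \<and> Trg E c = C0 J \<and> ncmp \<theta> \<bullet> c = a \<and> F0 k \<bullet> c = h)"

context
  fixes a h
  assumes ah: "a \<in> Ar E" "h \<in> Ar E" "Trg E a = C1 X0" "Trg E h = C0 X1" "Src E h = Src E a"
    "itrg X0 \<bullet> a = F0 s \<bullet> h"
begin

lemma corner_simps [simp]:
  "corner a h \<in> Ar E" "Src E (corner a h) = Src E a" "Trg E (corner a h) = C0 J"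
  "ncmp \<theta> \<bullet> corner a h = a" "F0 k \<bullet> corner a h = h"
  using someI_ex[OF corner_exists[OF ah]] unfolding corner_def by auto

lemma corner_legs [simp]:
  "F0 \<sigma> \<bullet> corner a h = isrc X0 \<bullet> a" "F0 \<tau> \<bullet> corner a h = F0 t \<bullet> h"
  using nat_src_trg(1)[of \<theta> X0 "corner a h"] t_k_eqs(1)[of "corner a h"] by simp_all

lemma corner_stage:
  assumes "x \<in> Ar E" "Trg E x = Src E a"
  shows "corner a h \<bullet> x = corner (a \<bullet> x) (h \<bullet> x)"
proof (rule corner_unique)
  have e: "itrg X0 \<bullet> (a \<bullet> x) = F0 s \<bullet> (h \<bullet> x)"
    using ah assms comp_reassoc[OF ah(6), of x] by auto
  have ax: "a \<bullet> x \<in> Ar E" "h \<bullet> x \<in> Ar E" "Trg E (a \<bullet> x) = C1 X0" "Trg E (h \<bullet> x) = C0 X1"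
    "Src E (h \<bullet> x) = Src E (a \<bullet> x)"
    using ah assms by auto
  \<comment> \<open>In this context \<open>corner_simps\<close> is tied to the fixed
    \<open>a\<close> and \<open>h\<close>, so the choice is unfolded again for the restricted
    pair.\<close>
  have "corner (a \<bullet> x) (h \<bullet> x) \<in> Ar E \<and> Src E (corner (a \<bullet> x) (h \<bullet> x)) = Src E (a \<bullet> x) \<and>
      Trg E (corner (a \<bullet> x) (h \<bullet> x)) = C0 J \<and> ncmp \<theta> \<bullet> corner (a \<bullet> x) (h \<bullet> x) = a \<bullet> x \<and>
      F0 k \<bullet> corner (a \<bullet> x) (h \<bullet> x) = h \<bullet> x"
    using someI_ex[OF corner_exists[OF ax e]] unfolding corner_def by simp
  then show "corner (a \<bullet> x) (h \<bullet> x) \<in> Ar E" "Trg E (corner (a \<bullet> x) (h \<bullet> x)) = C0 J"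
    "Src E (corner (a \<bullet> x) (h \<bullet> x)) = Src E (corner a h \<bullet> x)"
    "ncmp \<theta> \<bullet> (corner a h \<bullet> x) = ncmp \<theta> \<bullet> corner (a \<bullet> x) (h \<bullet> x)"
    "F0 k \<bullet> (corner a h \<bullet> x) = F0 k \<bullet> corner (a \<bullet> x) (h \<bullet> x)"
    using assms ah comp_reassoc[OF corner_simps(4), of x] comp_reassoc[OF corner_simps(5), of x]
    by simp_all
qed (use assms ah in simp_all)

end

text \<open>The two components are jointly injective. This recognises units and composites in
  \<open>Cnr(X)\<close> as corners.\<close>

lemma corner_eta:
  assumes "c \<in> Ar E" "Trg E c = C0 J"
  shows "corner (ncmp \<theta> \<bullet> c) (F0 k \<bullet> c) = c"
proof -
  have "ncmp \<theta> \<bullet> c \<in> Ar E" "F0 k \<bullet> c \<in> Ar E" "Trg E (ncmp \<theta> \<bullet> c) = C1 X0"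
    "Trg E (F0 k \<bullet> c) = C0 X1" "Src E (F0 k \<bullet> c) = Src E (ncmp \<theta> \<bullet> c)"
    "itrg X0 \<bullet> (ncmp \<theta> \<bullet> c) = F0 s \<bullet> (F0 k \<bullet> c)"
    using assms by simp_all
  note c = corner_simps[OF this]
  show ?thesis
    by (rule corner_unique) (use c assms in simp_all)
qed

section \<open>Chosen lifts at generalised elements\<close>

lemma lift_exists:
  assumes "h \<in> Ar E" "b \<in> Ar E" "Trg E h = C0 X1" "Trg E b = C1 X0" "Src E b = Src E h"
    and "isrc X0 \<bullet> b = F0 t \<bullet> h"
  obtains f where "f \<in> Ar E" "Src E f = Src E h" "Trg E f = C1 X1" "cell X1 f \<in> \<Phi>"
    "isrc X1 \<bullet> f = h" "F1 t \<bullet> f = b"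
proof -
  have "\<forall>Y a b \<beta>. hom1 (Cat E) a Y (fdom t) \<longrightarrow> hom2 (Cat E) \<beta> (t \<cdot>\<^bsub>Cat E\<^esub> a) b \<longrightarrow>
        (\<exists>!\<phi>. \<phi> \<in> \<Phi> \<and> nsrc \<phi> = a \<and> t \<rhd>\<^bsub>Cat E\<^esub> \<phi> = \<beta>)"
    using opfib by (simp add: split_opfibration_def)
  from this[rule_format, of "pt X1 h" "disc E (Src E h)" "cell X0 b"] assms
  obtain \<phi> where \<phi>: "\<phi> \<in> \<Phi>" "nsrc \<phi> = pt X1 h" "t \<rhd>\<^bsub>Cat E\<^esub> \<phi> = cell X0 b"
    by auto
  have n: "internal_nat E \<phi>"
    using opfib \<phi>(1) by (auto simp: split_opfibration_def cells_into_def)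
  have "F1 t \<bullet> ncmp \<phi> = b"
    using \<phi>(3) by (metis lwhisk_Cat_simps(3) cell_simps(3))
  moreover have "\<phi> = cell X1 (ncmp \<phi>)"
    using nat_disc_eq[OF n] \<phi>(2) by simp
  ultimately show ?thesis
    using that[of "ncmp \<phi>"] n \<phi> by simp
qed

lemma lift_unique:
  assumes "f \<in> Ar E" "g \<in> Ar E" "Src E g = Src E f" "Trg E f = C1 X1" "Trg E g = C1 X1"
    and "cell X1 f \<in> \<Phi>" "cell X1 g \<in> \<Phi>" "isrc X1 \<bullet> f = isrc X1 \<bullet> g" "F1 t \<bullet> f = F1 t \<bullet> g"
  shows "f = g"
proof -
  have "\<forall>Y a b \<beta>. hom1 (Cat E) a Y (fdom t) \<longrightarrow> hom2 (Cat E) \<beta> (t \<cdot>\<^bsub>Cat E\<^esub> a) b \<longrightarrow>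
        (\<exists>!\<phi>. \<phi> \<in> \<Phi> \<and> nsrc \<phi> = a \<and> t \<rhd>\<^bsub>Cat E\<^esub> \<phi> = \<beta>)"
    using opfib by (simp add: split_opfibration_def)
  from this[rule_format, of "pt X1 (isrc X1 \<bullet> f)" "disc E (Src E f)" "cell X0 (F1 t \<bullet> f)"]
  have "\<exists>!\<phi>. \<phi> \<in> \<Phi> \<and> nsrc \<phi> = pt X1 (isrc X1 \<bullet> f) \<and> t \<rhd>\<^bsub>Cat E\<^esub> \<phi> = cell X0 (F1 t \<bullet> f)"
    using assms(1,4) by simp
  then have "cell X1 f = cell X1 g"
    by (rule ex1_unique) (use assms in simp_all)
  then show ?thesis
    by simp
qed

text \<open>The universal property of \<open>f\<close> with an identity below: \<open>g\<close> has
  the same source and the same image under \<open>t\<close>, so it factors through \<open>f\<close>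
  by a vertical arrow.\<close>

lemma lift_opcartesian:
  assumes f: "f \<in> Ar E" "Trg E f = C1 X1" "cell X1 f \<in> \<Phi>"
    and g: "g \<in> Ar E" "Src E g = Src E f" "Trg E g = C1 X1" "isrc X1 \<bullet> g = isrc X1 \<bullet> f"
      "F1 t \<bullet> g = F1 t \<bullet> f"
  obtains \<chi> where "\<chi> \<in> Ar E" "Src E \<chi> = Src E f" "Trg E \<chi> = C1 X1" "isrc X1 \<bullet> \<chi> = itrg X1 \<bullet> f"
    "itrg X1 \<bullet> \<chi> = itrg X1 \<bullet> g" "F1 t \<bullet> \<chi> = iunt X0 \<bullet> (F0 t \<bullet> (itrg X1 \<bullet> f))" "icomp E X1 \<chi> f = g"
proof -
  have e: "F0 t \<bullet> (itrg X1 \<bullet> g) = F0 t \<bullet> (itrg X1 \<bullet> f)"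
    using arg_cong[OF g(5), of "(\<bullet>) (itrg X0)"] f(1,2) g(1,3) functor_src_trg(2)[of t X0] by (metis X.face_simps(4-6))
  let ?\<gamma> = "cell X0 (iunt X0 \<bullet> (F0 t \<bullet> (itrg X1 \<bullet> f)))"
  have "opcartesian (Cat E) t (cell X1 f)"
    using opfib f(3) by (simp add: split_opfibration_def)
  then have *: "\<forall>a \<psi> \<gamma>. hom2 (Cat E) \<psi> (nsrc (cell X1 f)) a \<longrightarrow>
      hom2 (Cat E) \<gamma> (t \<cdot>\<^bsub>Cat E\<^esub> ntrg (cell X1 f)) (t \<cdot>\<^bsub>Cat E\<^esub> a) \<longrightarrow>
      \<gamma> \<odot>\<^bsub>Cat E\<^esub> (t \<rhd>\<^bsub>Cat E\<^esub> cell X1 f) = t \<rhd>\<^bsub>Cat E\<^esub> \<psi> \<longrightarrow>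
      (\<exists>!\<chi>. hom2 (Cat E) \<chi> (ntrg (cell X1 f)) a \<and> t \<rhd>\<^bsub>Cat E\<^esub> \<chi> = \<gamma> \<and> \<chi> \<odot>\<^bsub>Cat E\<^esub> cell X1 f = \<psi>)"
    unfolding opcartesian_def by simp
  have "\<exists>!\<chi>. hom2 (Cat E) \<chi> (ntrg (cell X1 f)) (ntrg (cell X1 g)) \<and> t \<rhd>\<^bsub>Cat E\<^esub> \<chi> = ?\<gamma> \<and>
      \<chi> \<odot>\<^bsub>Cat E\<^esub> cell X1 f = cell X1 g"
    by (rule *[rule_format]) (use f g e icomp_unit(2)[of X0 "F1 t \<bullet> f"] in simp_all)
  then obtain \<chi> where \<chi>: "internal_nat E \<chi>" "nsrc \<chi> = pt X1 (itrg X1 \<bullet> f)" "ntrg \<chi> = pt X1 (itrg X1 \<bullet> g)"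
      "t \<rhd>\<^bsub>Cat E\<^esub> \<chi> = ?\<gamma>" "\<chi> \<odot>\<^bsub>Cat E\<^esub> cell X1 f = cell X1 g"
    by auto
  have "F1 t \<bullet> ncmp \<chi> = iunt X0 \<bullet> (F0 t \<bullet> (itrg X1 \<bullet> f))"
    using \<chi>(4) by (metis lwhisk_Cat_simps(3) cell_simps(3))
  moreover have "icomp E X1 (ncmp \<chi>) f = g"
    using arg_cong[OF \<chi>(5), of ncmp] by simp
  ultimately show ?thesis
    by (intro that[of "ncmp \<chi>"]) (use f \<chi>(1-3) in simp_all)
qed

lemma lift_id:
  assumes "h \<in> Ar E" "Trg E h = C0 X1"
  shows "cell X1 (iunt X1 \<bullet> h) \<in> \<Phi>"
proof -
  have "\<forall>Y a. hom1 (Cat E) a Y (fdom t) \<longrightarrow> cone (Cat E) a \<in> \<Phi>"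
    using opfib by (simp add: split_opfibration_def)
  from this[rule_format, of "pt X1 h" "disc E (Src E h)"] show ?thesis
    using assms by simp
qed

text \<open>For the identity opfibration every cell is chosen, so each
  \<open>F1 u \<bullet> b\<close> is the chosen lift of \<open>b\<close> at a unit.\<close>

lemma lift_unit:
  assumes "b \<in> Ar E" "Trg E b = C1 X0"
  shows "cell X1 (F1 u \<bullet> b) \<in> \<Phi>"
proof -
  have "\<forall>\<phi>\<in>cells_into (Cat E) X0. u \<rhd>\<^bsub>Cat E\<^esub> \<phi> \<in> \<Phi>"
    using unit_opfib by (simp add: opfib_morphism_def)
  moreover have "cell X0 b \<in> cells_into (Cat E) X0"
    using assms by (simp add: cells_into_def)
  ultimately show ?thesis
    using assms by fastforce
qed

section \<open>From cocones of \<open>X\<close> to cocones of \<open>Cnr(X)\<close>\<close>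

definition restrict :: "('o, 'm) ifun \<Rightarrow> ('o, 'm) inat \<Rightarrow> ('o, 'm) inat" where
  "restrict f0 f1 = (f1 \<lhd>\<^bsub>Cat E\<^esub> k) \<odot>\<^bsub>Cat E\<^esub> (f0 \<rhd>\<^bsub>Cat E\<^esub> \<theta>)"

context
  fixes Z f0 f1
  assumes coc: "X.coc Z f0 f1"
  notes [simp] = X.cocone_simps[OF coc]
begin

lemma ncmp_restrict: "ncmp (restrict f0 f1) = icomp E Z (ncmp f1 \<bullet> F0 k) (F1 f0 \<bullet> ncmp \<theta>)"
  by (simp add: restrict_def)

lemma restrict_eval:
  assumes "c \<in> Ar E" "Trg E c = C0 J"
  shows "ncmp (restrict f0 f1) \<bullet> c = icomp E Z (ncmp f1 \<bullet> (F0 k \<bullet> c)) (F1 f0 \<bullet> (ncmp \<theta> \<bullet> c))"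
  using assms by (simp add: ncmp_restrict icomp_stage)

lemma restrict_nat:
  "internal_nat E (restrict f0 f1)" "nsrc (restrict f0 f1) = (f0 \<cdot>\<^bsub>Cat E\<^esub> obj_incl E X0) \<cdot>\<^bsub>Cat E\<^esub> \<sigma>"
  "ntrg (restrict f0 f1) = (f0 \<cdot>\<^bsub>Cat E\<^esub> obj_incl E X0) \<cdot>\<^bsub>Cat E\<^esub> \<tau>"
proof -
  show "nsrc (restrict f0 f1) = (f0 \<cdot>\<^bsub>Cat E\<^esub> obj_incl E X0) \<cdot>\<^bsub>Cat E\<^esub> \<sigma>"
    "ntrg (restrict f0 f1) = (f0 \<cdot>\<^bsub>Cat E\<^esub> obj_incl E X0) \<cdot>\<^bsub>Cat E\<^esub> \<tau>"
    by (auto simp: restrict_def F0_t_k F1_t_k intro!: ifun_eqI)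
  show "internal_nat E (restrict f0 f1)"
    unfolding restrict_def by (rule internal_nat_vcmp) (auto intro: ifun_eqI)
qed

text \<open>For corners \<open>(a, h)\<close> and \<open>(b, h')\<close> the inner factors are
  \<open>f0\<close> at \<open>b\<close> and \<open>f1\<close> at \<open>h\<close>. Naturality of
  \<open>f1\<close> at the lift \<open>f\<close> of \<open>b\<close> exchanges them; afterwards the
  two parts from \<open>f1\<close> compose by the cocone law and those from \<open>f0\<close> by
  functoriality.\<close>

lemma restrict_mult:
  assumes w: "w \<in> Ar E" "Trg E w = C0 J2"
  shows "icomp E Z (ncmp (restrict f0 f1) \<bullet> (F0 \<rho> \<bullet> w)) (ncmp (restrict f0 f1) \<bullet> (F0 \<pi> \<bullet> w)) =
    ncmp (restrict f0 f1) \<bullet> (F0 \<mu> \<bullet> w)"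
proof -
  obtain f y where f: "f \<in> Ar E" "Src E f = Src E w" "Trg E f = C1 X1" "isrc X1 \<bullet> f = F0 k \<bullet> (F0 \<pi> \<bullet> w)"
      "F1 t \<bullet> f = ncmp \<theta> \<bullet> (F0 \<rho> \<bullet> w)"
    and y: "y \<in> Ar E" "Src E y = Src E w" "Trg E y = C0 X2" "F0 p \<bullet> y = itrg X1 \<bullet> f"
      "F0 q \<bullet> y = F0 k \<bullet> (F0 \<rho> \<bullet> w)" "F0 m \<bullet> y = F0 k \<bullet> (F0 \<mu> \<bullet> w)"
    and \<mu>: "icomp E X0 (F1 s \<bullet> f) (ncmp \<theta> \<bullet> (F0 \<pi> \<bullet> w)) = ncmp \<theta> \<bullet> (F0 \<mu> \<bullet> w)"
    using corner_mult[OF w] by blast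
  define a b where "a = ncmp \<theta> \<bullet> (F0 \<pi> \<bullet> w)" and "b = ncmp \<theta> \<bullet> (F0 \<rho> \<bullet> w)"
  define h h' where "h = F0 k \<bullet> (F0 \<pi> \<bullet> w)" and "h' = F0 k \<bullet> (F0 \<rho> \<bullet> w)"
  have ab: "a \<in> Ar E" "Src E a = Src E w" "Trg E a = C1 X0" "itrg X0 \<bullet> a = F0 s \<bullet> h"
     "b \<in> Ar E" "Src E b = Src E w" "Trg E b = C1 X0" "itrg X0 \<bullet> b = F0 s \<bullet> h'" "isrc X0 \<bullet> b = F0 t \<bullet> h"
    using w by (simp_all add: a_def b_def h_def h'_def)
  have h: "h \<in> Ar E" "Src E h = Src E w" "Trg E h = C0 X1" "h' \<in> Ar E" "Src E h' = Src E w" "Trg E h' = C0 X1"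
    using w by (simp_all add: h_def h'_def)
  have f': "isrc X1 \<bullet> f = h" "F1 t \<bullet> f = b"
    using f by (simp_all add: h_def b_def)
  \<comment> \<open>The end of the lift lies over the end of \<open>b\<close>, which makes it
    composable with \<open>h'\<close>.\<close>
  have ft: "F0 t \<bullet> (itrg X1 \<bullet> f) = F0 s \<bullet> h'"
    using arg_cong[OF f'(2), of "(\<bullet>) (itrg X0)"] f(1-3) ab(8) by simp
  have "icomp E Z (ncmp (restrict f0 f1) \<bullet> (F0 \<rho> \<bullet> w)) (ncmp (restrict f0 f1) \<bullet> (F0 \<pi> \<bullet> w)) =
      icomp E Z (icomp E Z (ncmp f1 \<bullet> h') (F1 f0 \<bullet> b)) (icomp E Z (ncmp f1 \<bullet> h) (F1 f0 \<bullet> a))"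
    using w by (simp add: restrict_eval a_def b_def h_def h'_def)
  also have "\<dots> = icomp E Z (ncmp f1 \<bullet> h') (icomp E Z (icomp E Z (F1 f0 \<bullet> b) (ncmp f1 \<bullet> h)) (F1 f0 \<bullet> a))"
    using ab h by (intro icomp_middle) simp_all
  also have "icomp E Z (F1 f0 \<bullet> b) (ncmp f1 \<bullet> h) =
      icomp E Z (ncmp f1 \<bullet> (itrg X1 \<bullet> f)) (F1 f0 \<bullet> (F1 s \<bullet> f))"
    using naturality[of f1 X1 Z f h "itrg X1 \<bullet> f"] f(1-3) f' by simp
  also have "icomp E Z (ncmp f1 \<bullet> h')
        (icomp E Z (icomp E Z (ncmp f1 \<bullet> (itrg X1 \<bullet> f)) (F1 f0 \<bullet> (F1 s \<bullet> f))) (F1 f0 \<bullet> a)) =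
      icomp E Z (icomp E Z (ncmp f1 \<bullet> h') (ncmp f1 \<bullet> (itrg X1 \<bullet> f)))
        (icomp E Z (F1 f0 \<bullet> (F1 s \<bullet> f)) (F1 f0 \<bullet> a))"
    using ab h f(1-3) f'(1) ft by (intro icomp_middle[symmetric]) simp_all
  also have "icomp E Z (ncmp f1 \<bullet> h') (ncmp f1 \<bullet> (itrg X1 \<bullet> f)) = ncmp f1 \<bullet> (F0 k \<bullet> (F0 \<mu> \<bullet> w))"
    using X.cocone_mult[OF coc y(1,3)] y(4-6) by (simp add: h'_def)
  also have "icomp E Z (F1 f0 \<bullet> (F1 s \<bullet> f)) (F1 f0 \<bullet> a) = F1 f0 \<bullet> (ncmp \<theta> \<bullet> (F0 \<mu> \<bullet> w))"
    using functor_icomp[of f0 X0 a "F1 s \<bullet> f"] ab f(1-3) f'(1) \<mu> by (simp add: a_def)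
  finally show ?thesis
    using w by (simp add: restrict_eval)
qed

lemma restrict_cocone: "C.coc Z (f0 \<cdot>\<^bsub>Cat E\<^esub> obj_incl E X0) (restrict f0 f1)"
proof (rule C.coconeI)
  show "ncmp (restrict f0 f1) \<bullet> F0 \<epsilon> = iunt Z \<bullet> F0 (f0 \<cdot>\<^bsub>Cat E\<^esub> obj_incl E X0)"
    using X.cocone_unit[OF coc, of "Ide E (C0 X0)"] corner_unit icomp_unit(1)[of Z "iunt Z \<bullet> F0 f0" "F0 f0"]
    by (simp add: restrict_eval functor_eqs(3)[of f0, simplified])
  show "icomp E Z (ncmp (restrict f0 f1) \<bullet> F0 \<rho>) (ncmp (restrict f0 f1) \<bullet> F0 \<pi>) =
      ncmp (restrict f0 f1) \<bullet> F0 \<mu>"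
    using restrict_mult[of "Ide E (C0 J2)"] by simp
qed (use restrict_nat in simp_all)

lemma restrict_postcompose:
  assumes "internal_functor E h" "fdom h = Z"
  shows "restrict (h \<cdot>\<^bsub>Cat E\<^esub> f0) (h \<rhd>\<^bsub>Cat E\<^esub> f1) = h \<rhd>\<^bsub>Cat E\<^esub> restrict f0 f1"
proof (rule inat_eqI)
  show "ncmp (restrict (h \<cdot>\<^bsub>Cat E\<^esub> f0) (h \<rhd>\<^bsub>Cat E\<^esub> f1)) = ncmp (h \<rhd>\<^bsub>Cat E\<^esub> restrict f0 f1)"
    using assms functor_icomp[of h Z "F1 f0 \<bullet> ncmp \<theta>" "ncmp f1 \<bullet> F0 k"] by (simp add: restrict_def)
qed (use assms in \<open>auto simp: restrict_def intro!: ifun_eqI\<close>)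

end

section \<open>From cocones of \<open>Cnr(X)\<close> to cocones of \<open>X\<close>\<close>

context
  fixes Z g0 g1
  assumes coc: "C.coc Z g0 g1"
  notes [simp] = C.cocone_simps[OF coc]
begin

lemma g0_typing [simp]: "F0 g0 \<in> Ar E" "Src E (F0 g0) = C0 X0" "Trg E (F0 g0) = C0 Z" "F1 g0 = iunt Z \<bullet> F0 g0"
proof -
  show *: "F0 g0 \<in> Ar E" "Src E (F0 g0) = C0 X0" "Trg E (F0 g0) = C0 Z"
    by simp_all
  show "F1 g0 = iunt Z \<bullet> F0 g0"
    using functor_disc_eq[of g0 "C0 X0"] by (metis C.cocone_simps(1-3) coc pt_simps(4))
qed

definition val :: "'m \<Rightarrow> 'm \<Rightarrow> 'm" where
  "val a h = ncmp g1 \<bullet> corner a h"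

context
  fixes a h
  assumes ah: "a \<in> Ar E" "h \<in> Ar E" "Trg E a = C1 X0" "Trg E h = C0 X1" "Src E h = Src E a"
    "itrg X0 \<bullet> a = F0 s \<bullet> h"
  notes [simp] = corner_simps[OF ah] corner_legs[OF ah]
begin

lemma val_simps [simp]:
  "val a h \<in> Ar E" "Src E (val a h) = Src E a" "Trg E (val a h) = C1 Z"
  "isrc Z \<bullet> val a h = F0 g0 \<bullet> (isrc X0 \<bullet> a)" "itrg Z \<bullet> val a h = F0 g0 \<bullet> (F0 t \<bullet> h)"
  using ah by (simp_all add: val_def)

lemma val_stage:
  assumes "x \<in> Ar E" "Trg E x = Src E a"
  shows "val a h \<bullet> x = val (a \<bullet> x) (h \<bullet> x)"
  using assms by (simp add: val_def corner_stage[OF ah])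

text \<open>A vertical \<open>\<kappa>\<close> gives an arrow \<open>\<chi>\<close> of
  \<open>J\<close> between the two corners. Both legs send \<open>\<chi>\<close> into a discrete
  category, so the other two sides of the naturality square of \<open>g1\<close> at
  \<open>\<chi>\<close> are identities.\<close>

lemma val_invariant:
  assumes \<kappa>: "\<kappa> \<in> Ar E" "Trg E \<kappa> = C1 X1" "Src E \<kappa> = Src E a" "isrc X1 \<bullet> \<kappa> = h"
    "F1 t \<bullet> \<kappa> = iunt X0 \<bullet> (F0 t \<bullet> h)"
  shows "val (icomp E X0 (F1 s \<bullet> \<kappa>) a) (itrg X1 \<bullet> \<kappa>) = val a h"
proof -
  let ?a' = "icomp E X0 (F1 s \<bullet> \<kappa>) a" and ?h' = "itrg X1 \<bullet> \<kappa>"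
  have a'h': "?a' \<in> Ar E" "?h' \<in> Ar E" "Trg E ?a' = C1 X0" "Trg E ?h' = C0 X1" "Src E ?h' = Src E ?a'"
    "itrg X0 \<bullet> ?a' = F0 s \<bullet> ?h'" "Src E ?a' = Src E a"
    using ah \<kappa> by simp_all
  note [simp] = corner_simps[OF a'h'(1-6)]
  obtain \<chi> where \<chi>: "\<chi> \<in> Ar E" "Src E \<chi> = Src E a" "Trg E \<chi> = C1 J" "isrc J \<bullet> \<chi> = corner a h"
    "itrg J \<bullet> \<chi> = corner ?a' ?h'"
    using corner_arrow[of "corner a h" "corner ?a' ?h'" \<kappa>] \<kappa> a'h' by auto
  \<comment> \<open>An arrow of a discrete category equals its own source and its own
    target.\<close>
  have "F1 \<sigma> \<bullet> \<chi> = F0 \<sigma> \<bullet> (isrc J \<bullet> \<chi>)" "F1 \<tau> \<bullet> \<chi> = F0 \<tau> \<bullet> (itrg J \<bullet> \<chi>)"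
    using functor_src_trg(1)[of \<sigma> "disc E (C0 X0)" \<chi>] functor_src_trg(2)[of \<tau> "disc E (C0 X0)" \<chi>] \<chi>(1-3)
    by simp_all
  moreover have "F0 \<tau> \<bullet> corner ?a' ?h' = F0 \<tau> \<bullet> corner a h"
    using functor_src_trg[of \<tau> "disc E (C0 X0)" \<chi>] \<chi> ah by simp
  ultimately have e: "F1 \<sigma> \<bullet> \<chi> = isrc X0 \<bullet> a" "F1 \<tau> \<bullet> \<chi> = F0 t \<bullet> h"
    using \<chi>(4,5) by simp_all
  have "icomp E Z (val ?a' ?h') (iunt Z \<bullet> (F0 g0 \<bullet> (isrc X0 \<bullet> a))) =
      icomp E Z (iunt Z \<bullet> (F0 g0 \<bullet> (F0 t \<bullet> h))) (val a h)"
    using naturality[of g1 J Z \<chi>, OF _ _ _ _ _ \<chi>(4,5)] \<chi>(1-3) by (simp add: e val_def)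
  moreover have "isrc Z \<bullet> val ?a' ?h' = F0 g0 \<bullet> (isrc X0 \<bullet> a)"
    using a'h' ah \<kappa> corner_legs(1)[OF a'h'(1-6)] by (simp add: val_def)
  moreover have "val ?a' ?h' \<in> Ar E" "Trg E (val ?a' ?h') = C1 Z"
    by (simp_all add: val_def)
  ultimately show ?thesis
    using icomp_unit(1)[of Z "val ?a' ?h'"] icomp_unit(2)[of Z "val a h"] by simp
qed

text \<open>\<open>corner_mult\<close> only asserts that some lift and some composable pair compute
  the product. Uniqueness of chosen lifts and of pairings in \<open>X2\<close> identifies them with
  \<open>f\<close> and \<open>y\<close>, so a product may be evaluated with whichever chosen lift is
  at hand.\<close>

lemma val_comp:
  assumes f: "f \<in> Ar E" "Src E f = Src E a" "Trg E f = C1 X1" "isrc X1 \<bullet> f = h" "cell X1 f \<in> \<Phi>"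
    and y: "y \<in> Ar E" "Src E y = Src E a" "Trg E y = C0 X2" "F0 p \<bullet> y = itrg X1 \<bullet> f"
  shows "icomp E Z (val (F1 t \<bullet> f) (F0 q \<bullet> y)) (val a h) = val (icomp E X0 (F1 s \<bullet> f) a) (F0 m \<bullet> y)"
proof -
  let ?b = "F1 t \<bullet> f" and ?h' = "F0 q \<bullet> y"
  have "F0 s \<bullet> ?h' = F0 t \<bullet> (itrg X1 \<bullet> f)"
    using X.mult_eqs(1)[OF y(1,3)] y(4) by simp
  then have bh': "?b \<in> Ar E" "?h' \<in> Ar E" "Trg E ?b = C1 X0" "Trg E ?h' = C0 X1" "Src E ?h' = Src E ?b"
    "itrg X0 \<bullet> ?b = F0 s \<bullet> ?h'"
    using f(1-3) y(1-3) by simp_all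
  note [simp] = corner_simps[OF bh'] corner_legs[OF bh']
  have "F0 \<tau> \<bullet> corner a h = F0 \<sigma> \<bullet> corner ?b ?h'"
    using f(1-4) by simp
  from pullback_obj[OF J2_pullback _ _ _ _ _ this]
  obtain w where w: "w \<in> Ar E" "Src E w = Src E a" "Trg E w = C0 J2" "F0 \<pi> \<bullet> w = corner a h"
      "F0 \<rho> \<bullet> w = corner ?b ?h'"
    using f(1-3) by auto
  have kw: "F0 k \<bullet> (F0 \<pi> \<bullet> w) = h" "ncmp \<theta> \<bullet> (F0 \<pi> \<bullet> w) = a"
    "F0 k \<bullet> (F0 \<rho> \<bullet> w) = ?h'" "ncmp \<theta> \<bullet> (F0 \<rho> \<bullet> w) = ?b"
    by (simp_all add: w(4,5))
  obtain f' y' where f': "f' \<in> Ar E" "Src E f' = Src E w" "Trg E f' = C1 X1" "isrc X1 \<bullet> f' = h"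
      "F1 t \<bullet> f' = ?b" "cell X1 f' \<in> \<Phi>"
    and y': "y' \<in> Ar E" "Src E y' = Src E w" "Trg E y' = C0 X2" "F0 p \<bullet> y' = itrg X1 \<bullet> f'"
      "F0 q \<bullet> y' = ?h'" "F0 m \<bullet> y' = F0 k \<bullet> (F0 \<mu> \<bullet> w)"
    and \<mu>: "icomp E X0 (F1 s \<bullet> f') a = ncmp \<theta> \<bullet> (F0 \<mu> \<bullet> w)"
    using corner_mult[OF w(1,3)] unfolding kw by blast
  have ff: "f' = f"
    by (rule lift_unique) (use f f' w(2) in simp_all)
  have "y' = y"
    by (rule pullback_obj_eq[OF X2_pullback]) (use y y' w(2) ff in simp_all)
  then have "corner (icomp E X0 (F1 s \<bullet> f) a) (F0 m \<bullet> y) = F0 \<mu> \<bullet> w"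
    using \<mu> y'(6) ff corner_eta[of "F0 \<mu> \<bullet> w"] w(1-3) by simp
  then show ?thesis
    using C.cocone_mult[OF coc w(1,3)] by (simp add: val_def w(4,5))
qed

end

lemma val_unit:
  assumes "x \<in> Ar E" "Trg E x = C0 X0"
  shows "val (iunt X0 \<bullet> x) (F0 u \<bullet> x) = iunt Z \<bullet> (F0 g0 \<bullet> x)"
proof -
  have "ncmp \<theta> \<bullet> (F0 \<epsilon> \<bullet> x) = iunt X0 \<bullet> x" "F0 k \<bullet> (F0 \<epsilon> \<bullet> x) = F0 u \<bullet> x"
    using corner_unit[THEN comp_reassoc, of x] assms by simp_all
  then have "corner (iunt X0 \<bullet> x) (F0 u \<bullet> x) = F0 \<epsilon> \<bullet> x"
    using corner_eta[of "F0 \<epsilon> \<bullet> x"] assms by simp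
  then show ?thesis
    using C.cocone_unit[OF coc, of x] assms by (simp add: val_def)
qed

definition ext_ver :: "'m \<Rightarrow> 'm" where
  "ext_ver a = val a (F0 u \<bullet> (itrg X0 \<bullet> a))"

definition ext_hor :: "'m \<Rightarrow> 'm" where
  "ext_hor h = val (iunt X0 \<bullet> (F0 s \<bullet> h)) h"

lemma ext_ver_simps [simp]:
  assumes "a \<in> Ar E" "Trg E a = C1 X0"
  shows "ext_ver a \<in> Ar E" "Src E (ext_ver a) = Src E a" "Trg E (ext_ver a) = C1 Z"
    "isrc Z \<bullet> ext_ver a = F0 g0 \<bullet> (isrc X0 \<bullet> a)" "itrg Z \<bullet> ext_ver a = F0 g0 \<bullet> (itrg X0 \<bullet> a)"
  using assms by (simp_all add: ext_ver_def)

lemma ext_hor_simps [simp]: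
  assumes "h \<in> Ar E" "Trg E h = C0 X1"
  shows "ext_hor h \<in> Ar E" "Src E (ext_hor h) = Src E h" "Trg E (ext_hor h) = C1 Z"
    "isrc Z \<bullet> ext_hor h = F0 g0 \<bullet> (F0 s \<bullet> h)" "itrg Z \<bullet> ext_hor h = F0 g0 \<bullet> (F0 t \<bullet> h)"
  using assms by (simp_all add: ext_hor_def)

lemma ext_stage:
  assumes "x \<in> Ar E"
  shows "a \<in> Ar E \<Longrightarrow> Trg E a = C1 X0 \<Longrightarrow> Trg E x = Src E a \<Longrightarrow> ext_ver a \<bullet> x = ext_ver (a \<bullet> x)"
    and "h \<in> Ar E \<Longrightarrow> Trg E h = C0 X1 \<Longrightarrow> Trg E x = Src E h \<Longrightarrow> ext_hor h \<bullet> x = ext_hor (h \<bullet> x)"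
  using assms by (simp_all add: ext_ver_def ext_hor_def val_stage)

lemma ext_unit:
  assumes "x \<in> Ar E" "Trg E x = C0 X0"
  shows "ext_ver (iunt X0 \<bullet> x) = iunt Z \<bullet> (F0 g0 \<bullet> x)" "ext_hor (F0 u \<bullet> x) = iunt Z \<bullet> (F0 g0 \<bullet> x)"
  using assms val_unit[OF assms] by (simp_all add: ext_ver_def ext_hor_def)

text \<open>The factorisation of a corner into a vertical and a horizontal one. The arrow to be
  lifted is an identity, so the lift \<open>?f\<close> is a unit, and \<open>l\<close> pairs the
  unit of \<open>X\<close> with \<open>h\<close>.\<close>

lemma val_eq_ext:
  assumes ah: "a \<in> Ar E" "h \<in> Ar E" "Trg E a = C1 X0" "Trg E h = C0 X1" "Src E h = Src E a"
    "itrg X0 \<bullet> a = F0 s \<bullet> h"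
  shows "icomp E Z (ext_hor h) (ext_ver a) = val a h"
proof -
  let ?f = "iunt X1 \<bullet> (F0 u \<bullet> (itrg X0 \<bullet> a))"
  have "icomp E Z (val (F1 t \<bullet> ?f) (F0 q \<bullet> (F0 l \<bullet> h))) (val a (F0 u \<bullet> (itrg X0 \<bullet> a))) =
      val (icomp E X0 (F1 s \<bullet> ?f) a) (F0 m \<bullet> (F0 l \<bullet> h))"
    by (rule val_comp) (use ah in \<open>simp_all add: lift_id\<close>)
  then show ?thesis
    using ah icomp_unit(2)[of X0 a] by (simp add: ext_hor_def ext_ver_def)
qed

lemma ext_ver_comp:
  assumes ab: "a \<in> Ar E" "b \<in> Ar E" "Trg E a = C1 X0" "Trg E b = C1 X0" "Src E b = Src E a"
    "itrg X0 \<bullet> a = isrc X0 \<bullet> b"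
  shows "icomp E Z (ext_ver b) (ext_ver a) = ext_ver (icomp E X0 b a)"
proof -
  \<comment> \<open>Both \<open>s\<close> and \<open>t\<close> send \<open>?f\<close> to
    \<open>b\<close>, so the crossing returns \<open>b\<close> unchanged; \<open>?y\<close> is a
    pair of units.\<close>
  let ?f = "F1 u \<bullet> b" and ?y = "F0 l \<bullet> (F0 u \<bullet> (itrg X0 \<bullet> b))"
  have "icomp E Z (val (F1 t \<bullet> ?f) (F0 q \<bullet> ?y)) (val a (F0 u \<bullet> (itrg X0 \<bullet> a))) =
      val (icomp E X0 (F1 s \<bullet> ?f) a) (F0 m \<bullet> ?y)"
    by (rule val_comp) (use ab in \<open>simp_all add: lift_unit\<close>)
  then show ?thesis
    using ab by (simp add: ext_ver_def)
qed

text \<open>The second corner has a trivial first component, so its crossing with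
  \<open>F0 p \<bullet> y\<close> lifts an identity and changes nothing.\<close>

lemma ext_hor_mult:
  assumes y: "y \<in> Ar E" "Trg E y = C0 X2"
  shows "icomp E Z (ext_hor (F0 q \<bullet> y)) (ext_hor (F0 p \<bullet> y)) = ext_hor (F0 m \<bullet> y)"
proof -
  let ?h = "F0 p \<bullet> y"
  let ?f = "iunt X1 \<bullet> ?h" and ?a = "iunt X0 \<bullet> (F0 s \<bullet> ?h)"
  have "icomp E Z (val (F1 t \<bullet> ?f) (F0 q \<bullet> y)) (val ?a ?h) = val (icomp E X0 (F1 s \<bullet> ?f) ?a) (F0 m \<bullet> y)"
    by (rule val_comp) (use y in \<open>simp_all add: lift_id\<close>)
  then show ?thesis
    using y icomp_unit(2)[of X0 ?a] by (simp add: ext_hor_def)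
qed

text \<open>Both sides of the naturality square agree with the corner \<open>(F1 s \<kappa>, itrg X1 \<kappa>)\<close>. For the
  second one the target leg of \<open>\<kappa>\<close> is lifted to a chosen opcartesian \<open>f\<close>; the comparison \<open>\<chi>\<close> from \<open>f\<close>
  to \<open>\<kappa>\<close> is a 2-cell of corners, on which the cocone is invariant.\<close>

lemma ext_natural:
  assumes \<kappa>: "\<kappa> \<in> Ar E" "Trg E \<kappa> = C1 X1"
  shows "icomp E Z (ext_hor (itrg X1 \<bullet> \<kappa>)) (ext_ver (F1 s \<bullet> \<kappa>)) =
    icomp E Z (ext_ver (F1 t \<bullet> \<kappa>)) (ext_hor (isrc X1 \<bullet> \<kappa>))"
proof -
  let ?h = "isrc X1 \<bullet> \<kappa>"
  let ?a = "iunt X0 \<bullet> (F0 s \<bullet> ?h)"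
  obtain f where f: "f \<in> Ar E" "Src E f = Src E \<kappa>" "Trg E f = C1 X1" "cell X1 f \<in> \<Phi>"
    "isrc X1 \<bullet> f = ?h" "F1 t \<bullet> f = F1 t \<bullet> \<kappa>"
    using lift_exists[of ?h "F1 t \<bullet> \<kappa>"] \<kappa> by auto
  obtain \<chi> where \<chi>: "\<chi> \<in> Ar E" "Src E \<chi> = Src E f" "Trg E \<chi> = C1 X1" "isrc X1 \<bullet> \<chi> = itrg X1 \<bullet> f"
    "itrg X1 \<bullet> \<chi> = itrg X1 \<bullet> \<kappa>" "F1 t \<bullet> \<chi> = iunt X0 \<bullet> (F0 t \<bullet> (itrg X1 \<bullet> f))" "icomp E X1 \<chi> f = \<kappa>"
    using lift_opcartesian[of f \<kappa>] f \<kappa> by metis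
  have ft: "F0 t \<bullet> (itrg X1 \<bullet> f) = F0 t \<bullet> (itrg X1 \<bullet> \<kappa>)"
    using arg_cong[OF f(6), of "(\<bullet>) (itrg X0)"] f(1,3) \<kappa> by simp
  \<comment> \<open>The corner in \<open>ext_ver (F1 t \<bullet> \<kappa>)\<close> has a unit as its
    second component; \<open>r\<close> supplies the pair of the end of \<open>f\<close> with
    it.\<close>
  let ?y = "F0 r \<bullet> (itrg X1 \<bullet> f)"
  have "icomp E Z (val (F1 t \<bullet> f) (F0 q \<bullet> ?y)) (val ?a ?h) = val (icomp E X0 (F1 s \<bullet> f) ?a) (F0 m \<bullet> ?y)"
    by (rule val_comp) (use f \<kappa> in simp_all)
  then have "icomp E Z (ext_ver (F1 t \<bullet> \<kappa>)) (ext_hor ?h) = val (F1 s \<bullet> f) (itrg X1 \<bullet> f)"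
    using f(1-3,5) \<kappa> ft icomp_unit(1)[of X0 "F1 s \<bullet> f"] by (simp add: ext_hor_def ext_ver_def f(6))
  also have "\<dots> = val (icomp E X0 (F1 s \<bullet> \<chi>) (F1 s \<bullet> f)) (itrg X1 \<bullet> \<chi>)"
    by (rule val_invariant[symmetric]) (use f(1-3) \<chi> in simp_all)
  also have "icomp E X0 (F1 s \<bullet> \<chi>) (F1 s \<bullet> f) = F1 s \<bullet> \<kappa>"
    using functor_icomp[of s X1 f \<chi>] f(1-3) \<chi> by simp
  also have "val (F1 s \<bullet> \<kappa>) (itrg X1 \<bullet> \<chi>) = icomp E Z (ext_hor (itrg X1 \<bullet> \<kappa>)) (ext_ver (F1 s \<bullet> \<kappa>))"
    unfolding \<chi>(5) by (rule val_eq_ext[symmetric]) (use \<kappa> in simp_all)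
  finally show ?thesis
    by simp
qed

lemma cocone_extends:
  obtains f0 f1 where "X.coc Z f0 f1" "f0 \<cdot>\<^bsub>Cat E\<^esub> obj_incl E X0 = g0" "restrict f0 f1 = g1"
proof
  \<comment> \<open>The maps are the values at the generic arrow of \<open>X0\<close> and the
    generic object of \<open>X1\<close>; by \<open>ext_stage\<close> they induce
    \<open>ext_ver\<close> and \<open>ext_hor\<close> at every stage.\<close>
  define f0 where "f0 = \<lparr>fdom = X0, fcod = Z, F0 = F0 g0, F1 = ext_ver (Ide E (C1 X0))\<rparr>"
  define f1 where "f1 = \<lparr>nsrc = f0 \<cdot>\<^bsub>Cat E\<^esub> s, ntrg = f0 \<cdot>\<^bsub>Cat E\<^esub> t, ncmp = ext_hor (Ide E (C0 X1))\<rparr>"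
  have f0_simps [simp]: "fdom f0 = X0" "fcod f0 = Z" "F0 f0 = F0 g0" "F1 f0 = ext_ver (Ide E (C1 X0))"
    and f1_simps [simp]: "nsrc f1 = f0 \<cdot>\<^bsub>Cat E\<^esub> s" "ntrg f1 = f0 \<cdot>\<^bsub>Cat E\<^esub> t" "ncmp f1 = ext_hor (Ide E (C0 X1))"
    by (simp_all add: f0_def f1_def)
  have ver: "ext_ver (Ide E (C1 X0)) \<bullet> a = ext_ver a" if "a \<in> Ar E" "Trg E a = C1 X0" for a
    using that ext_stage(1)[of a "Ide E (C1 X0)"] by simp
  have hor: "ext_hor (Ide E (C0 X1)) \<bullet> h = ext_hor h" if "h \<in> Ar E" "Trg E h = C0 X1" for h
    using that ext_stage(2)[of h "Ide E (C0 X1)"] by simp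
  have f0: "internal_functor E f0"
  proof (rule internal_functorI, goal_cases)
    case 11
    then show ?case
      using ext_unit(1)[of "Ide E (C0 X0)"] ver[of "iunt X0"] by simp
  next
    case (12 f g)
    then show ?case
      by (simp add: ver ext_ver_comp)
  qed simp_all
  have f1: "internal_nat E f1"
    by (rule internal_natI) (use f0 in \<open>simp_all add: ext_stage ext_natural\<close>)
  show coc': "X.coc Z f0 f1"
  proof (rule X.coconeI)
    show "ncmp f1 \<bullet> F0 u = iunt Z \<bullet> F0 f0"
      using ext_unit(2)[of "Ide E (C0 X0)"] hor[of "F0 u"] by simp
    show "icomp E Z (ncmp f1 \<bullet> F0 q) (ncmp f1 \<bullet> F0 p) = ncmp f1 \<bullet> F0 m"
      using ext_hor_mult[of "Ide E (C0 X2)"] by (simp add: hor)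
  qed (use f0 f1 in simp_all)
  show e: "f0 \<cdot>\<^bsub>Cat E\<^esub> obj_incl E X0 = g0"
    using ext_unit(1)[of "Ide E (C0 X0)"] ver[of "iunt X0"] by (intro ifun_eqI) simp_all
  show "restrict f0 f1 = g1"
  proof (rule inat_eqI)
    \<comment> \<open>\<open>ncmp \<theta>\<close> and \<open>F0 k\<close> are the components of the
      identity on \<open>C0 J\<close>, the generic corner.\<close>
    have "ncmp (restrict f0 f1) = val (ncmp \<theta>) (F0 k)"
      using val_eq_ext[of "ncmp \<theta>" "F0 k"] by (simp add: ncmp_restrict[OF coc'] ver hor)
    also have "\<dots> = ncmp g1"
      using corner_eta[of "Ide E (C0 J)"] by (simp add: val_def)
    finally show "ncmp (restrict f0 f1) = ncmp g1" .
  qed (simp_all add: restrict_nat[OF coc'] e)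
qed

end

section \<open>Recovering a cocone from its restriction\<close>

lemma restrict_corner_ver:
  assumes coc: "X.coc Z f0 f1" and a: "a \<in> Ar E" "Trg E a = C1 X0"
  shows "ncmp (restrict f0 f1) \<bullet> corner a (F0 u \<bullet> (itrg X0 \<bullet> a)) = F1 f0 \<bullet> a"
proof -
  note [simp] = X.cocone_simps[OF coc]
  show ?thesis
    using a X.cocone_unit[OF coc, of "itrg X0 \<bullet> a"] icomp_unit(2)[of Z "F1 f0 \<bullet> a"]
    by (simp add: restrict_eval[OF coc])
qed

lemma restrict_corner_hor:
  assumes coc: "X.coc Z f0 f1" and h: "h \<in> Ar E" "Trg E h = C0 X1"
  shows "ncmp (restrict f0 f1) \<bullet> corner (iunt X0 \<bullet> (F0 s \<bullet> h)) h = ncmp f1 \<bullet> h"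
proof -
  note [simp] = X.cocone_simps[OF coc]
  show ?thesis
    using h icomp_unit(1)[of Z "ncmp f1 \<bullet> h"] by (simp add: restrict_eval[OF coc])
qed

text \<open>The object part is unchanged by restriction. The vertical corner of the generic arrow
  gives back \<open>F1 f0\<close>, and the horizontal corner of the generic object gives back
  \<open>f1\<close>.\<close>

lemma restrict_inject:
  assumes coc: "X.coc Z f0 f1" "X.coc Z f0' f1'"
    and eq: "f0 \<cdot>\<^bsub>Cat E\<^esub> obj_incl E X0 = f0' \<cdot>\<^bsub>Cat E\<^esub> obj_incl E X0" "restrict f0 f1 = restrict f0' f1'"
  shows "f0 = f0'" "f1 = f1'"
proof -
  note [simp] = X.cocone_simps[OF coc(1)] X.cocone_simps[OF coc(2)]
  show *: "f0 = f0'"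
  proof (rule ifun_eqI)
    show "F0 f0 = F0 f0'"
      using arg_cong[OF eq(1), of F0] by simp
    show "F1 f0 = F1 f0'"
      using restrict_corner_ver[OF coc(1), of "Ide E (C1 X0)"]
        restrict_corner_ver[OF coc(2), of "Ide E (C1 X0)"] eq(2) by simp
  qed simp_all
  show "f1 = f1'"
  proof (rule inat_eqI)
    show "ncmp f1 = ncmp f1'"
      using restrict_corner_hor[OF coc(1), of "Ide E (C0 X1)"]
        restrict_corner_hor[OF coc(2), of "Ide E (C0 X1)"] eq(2) by simp
  qed (simp_all add: *)
qed

section \<open>Morphisms of cocones\<close>

context
  fixes Z f0 f1 g0 g1
  assumes f: "X.coc Z f0 f1" and g: "X.coc Z g0 g1"
  notes [simp] = X.cocone_simps[OF f] X.cocone_simps[OF g]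
begin

text \<open>The compatibility square of \<open>\<phi>\<close> at \<open>k\<close> is pasted with the
  naturality square of \<open>\<phi>\<close> at \<open>\<theta>\<close>.\<close>

lemma compatible_restrict:
  assumes \<phi>: "compatible s t f0 f1 g0 g1 \<phi>"
  shows "compatible \<sigma> \<tau> (f0 \<cdot>\<^bsub>Cat E\<^esub> obj_incl E X0) (restrict f0 f1) (g0 \<cdot>\<^bsub>Cat E\<^esub> obj_incl E X0)
    (restrict g0 g1) (\<phi> \<lhd>\<^bsub>Cat E\<^esub> obj_incl E X0)"
proof -
  have nat [simp]: "internal_nat E \<phi>" "nsrc \<phi> = f0" "ntrg \<phi> = g0"
    and e: "(\<phi> \<lhd>\<^bsub>Cat E\<^esub> t) \<odot>\<^bsub>Cat E\<^esub> f1 = g1 \<odot>\<^bsub>Cat E\<^esub> (\<phi> \<lhd>\<^bsub>Cat E\<^esub> s)"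
    using \<phi> by (auto simp: compatible_def)
  let ?v = "ncmp \<phi>"
  have v [simp]: "?v \<in> Ar E" "Src E ?v = C0 X0" "Trg E ?v = C1 Z"
    using nat_simps(5-7)[of \<phi>] by simp_all
  have "icomp E Z (?v \<bullet> F0 t) (ncmp f1) \<bullet> F0 k = icomp E Z (ncmp g1) (?v \<bullet> F0 s) \<bullet> F0 k"
    using arg_cong[OF e, of ncmp] by simp
  then have h: "icomp E Z (?v \<bullet> F0 \<tau>) (ncmp f1 \<bullet> F0 k) = icomp E Z (ncmp g1 \<bullet> F0 k) (?v \<bullet> (F0 s \<bullet> F0 k))"
    by (simp add: icomp_stage F0_t_k)
  have "icomp E Z (?v \<bullet> F0 \<tau>) (icomp E Z (ncmp f1 \<bullet> F0 k) (F1 f0 \<bullet> ncmp \<theta>)) =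
      icomp E Z (icomp E Z (?v \<bullet> F0 \<tau>) (ncmp f1 \<bullet> F0 k)) (F1 f0 \<bullet> ncmp \<theta>)"
    by (intro icomp_assoc) (simp_all add: F0_t_k)
  also have "\<dots> = icomp E Z (icomp E Z (ncmp g1 \<bullet> F0 k) (?v \<bullet> (F0 s \<bullet> F0 k))) (F1 f0 \<bullet> ncmp \<theta>)"
    by (simp only: h)
  also have "\<dots> = icomp E Z (ncmp g1 \<bullet> F0 k) (icomp E Z (?v \<bullet> (F0 s \<bullet> F0 k)) (F1 f0 \<bullet> ncmp \<theta>))"
    by (intro icomp_assoc[symmetric]) simp_all
  also have "icomp E Z (?v \<bullet> (F0 s \<bullet> F0 k)) (F1 f0 \<bullet> ncmp \<theta>) = icomp E Z (F1 g0 \<bullet> ncmp \<theta>) (?v \<bullet> F0 \<sigma>)"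
    using naturality[of \<phi> X0 Z "ncmp \<theta>" "F0 \<sigma>" "F0 s \<bullet> F0 k"] by simp
  also have "icomp E Z (ncmp g1 \<bullet> F0 k) \<dots> =
      icomp E Z (icomp E Z (ncmp g1 \<bullet> F0 k) (F1 g0 \<bullet> ncmp \<theta>)) (?v \<bullet> F0 \<sigma>)"
    by (intro icomp_assoc) simp_all
  finally have "((\<phi> \<lhd>\<^bsub>Cat E\<^esub> obj_incl E X0) \<lhd>\<^bsub>Cat E\<^esub> \<tau>) \<odot>\<^bsub>Cat E\<^esub> restrict f0 f1 =
      restrict g0 g1 \<odot>\<^bsub>Cat E\<^esub> ((\<phi> \<lhd>\<^bsub>Cat E\<^esub> obj_incl E X0) \<lhd>\<^bsub>Cat E\<^esub> \<sigma>)"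
    by (intro inat_eqI) (simp_all add: restrict_nat[OF f] restrict_nat[OF g] ncmp_restrict[OF f] ncmp_restrict[OF g])
  then show ?thesis
    by (simp add: compatible_def)
qed

text \<open>The component of \<open>\<psi>\<close> is reused for \<open>\<phi>\<close>.
  Compatibility of \<open>\<psi>\<close> at vertical corners is the missing naturality along arrows
  of \<open>X0\<close>, and at horizontal corners it is compatibility with \<open>f1\<close> and
  \<open>g1\<close>.\<close>

lemma compatible_extends:
  assumes \<psi>: "compatible \<sigma> \<tau> (f0 \<cdot>\<^bsub>Cat E\<^esub> obj_incl E X0) (restrict f0 f1) (g0 \<cdot>\<^bsub>Cat E\<^esub> obj_incl E X0)
    (restrict g0 g1) \<psi>"
  obtains \<phi> where "compatible s t f0 f1 g0 g1 \<phi>" "\<phi> \<lhd>\<^bsub>Cat E\<^esub> obj_incl E X0 = \<psi>"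
proof
  have nat [simp]: "internal_nat E \<psi>" "nsrc \<psi> = f0 \<cdot>\<^bsub>Cat E\<^esub> obj_incl E X0" "ntrg \<psi> = g0 \<cdot>\<^bsub>Cat E\<^esub> obj_incl E X0"
    and e: "(\<psi> \<lhd>\<^bsub>Cat E\<^esub> \<tau>) \<odot>\<^bsub>Cat E\<^esub> restrict f0 f1 = restrict g0 g1 \<odot>\<^bsub>Cat E\<^esub> (\<psi> \<lhd>\<^bsub>Cat E\<^esub> \<sigma>)"
    using \<psi> by (auto simp: compatible_def)
  note [simp] = restrict_nat[OF f] restrict_nat[OF g]
  let ?v = "ncmp \<psi>" and ?f = "ncmp (restrict f0 f1)" and ?g = "ncmp (restrict g0 g1)"
  have v [simp]: "?v \<in> Ar E" "Src E ?v = C0 X0" "Trg E ?v = C1 Z" "isrc Z \<bullet> ?v = F0 f0" "itrg Z \<bullet> ?v = F0 g0"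
    using nat_simps(5-7)[of \<psi>] nat_eqs[of \<psi>] by simp_all
  have vx [simp]: "isrc Z \<bullet> (?v \<bullet> x) = F0 f0 \<bullet> x" "itrg Z \<bullet> (?v \<bullet> x) = F0 g0 \<bullet> x"
    if "x \<in> Ar E" "Trg E x = C0 X0" for x
    using that nat_src_trg[of \<psi> Z x] by simp_all
  have fg [simp]: "?f \<in> Ar E" "Src E ?f = C0 J" "Trg E ?f = C1 Z" "?g \<in> Ar E" "Src E ?g = C0 J" "Trg E ?g = C1 Z"
    using nat_simps(5-7)[of "restrict f0 f1"] nat_simps(5-7)[of "restrict g0 g1"] by simp_all
  have c: "icomp E Z (?v \<bullet> (F0 \<tau> \<bullet> c)) (?f \<bullet> c) = icomp E Z (?g \<bullet> c) (?v \<bullet> (F0 \<sigma> \<bullet> c))"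
    if "c \<in> Ar E" "Trg E c = C0 J" for c
  proof -
    have "icomp E Z (?v \<bullet> F0 \<tau>) ?f \<bullet> c = icomp E Z ?g (?v \<bullet> F0 \<sigma>) \<bullet> c"
      using arg_cong[OF e, of ncmp] by simp
    then show ?thesis
      using that by (simp add: icomp_stage)
  qed
  have ver: "icomp E Z (?v \<bullet> (itrg X0 \<bullet> a)) (F1 f0 \<bullet> a) = icomp E Z (F1 g0 \<bullet> a) (?v \<bullet> (isrc X0 \<bullet> a))"
    if "a \<in> Ar E" "Trg E a = C1 X0" for a
    using that c[of "corner a (F0 u \<bullet> (itrg X0 \<bullet> a))"]
    by (simp add: restrict_corner_ver[OF f] restrict_corner_ver[OF g])
  have hor: "icomp E Z (?v \<bullet> (F0 t \<bullet> h)) (ncmp f1 \<bullet> h) = icomp E Z (ncmp g1 \<bullet> h) (?v \<bullet> (F0 s \<bullet> h))"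
    if "h \<in> Ar E" "Trg E h = C0 X1" for h
    using that c[of "corner (iunt X0 \<bullet> (F0 s \<bullet> h)) h"]
    by (simp add: restrict_corner_hor[OF f] restrict_corner_hor[OF g])
  define \<phi> where "\<phi> = \<lparr>nsrc = f0, ntrg = g0, ncmp = ?v\<rparr>"
  have \<phi>_simps [simp]: "nsrc \<phi> = f0" "ntrg \<phi> = g0" "ncmp \<phi> = ?v"
    by (simp_all add: \<phi>_def)
  have "internal_nat E \<phi>"
    by (rule internal_natI) (simp_all add: ver)
  moreover have "(\<phi> \<lhd>\<^bsub>Cat E\<^esub> t) \<odot>\<^bsub>Cat E\<^esub> f1 = g1 \<odot>\<^bsub>Cat E\<^esub> (\<phi> \<lhd>\<^bsub>Cat E\<^esub> s)"
    using hor[of "Ide E (C0 X1)"] by (intro inat_eqI) simp_all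
  ultimately show "compatible s t f0 f1 g0 g1 \<phi>"
    by (simp add: compatible_def)
  show "\<phi> \<lhd>\<^bsub>Cat E\<^esub> obj_incl E X0 = \<psi>"
    by (rule inat_eqI) simp_all
qed

end

text \<open>The object part of \<open>obj_incl\<close> is an identity, so whiskering with it leaves
  the component as it is.\<close>

lemma whisker_obj_incl_inject:
  assumes "internal_nat E \<phi>" "internal_nat E \<psi>" "fdom (nsrc \<phi>) = X0"
    and "nsrc \<phi> = nsrc \<psi>" "ntrg \<phi> = ntrg \<psi>"
    and "\<phi> \<lhd>\<^bsub>Cat E\<^esub> obj_incl E X0 = \<psi> \<lhd>\<^bsub>Cat E\<^esub> obj_incl E X0"
  shows "\<phi> = \<psi>"
  using arg_cong[OF assms(6), of ncmp] assms(1-5) by (intro inat_eqI) simp_all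

lemma cmp_obj_incl_assoc:
  assumes "internal_functor E f" "internal_functor E g" "fdom g = fcod f" "fdom f = X0"
  shows "(g \<cdot>\<^bsub>Cat E\<^esub> f) \<cdot>\<^bsub>Cat E\<^esub> obj_incl E X0 = g \<cdot>\<^bsub>Cat E\<^esub> (f \<cdot>\<^bsub>Cat E\<^esub> obj_incl E X0)"
  using assms by (intro ifun_eqI) simp_all

lemma whisker_obj_incl_assoc:
  assumes "internal_functor E f" "internal_nat E \<phi>" "fdom (nsrc \<phi>) = fcod f" "fdom f = X0"
  shows "(\<phi> \<lhd>\<^bsub>Cat E\<^esub> f) \<lhd>\<^bsub>Cat E\<^esub> obj_incl E X0 = \<phi> \<lhd>\<^bsub>Cat E\<^esub> (f \<cdot>\<^bsub>Cat E\<^esub> obj_incl E X0)"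
  using assms by (intro inat_eqI ifun_eqI) simp_all

section \<open>Comparison of the universal properties\<close>

context
  fixes Q q0 q1
  assumes q: "X.coc Q q0 q1"
begin

text \<open>Restriction commutes with postcomposition and is injective, so the same \<open>h\<close>
  solves both factorisation problems.\<close>

lemma factor_iff:
  assumes f: "X.coc Z f0 f1" and h: "hom1 (Cat E) h Q Z"
  shows "h \<cdot>\<^bsub>Cat E\<^esub> q0 = f0 \<and> h \<rhd>\<^bsub>Cat E\<^esub> q1 = f1 \<longleftrightarrow>
    h \<cdot>\<^bsub>Cat E\<^esub> (q0 \<cdot>\<^bsub>Cat E\<^esub> obj_incl E X0) = f0 \<cdot>\<^bsub>Cat E\<^esub> obj_incl E X0 \<and>
    h \<rhd>\<^bsub>Cat E\<^esub> restrict q0 q1 = restrict f0 f1"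
proof -
  have h': "internal_functor E h" "fdom h = Q" "fcod h = Z"
    using h by auto
  have hq: "X.coc Z (h \<cdot>\<^bsub>Cat E\<^esub> q0) (h \<rhd>\<^bsub>Cat E\<^esub> q1)"
    using X.cocone_postcompose[OF q h'(1,2)] h' by simp
  have e: "(h \<cdot>\<^bsub>Cat E\<^esub> q0) \<cdot>\<^bsub>Cat E\<^esub> obj_incl E X0 = h \<cdot>\<^bsub>Cat E\<^esub> (q0 \<cdot>\<^bsub>Cat E\<^esub> obj_incl E X0)"
    "restrict (h \<cdot>\<^bsub>Cat E\<^esub> q0) (h \<rhd>\<^bsub>Cat E\<^esub> q1) = h \<rhd>\<^bsub>Cat E\<^esub> restrict q0 q1"
    using X.cocone_simps[OF q] h' restrict_postcompose[OF q h'(1,2)] cmp_obj_incl_assoc[of q0 h] by auto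
  show ?thesis
    using restrict_inject[OF hq f] e by metis
qed

lemma whisker_iff:
  assumes f: "X.coc Z f0 f1" and g: "X.coc Z g0 g1" and \<phi>: "compatible s t f0 f1 g0 g1 \<phi>"
    and f': "hom1 (Cat E) f' Q Z" "f' \<cdot>\<^bsub>Cat E\<^esub> q0 = f0"
    and g': "hom1 (Cat E) g' Q Z" "g' \<cdot>\<^bsub>Cat E\<^esub> q0 = g0"
    and \<psi>: "hom2 (Cat E) \<psi> f' g'"
  shows "\<psi> \<lhd>\<^bsub>Cat E\<^esub> q0 = \<phi> \<longleftrightarrow>
    \<psi> \<lhd>\<^bsub>Cat E\<^esub> (q0 \<cdot>\<^bsub>Cat E\<^esub> obj_incl E X0) = \<phi> \<lhd>\<^bsub>Cat E\<^esub> obj_incl E X0"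
proof -
  note [simp] = X.cocone_simps[OF q]
  have 1: "internal_nat E \<psi>" "nsrc \<psi> = f'" "ntrg \<psi> = g'" "fdom f' = Q"
    using \<psi> f' by auto
  have 2: "internal_nat E \<phi>" "nsrc \<phi> = f0" "ntrg \<phi> = g0" "fdom f0 = X0"
    using \<phi> X.cocone_simps[OF f] by (auto simp: compatible_def)
  have "(\<psi> \<lhd>\<^bsub>Cat E\<^esub> q0) \<lhd>\<^bsub>Cat E\<^esub> obj_incl E X0 = \<psi> \<lhd>\<^bsub>Cat E\<^esub> (q0 \<cdot>\<^bsub>Cat E\<^esub> obj_incl E X0)"
    using 1 by (intro whisker_obj_incl_assoc) simp_all
  moreover have "\<psi> \<lhd>\<^bsub>Cat E\<^esub> q0 = \<phi>"
    if "(\<psi> \<lhd>\<^bsub>Cat E\<^esub> q0) \<lhd>\<^bsub>Cat E\<^esub> obj_incl E X0 = \<phi> \<lhd>\<^bsub>Cat E\<^esub> obj_incl E X0"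
    by (rule whisker_obj_incl_inject[OF _ _ _ _ _ that]) (use 1 2 f'(2) g'(2) in simp_all)
  ultimately show ?thesis
    by metis
qed

text \<open>Each problem posed by cocones of \<open>Cnr(X)\<close> is the restriction of one posed
  by cocones of \<open>X\<close>, by the extension results; \<open>factor_iff\<close> and
  \<open>whisker_iff\<close> show that the two problems have the same solutions.\<close>

lemma codescent_restrict_iff:
  "codescent_on X0 s t u p q m Q q0 q1 \<longleftrightarrow>
   codescent_on (disc E (C0 X0)) \<sigma> \<tau> \<epsilon> \<pi> \<rho> \<mu> Q (q0 \<cdot>\<^bsub>Cat E\<^esub> obj_incl E X0) (restrict q0 q1)"
    (is "?X \<longleftrightarrow> ?C")
proof
  assume X: ?X
  show ?C
    unfolding codescent_on_def
  proof (intro conjI allI impI)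
    show "C.coc Q (q0 \<cdot>\<^bsub>Cat E\<^esub> obj_incl E X0) (restrict q0 q1)"
      by (rule restrict_cocone[OF q])
  next
    fix Z g0 g1
    assume "C.coc Z g0 g1"
    then obtain f0 f1 where f: "X.coc Z f0 f1" and g: "g0 = f0 \<cdot>\<^bsub>Cat E\<^esub> obj_incl E X0" "g1 = restrict f0 f1"
      using cocone_extends by metis
    have "\<exists>!f'. hom1 (Cat E) f' Q Z \<and> f' \<cdot>\<^bsub>Cat E\<^esub> q0 = f0 \<and> f' \<rhd>\<^bsub>Cat E\<^esub> q1 = f1"
      using X f unfolding codescent_on_def by blast
    \<comment> \<open>The equivalence holds only for maps from \<open>Q\<close> to \<open>Z\<close>;
      \<open>conj_cong\<close> makes the first conjunct available when the others are
      rewritten.\<close>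
    then show "\<exists>!f'. hom1 (Cat E) f' Q Z \<and> f' \<cdot>\<^bsub>Cat E\<^esub> (q0 \<cdot>\<^bsub>Cat E\<^esub> obj_incl E X0) = g0 \<and>
        f' \<rhd>\<^bsub>Cat E\<^esub> restrict q0 q1 = g1"
      using factor_iff[OF f] unfolding g by (simp only: cong: conj_cong)
  next
    fix Z f0' f1' g0' g1' \<psi> f' g'
    assume "C.coc Z f0' f1'" "C.coc Z g0' g1'" and \<psi>: "compatible \<sigma> \<tau> f0' f1' g0' g1' \<psi>"
      and f': "hom1 (Cat E) f' Q Z" "f' \<cdot>\<^bsub>Cat E\<^esub> (q0 \<cdot>\<^bsub>Cat E\<^esub> obj_incl E X0) = f0'" "f' \<rhd>\<^bsub>Cat E\<^esub> restrict q0 q1 = f1'"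
      and g': "hom1 (Cat E) g' Q Z" "g' \<cdot>\<^bsub>Cat E\<^esub> (q0 \<cdot>\<^bsub>Cat E\<^esub> obj_incl E X0) = g0'" "g' \<rhd>\<^bsub>Cat E\<^esub> restrict q0 q1 = g1'"
    then obtain f0 f1 g0 g1 where f: "X.coc Z f0 f1" and g: "X.coc Z g0 g1"
      and r: "f0' = f0 \<cdot>\<^bsub>Cat E\<^esub> obj_incl E X0" "f1' = restrict f0 f1"
        "g0' = g0 \<cdot>\<^bsub>Cat E\<^esub> obj_incl E X0" "g1' = restrict g0 g1"
      using cocone_extends by metis
    obtain \<phi> where \<phi>: "compatible s t f0 f1 g0 g1 \<phi>" "\<psi> = \<phi> \<lhd>\<^bsub>Cat E\<^esub> obj_incl E X0"
      using compatible_extends[OF f g] \<psi> unfolding r by metis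
    have ff: "f' \<cdot>\<^bsub>Cat E\<^esub> q0 = f0" "f' \<rhd>\<^bsub>Cat E\<^esub> q1 = f1"
      using factor_iff[OF f f'(1)] f'(2,3) unfolding r by blast+
    have gg: "g' \<cdot>\<^bsub>Cat E\<^esub> q0 = g0" "g' \<rhd>\<^bsub>Cat E\<^esub> q1 = g1"
      using factor_iff[OF g g'(1)] g'(2,3) unfolding r by blast+
    have "\<exists>!\<phi>'. hom2 (Cat E) \<phi>' f' g' \<and> \<phi>' \<lhd>\<^bsub>Cat E\<^esub> q0 = \<phi>"
      using X[unfolded codescent_on_def, THEN conjunct2, THEN conjunct2, rule_format,
          OF f g \<phi>(1) f'(1) ff g'(1) gg] .
    then show "\<exists>!\<phi>'. hom2 (Cat E) \<phi>' f' g' \<and> \<phi>' \<lhd>\<^bsub>Cat E\<^esub> (q0 \<cdot>\<^bsub>Cat E\<^esub> obj_incl E X0) = \<psi>"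
      using whisker_iff[OF f g \<phi>(1) f'(1) ff(1) g'(1) gg(1)] unfolding \<phi>(2) by (simp only: cong: conj_cong)
  qed
next
  assume C: ?C
  show ?X
    unfolding codescent_on_def
  proof (intro conjI allI impI)
    fix Z f0 f1
    assume f: "X.coc Z f0 f1"
    have "\<exists>!f'. hom1 (Cat E) f' Q Z \<and> f' \<cdot>\<^bsub>Cat E\<^esub> (q0 \<cdot>\<^bsub>Cat E\<^esub> obj_incl E X0) = f0 \<cdot>\<^bsub>Cat E\<^esub> obj_incl E X0 \<and>
        f' \<rhd>\<^bsub>Cat E\<^esub> restrict q0 q1 = restrict f0 f1"
      using C restrict_cocone[OF f] unfolding codescent_on_def by blast
    then show "\<exists>!f'. hom1 (Cat E) f' Q Z \<and> f' \<cdot>\<^bsub>Cat E\<^esub> q0 = f0 \<and> f' \<rhd>\<^bsub>Cat E\<^esub> q1 = f1"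
      using factor_iff[OF f] by (simp only: cong: conj_cong)
  next
    fix Z f0 f1 g0 g1 \<phi> f' g'
    assume f: "X.coc Z f0 f1" and g: "X.coc Z g0 g1" and \<phi>: "compatible s t f0 f1 g0 g1 \<phi>"
      and f': "hom1 (Cat E) f' Q Z" "f' \<cdot>\<^bsub>Cat E\<^esub> q0 = f0" "f' \<rhd>\<^bsub>Cat E\<^esub> q1 = f1"
      and g': "hom1 (Cat E) g' Q Z" "g' \<cdot>\<^bsub>Cat E\<^esub> q0 = g0" "g' \<rhd>\<^bsub>Cat E\<^esub> q1 = g1"
    have ff: "f' \<cdot>\<^bsub>Cat E\<^esub> (q0 \<cdot>\<^bsub>Cat E\<^esub> obj_incl E X0) = f0 \<cdot>\<^bsub>Cat E\<^esub> obj_incl E X0"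
      "f' \<rhd>\<^bsub>Cat E\<^esub> restrict q0 q1 = restrict f0 f1"
      using factor_iff[OF f f'(1)] f'(2,3) by blast+
    have gg: "g' \<cdot>\<^bsub>Cat E\<^esub> (q0 \<cdot>\<^bsub>Cat E\<^esub> obj_incl E X0) = g0 \<cdot>\<^bsub>Cat E\<^esub> obj_incl E X0"
      "g' \<rhd>\<^bsub>Cat E\<^esub> restrict q0 q1 = restrict g0 g1"
      using factor_iff[OF g g'(1)] g'(2,3) by blast+
    have "\<exists>!\<phi>'. hom2 (Cat E) \<phi>' f' g' \<and>
        \<phi>' \<lhd>\<^bsub>Cat E\<^esub> (q0 \<cdot>\<^bsub>Cat E\<^esub> obj_incl E X0) = \<phi> \<lhd>\<^bsub>Cat E\<^esub> obj_incl E X0"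
      using C[unfolded codescent_on_def, THEN conjunct2, THEN conjunct2, rule_format,
          OF restrict_cocone[OF f] restrict_cocone[OF g] compatible_restrict[OF f g \<phi>] f'(1) ff g'(1) gg] .
    then show "\<exists>!\<phi>'. hom2 (Cat E) \<phi>' f' g' \<and> \<phi>' \<lhd>\<^bsub>Cat E\<^esub> q0 = \<phi>"
      using whisker_iff[OF f g \<phi> f'(1,2) g'(1,2)] by (simp only: cong: conj_cong)
  qed (rule q)
qed

end

lemma codescent_iff:
  "(\<exists>q0 q1. codescent_on X0 s t u p q m Q q0 q1) \<longleftrightarrow>
   (\<exists>q0 q1. codescent_on (disc E (C0 X0)) \<sigma> \<tau> \<epsilon> \<pi> \<rho> \<mu> Q q0 q1)"
proof
  assume "\<exists>q0 q1. codescent_on X0 s t u p q m Q q0 q1"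
  then show "\<exists>q0 q1. codescent_on (disc E (C0 X0)) \<sigma> \<tau> \<epsilon> \<pi> \<rho> \<mu> Q q0 q1"
    using codescent_restrict_iff unfolding codescent_on_def[of X0] by blast
next
  assume "\<exists>q0 q1. codescent_on (disc E (C0 X0)) \<sigma> \<tau> \<epsilon> \<pi> \<rho> \<mu> Q q0 q1"
  then obtain g0 g1 where g: "codescent_on (disc E (C0 X0)) \<sigma> \<tau> \<epsilon> \<pi> \<rho> \<mu> Q g0 g1"
    by blast
  then have "C.coc Q g0 g1"
    by (simp add: codescent_on_def)
  then obtain q0 q1 where "X.coc Q q0 q1" "q0 \<cdot>\<^bsub>Cat E\<^esub> obj_incl E X0 = g0" "restrict q0 q1 = g1"
    using cocone_extends by metis
  then show "\<exists>q0 q1. codescent_on X0 s t u p q m Q q0 q1"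
    using codescent_restrict_iff g by metis
qed

end

section \<open>Recognising the corners in the definition of Cnr(X)\<close>

text \<open>Here \<open>(\<nu>, ns, nt)\<close> is the cotensor \<open>N1\<close> of \<open>X0\<close> with \<open>[1]\<close>, and \<open>l3\<close> the lift defining the crossing \<open>\<delta>\<close>.
  The maps \<open>w, v, y\<close> are the \<open>w, u, v\<close> of \<open>composite_monad\<close>, and \<open>b, d, c, z\<close> are the \<open>b, m, c, z\<close> of
  \<open>restricted_monad\<close>; \<open>lM, \<dots>, mM\<close> are the components of the composite monad.\<close>

locale corner_construction = base E +
  X: truncated_category E X0 X1 X2 s t u p q m +
  C: truncated_category E "disc E (C0 X0)" J J2 \<sigma> \<tau> \<epsilon> \<pi> \<rho> \<mu> +
  N: truncated_category E X0 N1 N2 ns nt nu np nq nm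
  for E :: "('o, 'm) cat" (structure) and X0 X1 X2 J J2 N1 N2 :: "('o, 'm) icat"
    and s t u p q m \<sigma> \<tau> \<epsilon> \<pi> \<rho> \<mu> ns nt nu np nq nm :: "('o, 'm) ifun" +
  fixes \<Phi> :: "('o, 'm) inat set" and \<nu> l3 :: "('o, 'm) inat"
    and p1 a1 a2 q2 \<delta> lM rM fM sM uM mM w v y b d c z :: "('o, 'm) ifun"
  assumes opfib: "split_opfibration (Cat E) t \<Phi>"
    and \<nu>_simps [simp]: "internal_nat E \<nu>" "nsrc \<nu> = ns" "ntrg \<nu> = nt"
    and \<nu>_exists: "\<lbrakk>a \<in> Ar E; Trg E a = C1 X0\<rbrakk> \<Longrightarrow>
      \<exists>n. n \<in> Ar E \<and> Src E n = Src E a \<and> Trg E n = C0 N1 \<and> ncmp \<nu> \<bullet> n = a"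
    and \<nu>_unique: "\<lbrakk>n \<in> Ar E; n' \<in> Ar E; Trg E n = C0 N1; Trg E n' = C0 N1; Src E n' = Src E n;
      ncmp \<nu> \<bullet> n = ncmp \<nu> \<bullet> n'\<rbrakk> \<Longrightarrow> n = n'"
    and \<nu>_arrow: "\<lbrakk>n \<in> Ar E; n' \<in> Ar E; Trg E n = C0 N1; Trg E n' = C0 N1; Src E n' = Src E n;
      f \<in> Ar E; g \<in> Ar E; Trg E f = C1 X0; Trg E g = C1 X0; Src E f = Src E n; Src E g = Src E n;
      isrc X0 \<bullet> f = F0 ns \<bullet> n; itrg X0 \<bullet> f = F0 ns \<bullet> n';
      isrc X0 \<bullet> g = F0 nt \<bullet> n; itrg X0 \<bullet> g = F0 nt \<bullet> n';
      icomp E X0 (ncmp \<nu> \<bullet> n') f = icomp E X0 g (ncmp \<nu> \<bullet> n)\<rbrakk> \<Longrightarrow>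
      \<exists>\<chi>. \<chi> \<in> Ar E \<and> Src E \<chi> = Src E n \<and> Trg E \<chi> = C1 N1 \<and> isrc N1 \<bullet> \<chi> = n \<and> itrg N1 \<bullet> \<chi> = n' \<and>
        F1 ns \<bullet> \<chi> = f \<and> F1 nt \<bullet> \<chi> = g"
    and \<nu>_unit: "ncmp \<nu> \<bullet> F0 nu = iunt X0"
    and \<nu>_mult: "\<lbrakk>x \<in> Ar E; Trg E x = C0 N2\<rbrakk> \<Longrightarrow>
      icomp E X0 (ncmp \<nu> \<bullet> (F0 nq \<bullet> x)) (ncmp \<nu> \<bullet> (F0 np \<bullet> x)) = ncmp \<nu> \<bullet> (F0 nm \<bullet> x)"
    and pb1: "pullback (Cat E) t ns p1 a1" and pb2: "pullback (Cat E) nt s a2 q2"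
    and \<delta>_simps [simp]: "internal_functor E \<delta>" "fdom \<delta> = fdom p1" "fcod \<delta> = fdom a2"
    and l3: "l3 \<in> \<Phi>" "nsrc l3 = p1" "t \<rhd>\<^bsub>Cat E\<^esub> l3 = \<nu> \<lhd>\<^bsub>Cat E\<^esub> a1" "q2 \<cdot>\<^bsub>Cat E\<^esub> \<delta> = ntrg l3"
      "(\<nu> \<lhd>\<^bsub>Cat E\<^esub> a2) \<lhd>\<^bsub>Cat E\<^esub> \<delta> = s \<rhd>\<^bsub>Cat E\<^esub> l3"
    and M_legs: "lM = ns \<cdot>\<^bsub>Cat E\<^esub> a2" "rM = t \<cdot>\<^bsub>Cat E\<^esub> q2"
    and pbM: "pullback (Cat E) rM lM fM sM"
    and uM_simps [simp]: "internal_functor E uM" "fdom uM = X0" "fcod uM = fdom a2"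
    and uM: "a2 \<cdot>\<^bsub>Cat E\<^esub> uM = nu" "q2 \<cdot>\<^bsub>Cat E\<^esub> uM = u"
    and mM_simps [simp]: "internal_functor E mM" "fdom mM = fdom fM" "fcod mM = fdom a2"
    and w_simps [simp]: "internal_functor E w" "fdom w = fdom fM" "fcod w = fdom p1"
    and w: "p1 \<cdot>\<^bsub>Cat E\<^esub> w = q2 \<cdot>\<^bsub>Cat E\<^esub> fM" "a1 \<cdot>\<^bsub>Cat E\<^esub> w = a2 \<cdot>\<^bsub>Cat E\<^esub> sM"
    and v_simps [simp]: "internal_functor E v" "fdom v = fdom fM" "fcod v = N2"
    and v: "np \<cdot>\<^bsub>Cat E\<^esub> v = a2 \<cdot>\<^bsub>Cat E\<^esub> fM" "nq \<cdot>\<^bsub>Cat E\<^esub> v = a2 \<cdot>\<^bsub>Cat E\<^esub> (\<delta> \<cdot>\<^bsub>Cat E\<^esub> w)"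
    and y_simps [simp]: "internal_functor E y" "fdom y = fdom fM" "fcod y = X2"
    and y: "p \<cdot>\<^bsub>Cat E\<^esub> y = q2 \<cdot>\<^bsub>Cat E\<^esub> (\<delta> \<cdot>\<^bsub>Cat E\<^esub> w)" "q \<cdot>\<^bsub>Cat E\<^esub> y = q2 \<cdot>\<^bsub>Cat E\<^esub> sM"
    and mM: "a2 \<cdot>\<^bsub>Cat E\<^esub> mM = nm \<cdot>\<^bsub>Cat E\<^esub> v" "q2 \<cdot>\<^bsub>Cat E\<^esub> mM = m \<cdot>\<^bsub>Cat E\<^esub> y"
    and pb_b: "pullback (Cat E) (obj_incl E X0) lM b d"
    and pb_c: "pullback (Cat E) (rM \<cdot>\<^bsub>Cat E\<^esub> d) (obj_incl E X0) c \<tau>"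
    and \<sigma>: "\<sigma> = b \<cdot>\<^bsub>Cat E\<^esub> c"
    and \<epsilon>: "d \<cdot>\<^bsub>Cat E\<^esub> (c \<cdot>\<^bsub>Cat E\<^esub> \<epsilon>) = uM \<cdot>\<^bsub>Cat E\<^esub> obj_incl E X0"
    and z_simps [simp]: "internal_functor E z" "fdom z = J2" "fcod z = fdom fM"
    and z: "fM \<cdot>\<^bsub>Cat E\<^esub> z = d \<cdot>\<^bsub>Cat E\<^esub> (c \<cdot>\<^bsub>Cat E\<^esub> \<pi>)" "sM \<cdot>\<^bsub>Cat E\<^esub> z = d \<cdot>\<^bsub>Cat E\<^esub> (c \<cdot>\<^bsub>Cat E\<^esub> \<rho>)"
    and \<mu>: "d \<cdot>\<^bsub>Cat E\<^esub> (c \<cdot>\<^bsub>Cat E\<^esub> \<mu>) = mM \<cdot>\<^bsub>Cat E\<^esub> z"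
begin

lemma limit_simps [simp]:
  "internal_functor E p1" "internal_functor E a1" "internal_functor E a2" "internal_functor E q2"
  "fcod p1 = X1" "fdom a1 = fdom p1" "fcod a1 = N1"
  "fcod a2 = N1" "fdom q2 = fdom a2" "fcod q2 = X1"
  "internal_functor E fM" "internal_functor E sM"
  "fcod fM = fdom a2" "fdom sM = fdom fM" "fcod sM = fdom a2"
  "internal_functor E b" "internal_functor E d" "internal_functor E c"
  "fdom d = fdom b" "fcod b = disc E (C0 X0)" "fcod d = fdom a2"
  "fdom c = J" "fcod c = fdom b"
  using pullback_simps[OF pb1] pullback_simps[OF pb2] pullback_simps[OF pbM] pullback_simps[OF pb_b]
    pullback_simps[OF pb_c] by (simp_all add: M_legs)

lemma \<nu>_typing [simp]: "ncmp \<nu> \<in> Ar E" "Src E (ncmp \<nu>) = C0 N1" "Trg E (ncmp \<nu>) = C1 X0"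
  using nat_simps(5-7)[of \<nu>] by simp_all

lemma pb2_eqs:
  "F0 nt \<bullet> F0 a2 = F0 s \<bullet> F0 q2" "F1 nt \<bullet> F1 a2 = F1 s \<bullet> F1 q2"
  using pullback_eqs[OF pb2] .

lemma pb2_obj_eqs:
  assumes "x \<in> Ar E" "Trg E x = C0 (fdom a2)"
  shows "F0 nt \<bullet> (F0 a2 \<bullet> x) = F0 s \<bullet> (F0 q2 \<bullet> x)"
  using assms pb2_eqs(1)[THEN comp_reassoc, of x] by simp

lemma b_eqs: "F0 b = F0 ns \<bullet> (F0 a2 \<bullet> F0 d)" "iunt X0 \<bullet> F1 b = F1 ns \<bullet> (F1 a2 \<bullet> F1 d)"
  using pullback_eqs[OF pb_b] by (simp_all add: M_legs)

lemma \<tau>_eqs: "F0 \<tau> = F0 t \<bullet> (F0 q2 \<bullet> (F0 d \<bullet> F0 c))"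
    "iunt X0 \<bullet> F1 \<tau> = F1 t \<bullet> (F1 q2 \<bullet> (F1 d \<bullet> F1 c))"
  using pullback_eqs[OF pb_c] by (simp_all add: M_legs)

text \<open>Pulling back along \<open>obj_incl\<close> on either side leaves the objects alone,
  since it is an identity there. So \<open>J\<close> has the same generalised objects as the
  composite span.\<close>

lemma J_obj:
  assumes x: "x \<in> Ar E" "Trg E x = C0 (fdom a2)"
  obtains j where "j \<in> Ar E" "Src E j = Src E x" "Trg E j = C0 J" "F0 d \<bullet> (F0 c \<bullet> j) = x"
proof -
  obtain x1 where x1: "x1 \<in> Ar E" "Src E x1 = Src E x" "Trg E x1 = C0 (fdom b)" "F0 d \<bullet> x1 = x"
    using pullback_obj[OF pb_b, of "F0 ns \<bullet> (F0 a2 \<bullet> x)" x] x by (auto simp: M_legs)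
  obtain j where "j \<in> Ar E" "Src E j = Src E x1" "Trg E j = C0 J" "F0 c \<bullet> j = x1"
    using pullback_obj[OF pb_c, of x1 "F0 t \<bullet> (F0 q2 \<bullet> x)"] x x1 by (auto simp: M_legs)
  then show ?thesis
    using that x1 by simp
qed

lemma J_obj_eq:
  assumes "j \<in> Ar E" "j' \<in> Ar E" "Trg E j = C0 J" "Trg E j' = C0 J" "Src E j' = Src E j"
    and e: "F0 d \<bullet> (F0 c \<bullet> j) = F0 d \<bullet> (F0 c \<bullet> j')"
  shows "j = j'"
proof -
  have c: "F0 c \<bullet> j = F0 c \<bullet> j'"
    by (rule pullback_obj_eq[OF pb_b]) (use assms(1-5) in \<open>simp_all add: e b_eqs\<close>)
  show ?thesis
    by (rule pullback_obj_eq[OF pb_c]) (use assms(1-5) in \<open>simp_all add: c e \<tau>_eqs\<close>)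
qed

text \<open>The arrows of \<open>J\<close> are the arrows \<open>\<xi>\<close> of the composite span
  whose two outer legs are identities, because \<open>X0\<close> has been restricted to its discrete
  part at both ends.\<close>

lemma J_arr:
  assumes j: "j \<in> Ar E" "j' \<in> Ar E" "Trg E j = C0 J" "Trg E j' = C0 J" "Src E j' = Src E j"
    and \<xi>: "\<xi> \<in> Ar E" "Src E \<xi> = Src E j" "Trg E \<xi> = C1 (fdom a2)"
      "isrc (fdom a2) \<bullet> \<xi> = F0 d \<bullet> (F0 c \<bullet> j)" "itrg (fdom a2) \<bullet> \<xi> = F0 d \<bullet> (F0 c \<bullet> j')"
    and id: "F1 ns \<bullet> (F1 a2 \<bullet> \<xi>) = iunt X0 \<bullet> (F0 ns \<bullet> (F0 a2 \<bullet> (F0 d \<bullet> (F0 c \<bullet> j))))"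
      "F1 t \<bullet> (F1 q2 \<bullet> \<xi>) = iunt X0 \<bullet> (F0 t \<bullet> (F0 q2 \<bullet> (F0 d \<bullet> (F0 c \<bullet> j))))"
  obtains \<chi> where "\<chi> \<in> Ar E" "Src E \<chi> = Src E j" "Trg E \<chi> = C1 J" "isrc J \<bullet> \<chi> = j" "itrg J \<bullet> \<chi> = j'"
proof -
  \<comment> \<open>Taking targets in the assumed identities shows that \<open>j\<close> and
    \<open>j'\<close> have the same outer legs.\<close>
  have e: "F0 ns \<bullet> (F0 a2 \<bullet> (F0 d \<bullet> (F0 c \<bullet> j'))) = F0 ns \<bullet> (F0 a2 \<bullet> (F0 d \<bullet> (F0 c \<bullet> j)))"
    "F0 t \<bullet> (F0 q2 \<bullet> (F0 d \<bullet> (F0 c \<bullet> j'))) = F0 t \<bullet> (F0 q2 \<bullet> (F0 d \<bullet> (F0 c \<bullet> j)))"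
    using id[THEN arg_cong[where f = "(\<bullet>) (itrg X0)"]] j(1-4) \<xi> by simp_all
  obtain \<xi>' where \<xi>': "\<xi>' \<in> Ar E" "Src E \<xi>' = Src E j" "Trg E \<xi>' = C1 (fdom b)"
    "isrc (fdom b) \<bullet> \<xi>' = F0 c \<bullet> j" "itrg (fdom b) \<bullet> \<xi>' = F0 c \<bullet> j'" "F1 d \<bullet> \<xi>' = \<xi>"
    by (rule pullback_arr[OF pb_b, of "F0 ns \<bullet> (F0 a2 \<bullet> (F0 d \<bullet> (F0 c \<bullet> j)))" \<xi> "F0 c \<bullet> j" "F0 c \<bullet> j'"])
      (use j \<xi> id(1) e(1) in \<open>simp_all add: M_legs b_eqs\<close>)
  show ?thesis
    by (rule pullback_arr[OF pb_c, of \<xi>' "F0 t \<bullet> (F0 q2 \<bullet> (F0 d \<bullet> (F0 c \<bullet> j)))" j j'])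
      (use that j \<xi>' id(2) e(2) in \<open>simp_all add: M_legs \<tau>_eqs\<close>)
qed

lemma l3_simps [simp]: "internal_nat E l3" "nsrc l3 = p1" "ncmp l3 \<in> Ar E"
  "Src E (ncmp l3) = C0 (fdom p1)" "Trg E (ncmp l3) = C1 X1"
proof -
  show *: "internal_nat E l3" "nsrc l3 = p1"
    using opfib l3 by (auto simp: split_opfibration_def cells_into_def)
  show "ncmp l3 \<in> Ar E" "Src E (ncmp l3) = C0 (fdom p1)" "Trg E (ncmp l3) = C1 X1"
    using nat_simps(5-7)[OF *(1)] *(2) by simp_all
qed

text \<open>The defining data of \<open>\<delta>\<close>, element by element: \<open>l3\<close>
  lifts the arrow to be crossed, its image under \<open>s\<close> is the arrow after crossing, and
  its end is the new object of \<open>X1\<close>.\<close>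

lemma crossing_eqs [simp]:
  assumes "x \<in> Ar E" "Trg E x = C0 (fdom p1)"
  shows "F1 t \<bullet> (ncmp l3 \<bullet> x) = ncmp \<nu> \<bullet> (F0 a1 \<bullet> x)" "F0 (ntrg l3) \<bullet> x = F0 q2 \<bullet> (F0 \<delta> \<bullet> x)"
    "F1 s \<bullet> (ncmp l3 \<bullet> x) = ncmp \<nu> \<bullet> (F0 a2 \<bullet> (F0 \<delta> \<bullet> x))"
    "isrc X1 \<bullet> (ncmp l3 \<bullet> x) = F0 p1 \<bullet> x" "itrg X1 \<bullet> (ncmp l3 \<bullet> x) = F0 q2 \<bullet> (F0 \<delta> \<bullet> x)"
proof -
  have "F1 t \<bullet> ncmp l3 = ncmp \<nu> \<bullet> F0 a1" "F1 s \<bullet> ncmp l3 = ncmp \<nu> \<bullet> (F0 a2 \<bullet> F0 \<delta>)"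
    using arg_cong[OF l3(3), of ncmp] arg_cong[OF l3(5), of ncmp] by simp_all
  from this[THEN comp_reassoc, of x] assms
  show "F1 t \<bullet> (ncmp l3 \<bullet> x) = ncmp \<nu> \<bullet> (F0 a1 \<bullet> x)"
    "F1 s \<bullet> (ncmp l3 \<bullet> x) = ncmp \<nu> \<bullet> (F0 a2 \<bullet> (F0 \<delta> \<bullet> x))" by simp_all
  show *: "F0 (ntrg l3) \<bullet> x = F0 q2 \<bullet> (F0 \<delta> \<bullet> x)"
    using assms unfolding l3(4)[symmetric] by simp
  show "isrc X1 \<bullet> (ncmp l3 \<bullet> x) = F0 p1 \<bullet> x" "itrg X1 \<bullet> (ncmp l3 \<bullet> x) = F0 q2 \<bullet> (F0 \<delta> \<bullet> x)"
    using assms nat_src_trg[of l3 X1 x] by (simp_all add: *)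
qed

lemma structure_maps [simp]:
  assumes "x \<in> Ar E"
  shows "Trg E x = C0 (fdom fM) \<Longrightarrow> F0 p1 \<bullet> (F0 w \<bullet> x) = F0 q2 \<bullet> (F0 fM \<bullet> x)"
    "Trg E x = C0 (fdom fM) \<Longrightarrow> F0 a1 \<bullet> (F0 w \<bullet> x) = F0 a2 \<bullet> (F0 sM \<bullet> x)"
    "Trg E x = C0 (fdom fM) \<Longrightarrow> F0 np \<bullet> (F0 v \<bullet> x) = F0 a2 \<bullet> (F0 fM \<bullet> x)"
    "Trg E x = C0 (fdom fM) \<Longrightarrow> F0 nq \<bullet> (F0 v \<bullet> x) = F0 a2 \<bullet> (F0 \<delta> \<bullet> (F0 w \<bullet> x))"
    "Trg E x = C0 (fdom fM) \<Longrightarrow> F0 p \<bullet> (F0 y \<bullet> x) = F0 q2 \<bullet> (F0 \<delta> \<bullet> (F0 w \<bullet> x))"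
    "Trg E x = C0 (fdom fM) \<Longrightarrow> F0 q \<bullet> (F0 y \<bullet> x) = F0 q2 \<bullet> (F0 sM \<bullet> x)"
    "Trg E x = C0 (fdom fM) \<Longrightarrow> F0 nm \<bullet> (F0 v \<bullet> x) = F0 a2 \<bullet> (F0 mM \<bullet> x)"
    "Trg E x = C0 (fdom fM) \<Longrightarrow> F0 m \<bullet> (F0 y \<bullet> x) = F0 q2 \<bullet> (F0 mM \<bullet> x)"
    "Trg E x = C0 J2 \<Longrightarrow> F0 fM \<bullet> (F0 z \<bullet> x) = F0 d \<bullet> (F0 c \<bullet> (F0 \<pi> \<bullet> x))"
    "Trg E x = C0 J2 \<Longrightarrow> F0 sM \<bullet> (F0 z \<bullet> x) = F0 d \<bullet> (F0 c \<bullet> (F0 \<rho> \<bullet> x))"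
    "Trg E x = C0 J2 \<Longrightarrow> F0 mM \<bullet> (F0 z \<bullet> x) = F0 d \<bullet> (F0 c \<bullet> (F0 \<mu> \<bullet> x))"
proof -
  show "F0 p1 \<bullet> (F0 w \<bullet> x) = F0 q2 \<bullet> (F0 fM \<bullet> x)" if "Trg E x = C0 (fdom fM)"
    using w(1)[THEN arg_cong[where f = F0], simplified, THEN comp_reassoc, of x] assms that by simp
  show "F0 a1 \<bullet> (F0 w \<bullet> x) = F0 a2 \<bullet> (F0 sM \<bullet> x)" if "Trg E x = C0 (fdom fM)"
    using w(2)[THEN arg_cong[where f = F0], simplified, THEN comp_reassoc, of x] assms that by simp
  show "F0 np \<bullet> (F0 v \<bullet> x) = F0 a2 \<bullet> (F0 fM \<bullet> x)" if "Trg E x = C0 (fdom fM)"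
    using v(1)[THEN arg_cong[where f = F0], simplified, THEN comp_reassoc, of x] assms that by simp
  show "F0 nq \<bullet> (F0 v \<bullet> x) = F0 a2 \<bullet> (F0 \<delta> \<bullet> (F0 w \<bullet> x))" if "Trg E x = C0 (fdom fM)"
    using v(2)[THEN arg_cong[where f = F0], simplified, THEN comp_reassoc, of x] assms that by simp
  show "F0 p \<bullet> (F0 y \<bullet> x) = F0 q2 \<bullet> (F0 \<delta> \<bullet> (F0 w \<bullet> x))" if "Trg E x = C0 (fdom fM)"
    using y(1)[THEN arg_cong[where f = F0], simplified, THEN comp_reassoc, of x] assms that by simp
  show "F0 q \<bullet> (F0 y \<bullet> x) = F0 q2 \<bullet> (F0 sM \<bullet> x)" if "Trg E x = C0 (fdom fM)"
    using y(2)[THEN arg_cong[where f = F0], simplified, THEN comp_reassoc, of x] assms that by simp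
  show "F0 nm \<bullet> (F0 v \<bullet> x) = F0 a2 \<bullet> (F0 mM \<bullet> x)" if "Trg E x = C0 (fdom fM)"
    using mM(1)[symmetric, THEN arg_cong[where f = F0], simplified, THEN comp_reassoc, of x] assms that by simp
  show "F0 m \<bullet> (F0 y \<bullet> x) = F0 q2 \<bullet> (F0 mM \<bullet> x)" if "Trg E x = C0 (fdom fM)"
    using mM(2)[symmetric, THEN arg_cong[where f = F0], simplified, THEN comp_reassoc, of x] assms that by simp
  show "F0 fM \<bullet> (F0 z \<bullet> x) = F0 d \<bullet> (F0 c \<bullet> (F0 \<pi> \<bullet> x))" if "Trg E x = C0 J2"
    using z(1)[THEN arg_cong[where f = F0], simplified, THEN comp_reassoc, of x] assms that by simp
  show "F0 sM \<bullet> (F0 z \<bullet> x) = F0 d \<bullet> (F0 c \<bullet> (F0 \<rho> \<bullet> x))" if "Trg E x = C0 J2"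
    using z(2)[THEN arg_cong[where f = F0], simplified, THEN comp_reassoc, of x] assms that by simp
  show "F0 mM \<bullet> (F0 z \<bullet> x) = F0 d \<bullet> (F0 c \<bullet> (F0 \<mu> \<bullet> x))" if "Trg E x = C0 J2"
    using \<mu>[symmetric, THEN arg_cong[where f = F0], simplified, THEN comp_reassoc, of x] assms that by simp
qed

lemma \<epsilon>_eqs: "F0 a2 \<bullet> (F0 d \<bullet> (F0 c \<bullet> F0 \<epsilon>)) = F0 nu" "F0 q2 \<bullet> (F0 d \<bullet> (F0 c \<bullet> F0 \<epsilon>)) = F0 u"
proof -
  have "F0 d \<bullet> (F0 c \<bullet> F0 \<epsilon>) = F0 uM"
    using arg_cong[OF \<epsilon>, of F0] by simp
  then show "F0 a2 \<bullet> (F0 d \<bullet> (F0 c \<bullet> F0 \<epsilon>)) = F0 nu" "F0 q2 \<bullet> (F0 d \<bullet> (F0 c \<bullet> F0 \<epsilon>)) = F0 u"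
    using uM[THEN arg_cong[where f = F0]] by simp_all
qed

text \<open>The lift in question is an instance of \<open>l3\<close>, and chosen cells are stable
  under precomposition. The equation is composition in the cotensor nerve at the pair
  \<open>v\<close> of vertical arrows.\<close>

lemma corner_mult:
  assumes x: "x \<in> Ar E" "Trg E x = C0 J2"
  defines "f \<equiv> ncmp l3 \<bullet> (F0 w \<bullet> (F0 z \<bullet> x))"
  shows "cell X1 f \<in> \<Phi>"
    and "icomp E X0 (F1 s \<bullet> f) (ncmp \<nu> \<bullet> (F0 a2 \<bullet> (F0 d \<bullet> (F0 c \<bullet> (F0 \<pi> \<bullet> x))))) =
      ncmp \<nu> \<bullet> (F0 a2 \<bullet> (F0 d \<bullet> (F0 c \<bullet> (F0 \<mu> \<bullet> x))))"
proof -
  have "\<forall>\<phi>\<in>\<Phi>. \<forall>Y' y. hom1 (Cat E) y Y' (fdom (nsrc \<phi>)) \<longrightarrow> \<phi> \<lhd>\<^bsub>Cat E\<^esub> y \<in> \<Phi>"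
    using opfib by (simp add: split_opfibration_def)
  from this[rule_format, OF l3(1), of "pt (fdom p1) (F0 w \<bullet> (F0 z \<bullet> x))" "disc E (Src E x)"]
  show "cell X1 f \<in> \<Phi>"
    using x by (simp add: f_def)
  show "icomp E X0 (F1 s \<bullet> f) (ncmp \<nu> \<bullet> (F0 a2 \<bullet> (F0 d \<bullet> (F0 c \<bullet> (F0 \<pi> \<bullet> x))))) =
      ncmp \<nu> \<bullet> (F0 a2 \<bullet> (F0 d \<bullet> (F0 c \<bullet> (F0 \<mu> \<bullet> x))))"
    using x \<nu>_mult[of "F0 v \<bullet> (F0 z \<bullet> x)"] by (simp add: f_def)
qed

text \<open>A corner is read off from the composite span: \<open>q2\<close> gives its object of
  \<open>X1\<close>, and \<open>a2\<close> followed by the universal 2-cell \<open>\<nu>\<close>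
  gives its arrow of \<open>X0\<close>.\<close>

lemma corners_intro:
  assumes degen_simps [simp]:
    "internal_functor E l" "fdom l = X1" "fcod l = X2"
    "internal_functor E r" "fdom r = X1" "fcod r = X2"
    and l_eqs: "p \<cdot>\<^bsub>Cat E\<^esub> l = u \<cdot>\<^bsub>Cat E\<^esub> s" "q \<cdot>\<^bsub>Cat E\<^esub> l = One (Cat E) X1" "m \<cdot>\<^bsub>Cat E\<^esub> l = One (Cat E) X1"
    and r_eqs: "p \<cdot>\<^bsub>Cat E\<^esub> r = One (Cat E) X1" "q \<cdot>\<^bsub>Cat E\<^esub> r = u \<cdot>\<^bsub>Cat E\<^esub> t" "m \<cdot>\<^bsub>Cat E\<^esub> r = One (Cat E) X1"
    and X2_pullback: "pullback (Cat E) t s p q"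
    and J2_pullback: "pullback (Cat E) \<tau> \<sigma> \<pi> \<rho>"
    and unit_opfib: "opfib_morphism (Cat E) (One (Cat E) X0) (cells_into (Cat E) X0) t \<Phi> u"
  shows "corners E X0 X1 X2 J J2 s t u p q m \<sigma> \<tau> \<epsilon> \<pi> \<rho> \<mu> \<Phi> l r (q2 \<cdot>\<^bsub>Cat E\<^esub> (d \<cdot>\<^bsub>Cat E\<^esub> c))
    (\<nu> \<lhd>\<^bsub>Cat E\<^esub> (a2 \<cdot>\<^bsub>Cat E\<^esub> (d \<cdot>\<^bsub>Cat E\<^esub> c)))"
proof (intro corners.intro corners_axioms.intro base_axioms X.truncated_category_axioms C.truncated_category_axioms)
  let ?k = "q2 \<cdot>\<^bsub>Cat E\<^esub> (d \<cdot>\<^bsub>Cat E\<^esub> c)" and ?\<theta> = "\<nu> \<lhd>\<^bsub>Cat E\<^esub> (a2 \<cdot>\<^bsub>Cat E\<^esub> (d \<cdot>\<^bsub>Cat E\<^esub> c))"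
  have b1: "iunt X0 \<bullet> (F1 b \<bullet> F1 c) = F1 ns \<bullet> (F1 a2 \<bullet> (F1 d \<bullet> F1 c))"
    using b_eqs(2)[THEN comp_reassoc, of "F1 c"] by simp
  show "nsrc ?\<theta> = obj_incl E X0 \<cdot>\<^bsub>Cat E\<^esub> \<sigma>"
    by (rule ifun_eqI) (simp_all add: \<sigma> b_eqs(1) b1)
  show "ntrg ?\<theta> = s \<cdot>\<^bsub>Cat E\<^esub> ?k"
    using pb2_eqs[THEN comp_reassoc, of "F0 d \<bullet> F0 c"] pb2_eqs[THEN comp_reassoc, of "F1 d \<bullet> F1 c"]
    by (intro ifun_eqI) simp_all
  show "t \<cdot>\<^bsub>Cat E\<^esub> ?k = obj_incl E X0 \<cdot>\<^bsub>Cat E\<^esub> \<tau>"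
    by (rule ifun_eqI) (simp_all add: \<tau>_eqs)
  show "ncmp ?\<theta> \<bullet> F0 \<epsilon> = iunt X0" "F0 ?k \<bullet> F0 \<epsilon> = F0 u"
    by (simp_all add: \<epsilon>_eqs \<nu>_unit)
  show "internal_functor E ?k" "internal_nat E ?\<theta>"
    by simp_all
next
  fix a h
  assume ah: "a \<in> Ar E" "h \<in> Ar E" "Trg E a = C1 X0" "Trg E h = C0 X1" "Src E h = Src E a"
    "itrg X0 \<bullet> a = F0 s \<bullet> h"
  \<comment> \<open>The object of \<open>N1\<close> classifying \<open>a\<close> is paired with
    \<open>h\<close> and then carried over to \<open>J\<close>.\<close>
  obtain n where n: "n \<in> Ar E" "Src E n = Src E a" "Trg E n = C0 N1" "ncmp \<nu> \<bullet> n = a"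
    using \<nu>_exists ah by metis
  have "F0 nt \<bullet> n = F0 s \<bullet> h"
    using nat_src_trg(2)[of \<nu> X0 n] n ah(6) by simp
  then obtain x where x: "x \<in> Ar E" "Src E x = Src E n" "Trg E x = C0 (fdom a2)" "F0 a2 \<bullet> x = n" "F0 q2 \<bullet> x = h"
    using pullback_obj[OF pb2, of n h] n ah by auto
  obtain j where j: "j \<in> Ar E" "Src E j = Src E x" "Trg E j = C0 J" "F0 d \<bullet> (F0 c \<bullet> j) = x"
    using J_obj x by metis
  show "\<exists>j. j \<in> Ar E \<and> Src E j = Src E a \<and> Trg E j = C0 J \<and>
      ncmp (\<nu> \<lhd>\<^bsub>Cat E\<^esub> (a2 \<cdot>\<^bsub>Cat E\<^esub> (d \<cdot>\<^bsub>Cat E\<^esub> c))) \<bullet> j = a \<and> F0 (q2 \<cdot>\<^bsub>Cat E\<^esub> (d \<cdot>\<^bsub>Cat E\<^esub> c)) \<bullet> j = h"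
    using n x j by (intro exI[of _ j]) simp
next
  fix j j'
  assume j: "j \<in> Ar E" "j' \<in> Ar E" "Trg E j = C0 J" "Trg E j' = C0 J" "Src E j' = Src E j"
    and e: "ncmp (\<nu> \<lhd>\<^bsub>Cat E\<^esub> (a2 \<cdot>\<^bsub>Cat E\<^esub> (d \<cdot>\<^bsub>Cat E\<^esub> c))) \<bullet> j = ncmp (\<nu> \<lhd>\<^bsub>Cat E\<^esub> (a2 \<cdot>\<^bsub>Cat E\<^esub> (d \<cdot>\<^bsub>Cat E\<^esub> c))) \<bullet> j'"
      "F0 (q2 \<cdot>\<^bsub>Cat E\<^esub> (d \<cdot>\<^bsub>Cat E\<^esub> c)) \<bullet> j = F0 (q2 \<cdot>\<^bsub>Cat E\<^esub> (d \<cdot>\<^bsub>Cat E\<^esub> c)) \<bullet> j'"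
  have "F0 a2 \<bullet> (F0 d \<bullet> (F0 c \<bullet> j)) = F0 a2 \<bullet> (F0 d \<bullet> (F0 c \<bullet> j'))"
    by (rule \<nu>_unique) (use j e(1) in simp_all)
  then have "F0 d \<bullet> (F0 c \<bullet> j) = F0 d \<bullet> (F0 c \<bullet> j')"
    by (intro pullback_obj_eq[OF pb2, of "F0 d \<bullet> (F0 c \<bullet> j)" "F0 d \<bullet> (F0 c \<bullet> j')"]) (use j e(2) in simp_all)
  then show "j = j'"
    by (rule J_obj_eq[OF j])
next
  fix j j' \<kappa>
  assume j: "j \<in> Ar E" "j' \<in> Ar E" "Trg E j = C0 J" "Trg E j' = C0 J" "Src E j' = Src E j"
    and \<kappa>: "\<kappa> \<in> Ar E" "Trg E \<kappa> = C1 X1" "Src E \<kappa> = Src E j"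
      "isrc X1 \<bullet> \<kappa> = F0 (q2 \<cdot>\<^bsub>Cat E\<^esub> (d \<cdot>\<^bsub>Cat E\<^esub> c)) \<bullet> j" "itrg X1 \<bullet> \<kappa> = F0 (q2 \<cdot>\<^bsub>Cat E\<^esub> (d \<cdot>\<^bsub>Cat E\<^esub> c)) \<bullet> j'"
      "F1 t \<bullet> \<kappa> = iunt X0 \<bullet> (F0 \<tau> \<bullet> j)"
    and sq: "icomp E X0 (F1 s \<bullet> \<kappa>) (ncmp (\<nu> \<lhd>\<^bsub>Cat E\<^esub> (a2 \<cdot>\<^bsub>Cat E\<^esub> (d \<cdot>\<^bsub>Cat E\<^esub> c))) \<bullet> j) =
      ncmp (\<nu> \<lhd>\<^bsub>Cat E\<^esub> (a2 \<cdot>\<^bsub>Cat E\<^esub> (d \<cdot>\<^bsub>Cat E\<^esub> c))) \<bullet> j'"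
  define g g' where "g = F0 d \<bullet> (F0 c \<bullet> j)" and "g' = F0 d \<bullet> (F0 c \<bullet> j')"
  have g: "g \<in> Ar E" "Src E g = Src E j" "Trg E g = C0 (fdom a2)" "g' \<in> Ar E" "Src E g' = Src E j" "Trg E g' = C0 (fdom a2)"
    using j by (simp_all add: g_def g'_def)
  have \<kappa>': "isrc X1 \<bullet> \<kappa> = F0 q2 \<bullet> g" "itrg X1 \<bullet> \<kappa> = F0 q2 \<bullet> g'" "F1 t \<bullet> \<kappa> = iunt X0 \<bullet> (F0 t \<bullet> (F0 q2 \<bullet> g))"
    using j \<kappa> by (simp_all add: g_def g'_def \<tau>_eqs)
  have sq': "icomp E X0 (F1 s \<bullet> \<kappa>) (ncmp \<nu> \<bullet> (F0 a2 \<bullet> g)) = ncmp \<nu> \<bullet> (F0 a2 \<bullet> g')"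
    using sq j by (simp add: g_def g'_def)
  have "F0 ns \<bullet> (F0 a2 \<bullet> g') = F0 ns \<bullet> (F0 a2 \<bullet> g)"
    using arg_cong[OF sq', of "(\<bullet>) (isrc X0)"] g \<kappa>(1-3) \<kappa>' by (simp add: pb2_obj_eqs)
  \<comment> \<open>The square with a unit on the source side and
    \<open>F1 s \<bullet> \<kappa>\<close> on the target side commutes by
    \<open>sq'\<close>.\<close>
  then obtain \<xi>1 where \<xi>1: "\<xi>1 \<in> Ar E" "Src E \<xi>1 = Src E j" "Trg E \<xi>1 = C1 N1" "isrc N1 \<bullet> \<xi>1 = F0 a2 \<bullet> g"
      "itrg N1 \<bullet> \<xi>1 = F0 a2 \<bullet> g'" "F1 ns \<bullet> \<xi>1 = iunt X0 \<bullet> (F0 ns \<bullet> (F0 a2 \<bullet> g))" "F1 nt \<bullet> \<xi>1 = F1 s \<bullet> \<kappa>"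
    using \<nu>_arrow[of "F0 a2 \<bullet> g" "F0 a2 \<bullet> g'" "iunt X0 \<bullet> (F0 ns \<bullet> (F0 a2 \<bullet> g))" "F1 s \<bullet> \<kappa>"] g \<kappa>(1-3) \<kappa>' sq'
      icomp_unit(1)[of X0 "ncmp \<nu> \<bullet> (F0 a2 \<bullet> g')" "F0 ns \<bullet> (F0 a2 \<bullet> g)"]
    by (auto simp: pb2_obj_eqs)
  obtain \<xi> where \<xi>: "\<xi> \<in> Ar E" "Src E \<xi> = Src E j" "Trg E \<xi> = C1 (fdom a2)" "isrc (fdom a2) \<bullet> \<xi> = g"
      "itrg (fdom a2) \<bullet> \<xi> = g'" "F1 a2 \<bullet> \<xi> = \<xi>1" "F1 q2 \<bullet> \<xi> = \<kappa>"
    by (rule pullback_arr[OF pb2, of \<xi>1 \<kappa> g g']) (use \<xi>1 \<kappa>(1-3) \<kappa>' g in simp_all)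
  obtain \<chi> where "\<chi> \<in> Ar E" "Src E \<chi> = Src E j" "Trg E \<chi> = C1 J" "isrc J \<bullet> \<chi> = j" "itrg J \<bullet> \<chi> = j'"
    by (rule J_arr[OF j \<xi>(1-3)]) (use \<xi> \<xi>1 \<kappa>'(3) in \<open>simp_all add: g_def g'_def\<close>)
  then show "\<exists>\<chi>. \<chi> \<in> Ar E \<and> Src E \<chi> = Src E j \<and> Trg E \<chi> = C1 J \<and> isrc J \<bullet> \<chi> = j \<and> itrg J \<bullet> \<chi> = j'"
    by blast
next
  fix x
  assume x: "x \<in> Ar E" "Trg E x = C0 J2"
  let ?f = "ncmp l3 \<bullet> (F0 w \<bullet> (F0 z \<bullet> x))" and ?y = "F0 y \<bullet> (F0 z \<bullet> x)"
  show "\<exists>f y. f \<in> Ar E \<and> Src E f = Src E x \<and> Trg E f = C1 X1 \<and> cell X1 f \<in> \<Phi> \<and>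
      isrc X1 \<bullet> f = F0 (q2 \<cdot>\<^bsub>Cat E\<^esub> (d \<cdot>\<^bsub>Cat E\<^esub> c)) \<bullet> (F0 \<pi> \<bullet> x) \<and>
      F1 t \<bullet> f = ncmp (\<nu> \<lhd>\<^bsub>Cat E\<^esub> (a2 \<cdot>\<^bsub>Cat E\<^esub> (d \<cdot>\<^bsub>Cat E\<^esub> c))) \<bullet> (F0 \<rho> \<bullet> x) \<and>
      y \<in> Ar E \<and> Src E y = Src E x \<and> Trg E y = C0 X2 \<and>
      F0 p \<bullet> y = itrg X1 \<bullet> f \<and> F0 q \<bullet> y = F0 (q2 \<cdot>\<^bsub>Cat E\<^esub> (d \<cdot>\<^bsub>Cat E\<^esub> c)) \<bullet> (F0 \<rho> \<bullet> x) \<and>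
      F0 m \<bullet> y = F0 (q2 \<cdot>\<^bsub>Cat E\<^esub> (d \<cdot>\<^bsub>Cat E\<^esub> c)) \<bullet> (F0 \<mu> \<bullet> x) \<and>
      icomp E X0 (F1 s \<bullet> f) (ncmp (\<nu> \<lhd>\<^bsub>Cat E\<^esub> (a2 \<cdot>\<^bsub>Cat E\<^esub> (d \<cdot>\<^bsub>Cat E\<^esub> c))) \<bullet> (F0 \<pi> \<bullet> x)) =
        ncmp (\<nu> \<lhd>\<^bsub>Cat E\<^esub> (a2 \<cdot>\<^bsub>Cat E\<^esub> (d \<cdot>\<^bsub>Cat E\<^esub> c))) \<bullet> (F0 \<mu> \<bullet> x)"
    using x corner_mult[OF x] by (intro exI[of _ ?f] exI[of _ ?y]) simp
qed (use assms opfib in simp_all)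

end

section \<open>Low-dimensional data of category objects and of the cotensor nerve\<close>

context base
begin

context
  fixes X
  assumes X: "category_object (Cat E) X"
begin

lemma category_object_simps:
  "internal_category E (level X n)"
  "i \<le> Suc n \<Longrightarrow> internal_functor E (face X (Suc n) i)" "i \<le> Suc n \<Longrightarrow> fdom (face X (Suc n) i) = level X (Suc n)"
  "i \<le> Suc n \<Longrightarrow> fcod (face X (Suc n) i) = level X n"
  "i \<le> n \<Longrightarrow> internal_functor E (degen X n i)" "i \<le> n \<Longrightarrow> fdom (degen X n i) = level X n"
  "i \<le> n \<Longrightarrow> fcod (degen X n i) = level X (Suc n)"
  using X by (auto simp: category_object_def simplicial_object_def)

lemma category_object_eqs:
  "i < j \<Longrightarrow> j \<le> n + 2 \<Longrightarrow>
    face X (n + 1) i \<cdot>\<^bsub>Cat E\<^esub> face X (n + 2) j = face X (n + 1) (j - 1) \<cdot>\<^bsub>Cat E\<^esub> face X (n + 2) i"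
  "i < j \<Longrightarrow> j \<le> n \<Longrightarrow>
    face X (n + 1) i \<cdot>\<^bsub>Cat E\<^esub> degen X n j = degen X (n - 1) (j - 1) \<cdot>\<^bsub>Cat E\<^esub> face X n i"
  "j \<le> n \<Longrightarrow> face X (n + 1) j \<cdot>\<^bsub>Cat E\<^esub> degen X n j = One (Cat E) (level X n)"
  "j \<le> n \<Longrightarrow> face X (n + 1) (j + 1) \<cdot>\<^bsub>Cat E\<^esub> degen X n j = One (Cat E) (level X n)"
  "j + 1 < i \<Longrightarrow> i \<le> n + 1 \<Longrightarrow>
    face X (n + 1) i \<cdot>\<^bsub>Cat E\<^esub> degen X n j = degen X (n - 1) j \<cdot>\<^bsub>Cat E\<^esub> face X n (i - 1)"
proof -
  note S = X[unfolded category_object_def simplicial_object_def, THEN conjunct1, THEN conjunct2,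
      THEN conjunct2, THEN conjunct2]
  show "face X (n + 1) i \<cdot>\<^bsub>Cat E\<^esub> face X (n + 2) j = face X (n + 1) (j - 1) \<cdot>\<^bsub>Cat E\<^esub> face X (n + 2) i"
    if "i < j" "j \<le> n + 2"
    using S[THEN conjunct1, rule_format, OF that] .
  note S = S[THEN conjunct2]
  show "face X (n + 1) i \<cdot>\<^bsub>Cat E\<^esub> degen X n j = degen X (n - 1) (j - 1) \<cdot>\<^bsub>Cat E\<^esub> face X n i"
    if "i < j" "j \<le> n"
    using S[THEN conjunct1, rule_format, OF that] .
  note S = S[THEN conjunct2]
  show "face X (n + 1) j \<cdot>\<^bsub>Cat E\<^esub> degen X n j = One (Cat E) (level X n)"
    "face X (n + 1) (j + 1) \<cdot>\<^bsub>Cat E\<^esub> degen X n j = One (Cat E) (level X n)" if "j \<le> n"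
    using S[THEN conjunct1, rule_format, OF that] by blast+
  note S = S[THEN conjunct2]
  show "face X (n + 1) i \<cdot>\<^bsub>Cat E\<^esub> degen X n j = degen X (n - 1) j \<cdot>\<^bsub>Cat E\<^esub> face X n (i - 1)"
    if "j + 1 < i" "i \<le> n + 1"
    using S[THEN conjunct1, rule_format, OF that] .
qed

lemma truncated_category_category_object:
  "truncated_category E (level X 0) (level X 1) (level X 2) (face X 1 1) (face X 1 0) (degen X 0 0)
     (face X 2 2) (face X 2 0) (face X 2 1)"
proof
  note simps = category_object_simps[where n = 0] category_object_simps[where n = 1]
  show "internal_category E (level X 0)" "internal_category E (level X 1)" "internal_category E (level X 2)"
    by (simp_all only: category_object_simps)
  show "internal_functor E (face X 1 1)" "fdom (face X 1 1) = level X 1" "fcod (face X 1 1) = level X 0"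
    "internal_functor E (face X 1 0)" "fdom (face X 1 0) = level X 1" "fcod (face X 1 0) = level X 0"
    "internal_functor E (degen X 0 0)" "fdom (degen X 0 0) = level X 0" "fcod (degen X 0 0) = level X 1"
    "internal_functor E (face X 2 2)" "fdom (face X 2 2) = level X 2" "fcod (face X 2 2) = level X 1"
    "internal_functor E (face X 2 0)" "fdom (face X 2 0) = level X 2" "fcod (face X 2 0) = level X 1"
    "internal_functor E (face X 2 1)" "fdom (face X 2 1) = level X 2" "fcod (face X 2 1) = level X 1"
    using simps by (simp_all add: numeral_2_eq_2)
  show "face X 1 1 \<cdot>\<^bsub>Cat E\<^esub> degen X 0 0 = One (Cat E) (level X 0)"
    "face X 1 0 \<cdot>\<^bsub>Cat E\<^esub> degen X 0 0 = One (Cat E) (level X 0)"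
    using category_object_eqs(3,4)[of 0 0] by simp_all
  show "face X 1 0 \<cdot>\<^bsub>Cat E\<^esub> face X 2 2 = face X 1 1 \<cdot>\<^bsub>Cat E\<^esub> face X 2 0"
    "face X 1 1 \<cdot>\<^bsub>Cat E\<^esub> face X 2 1 = face X 1 1 \<cdot>\<^bsub>Cat E\<^esub> face X 2 2"
    "face X 1 0 \<cdot>\<^bsub>Cat E\<^esub> face X 2 1 = face X 1 0 \<cdot>\<^bsub>Cat E\<^esub> face X 2 0"
    using category_object_eqs(1)[of 0 2 0] category_object_eqs(1)[of 1 2 0] category_object_eqs(1)[of 0 1 0]
    by (simp_all add: numeral_2_eq_2)
qed

lemma category_object_pullback:
  "pullback (Cat E) (face X 1 0) (face X 1 1) (face X 2 2) (face X 2 0)"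
proof -
  have "\<forall>n. pullback (Cat E) (face X (n + 1) 0) (face X (n + 1) (n + 1)) (face X (n + 2) (n + 2)) (face X (n + 2) 0)"
    using X by (simp add: category_object_def)
  from this[rule_format, of 0] show ?thesis
    by (simp add: numeral_2_eq_2)
qed

lemma degeneracies:
  "internal_functor E (degen X 1 0)" "fdom (degen X 1 0) = level X 1" "fcod (degen X 1 0) = level X 2"
  "internal_functor E (degen X 1 1)" "fdom (degen X 1 1) = level X 1" "fcod (degen X 1 1) = level X 2"
  "face X 2 2 \<cdot>\<^bsub>Cat E\<^esub> degen X 1 0 = degen X 0 0 \<cdot>\<^bsub>Cat E\<^esub> face X 1 1"
  "face X 2 0 \<cdot>\<^bsub>Cat E\<^esub> degen X 1 0 = One (Cat E) (level X 1)"
  "face X 2 1 \<cdot>\<^bsub>Cat E\<^esub> degen X 1 0 = One (Cat E) (level X 1)"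
  "face X 2 2 \<cdot>\<^bsub>Cat E\<^esub> degen X 1 1 = One (Cat E) (level X 1)"
  "face X 2 0 \<cdot>\<^bsub>Cat E\<^esub> degen X 1 1 = degen X 0 0 \<cdot>\<^bsub>Cat E\<^esub> face X 1 0"
  "face X 2 1 \<cdot>\<^bsub>Cat E\<^esub> degen X 1 1 = One (Cat E) (level X 1)"
  using category_object_simps(5-7)[of _ 1] category_object_eqs(5)[of 0 2 1] category_object_eqs(3,4)[of 0 1]
    category_object_eqs(3,4)[of 1 1] category_object_eqs(2)[of 0 1 1]
  by (simp_all add: numeral_2_eq_2)

end

lemma cotensor_nerve_simps:
  assumes nerve: "cotensor_nerve (Cat E) A N c"
  shows "category_object (Cat E) N" "level N 0 = A" "cotensor (Cat E) 1 A (level N 1) (c 1)"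
    "internal_nat E (c 1 0 1)" "nsrc (c 1 0 1) = face N 1 1" "ntrg (c 1 0 1) = face N 1 0"
    "nsrc (c 1 0 0) = face N 1 1" "nsrc (c 1 1 1) = face N 1 0"
    "ncmp (c 1 0 1) \<bullet> F0 (degen N 0 0) = iunt A"
    "\<lbrakk>x \<in> Ar E; Trg E x = C0 (level N 2)\<rbrakk> \<Longrightarrow>
      icomp E A (ncmp (c 1 0 1) \<bullet> (F0 (face N 2 0) \<bullet> x)) (ncmp (c 1 0 1) \<bullet> (F0 (face N 2 2) \<bullet> x)) =
        ncmp (c 1 0 1) \<bullet> (F0 (face N 2 1) \<bullet> x)"
proof -
  show N: "category_object (Cat E) N" and A: "level N 0 = A" and cot: "cotensor (Cat E) 1 A (level N 1) (c 1)"
    using nerve by (auto simp: cotensor_nerve_def)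
  interpret N: truncated_category E A "level N 1" "level N 2" "face N 1 1" "face N 1 0" "degen N 0 0"
     "face N 2 2" "face N 2 0" "face N 2 1"
    using truncated_category_category_object[OF N] by (simp only: A)
  note S = nerve[unfolded cotensor_nerve_def, THEN conjunct2, THEN conjunct2]
  note c0 = S[THEN conjunct1] and cot2 = S[THEN conjunct2, THEN conjunct1, rule_format, of 2]
    and face = S[THEN conjunct2, THEN conjunct2, THEN conjunct1]
    and degen = S[THEN conjunct2, THEN conjunct2, THEN conjunct2]
  \<comment> \<open>\<open>coface 1\<close> fixes \<open>0\<close> and \<open>coface 0\<close> moves
    it to \<open>1\<close>, so \<open>d\<^sub>1\<close> is the source and \<open>d\<^sub>0\<close>
    the target of the universal 2-cell.\<close>
  have "c 0 0 0 \<lhd>\<^bsub>Cat E\<^esub> face N 1 1 = c 1 0 0" "c 0 0 0 \<lhd>\<^bsub>Cat E\<^esub> face N 1 0 = c 1 1 1"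
    using face[rule_format, of 1 0 0 0] face[rule_format, of 0 0 0 0] by (simp_all add: coface_def)
  then have "nsrc (c 1 0 0) = One (Cat E) A \<cdot>\<^bsub>Cat E\<^esub> face N 1 1" "nsrc (c 1 1 1) = One (Cat E) A \<cdot>\<^bsub>Cat E\<^esub> face N 1 0"
    by (metis c0 cone_Cat_simps(1) rwhisk_Cat_simps(1))+
  moreover have "One (Cat E) A \<cdot>\<^bsub>Cat E\<^esub> face N 1 1 = face N 1 1" "One (Cat E) A \<cdot>\<^bsub>Cat E\<^esub> face N 1 0 = face N 1 0"
    using N.face_simps by (auto intro!: ifun_eqI)
  ultimately show src: "nsrc (c 1 0 0) = face N 1 1" "nsrc (c 1 1 1) = face N 1 0"
    by simp_all
  show nat: "internal_nat E (c 1 0 1)" "nsrc (c 1 0 1) = face N 1 1" "ntrg (c 1 0 1) = face N 1 0"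
    using cotensor_simps(1-3)[OF cot] src by simp_all
  have "c 1 0 1 \<lhd>\<^bsub>Cat E\<^esub> degen N 0 0 = c 0 0 0"
    using degen[rule_format, of 0 0 0 1] by (simp add: codegen_def)
  then have "ncmp (c 1 0 1) \<bullet> F0 (degen N 0 0) = iunt A \<bullet> Ide E (C0 A)"
    by (metis c0 cone_Cat_simps(3) rwhisk_Cat_simps(3) One_Cat_simps(2,3))
  then show "ncmp (c 1 0 1) \<bullet> F0 (degen N 0 0) = iunt A"
    by simp
  assume x: "x \<in> Ar E" "Trg E x = C0 (level N 2)"
  have "\<forall>j k l. j \<le> k \<longrightarrow> k \<le> l \<longrightarrow> l \<le> 2 \<longrightarrow> c 2 k l \<odot>\<^bsub>Cat E\<^esub> c 2 j k = c 2 j l"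
    using cot2[unfolded cotensor_def ord_functor_def, THEN conjunct1, THEN conjunct2, THEN conjunct2] .
  \<comment> \<open>The edges 01, 12 and 02 of \<open>[2]\<close> are selected by
    \<open>d\<^sub>2\<close>, \<open>d\<^sub>0\<close> and \<open>d\<^sub>1\<close>.\<close>
  from this[rule_format, of 0 1 2] have "c 2 1 2 \<odot>\<^bsub>Cat E\<^esub> c 2 0 1 = c 2 0 2"
    by simp
  moreover have "c 1 0 1 \<lhd>\<^bsub>Cat E\<^esub> face N 2 0 = c 2 1 2" "c 1 0 1 \<lhd>\<^bsub>Cat E\<^esub> face N 2 2 = c 2 0 1"
    "c 1 0 1 \<lhd>\<^bsub>Cat E\<^esub> face N 2 1 = c 2 0 2"
    using face[rule_format, of 0 1 0 1] face[rule_format, of 2 1 0 1] face[rule_format, of 1 1 0 1]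
    by (simp_all add: coface_def numeral_2_eq_2)
  ultimately have "(c 1 0 1 \<lhd>\<^bsub>Cat E\<^esub> face N 2 0) \<odot>\<^bsub>Cat E\<^esub> (c 1 0 1 \<lhd>\<^bsub>Cat E\<^esub> face N 2 2) = c 1 0 1 \<lhd>\<^bsub>Cat E\<^esub> face N 2 1"
    by simp
  from arg_cong[OF this, of "\<lambda>\<phi>. ncmp \<phi> \<bullet> x"]
  show "icomp E A (ncmp (c 1 0 1) \<bullet> (F0 (face N 2 0) \<bullet> x)) (ncmp (c 1 0 1) \<bullet> (F0 (face N 2 2) \<bullet> x)) =
        ncmp (c 1 0 1) \<bullet> (F0 (face N 2 1) \<bullet> x)"
    using x nat nat_simps(5-7)[OF nat(1)] N.face_simps N.F0_eqs(3) by (simp add: icomp_stage del: One_nat_def)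
qed

end

lemma corners_of_is_Cnr:
  assumes cat: "category E"
    and crossed: "crossed_internal_category (Cat E) X \<Phi>"
    and corners: "is_Cnr E X \<Phi> C"
  shows "\<exists>l r k \<theta>. corners E (level X 0) (level X 1) (level X 2) (level C 1) (level C 2)
    (face X 1 1) (face X 1 0) (degen X 0 0) (face X 2 2) (face X 2 0) (face X 2 1)
    (face C 1 1) (face C 1 0) (degen C 0 0) (face C 2 2) (face C 2 0) (face C 2 1) \<Phi> l r k \<theta>"
proof -
  interpret base E
    using cat by (rule base.intro)
  have X: "category_object (Cat E) X" and opfib: "split_opfibration (Cat E) (face X 1 0) \<Phi>"
    and unit: "opfib_morphism (Cat E) (One (Cat E) (level X 0)) (cells_into (Cat E) (level X 0)) (face X 1 0) \<Phi> (degen X 0 0)"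
    using crossed by (simp_all add: crossed_internal_category_def)
  have C: "category_object (Cat E) C" and C0: "level C 0 = disc E (C0 (level X 0))"
    using corners by (simp_all add: is_Cnr_def)
  obtain N c p1 a1 a2 q2 \<delta> M where nerve: "cotensor_nerve (Cat E) (level X 0) N c"
    and crossing: "crossing (Cat E) X \<Phi> N c p1 a1 a2 q2 \<delta>"
    and composite: "composite_monad (Cat E) (monad_of N) (monad_of X) p1 a1 a2 q2 \<delta> M"
    and restricted: "restricted_monad (Cat E) (obj_incl E (level X 0)) M (monad_of C)"
    using corners unfolding is_Cnr_def by blast
  note N = cotensor_nerve_simps[OF nerve]
  note Xt = truncated_category_category_object[OF X] and Ct = truncated_category_category_object[OF C, unfolded C0]
    and Nt = truncated_category_category_object[OF N(1), unfolded N(2)]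
  obtain l3 where l3: "l3 \<in> \<Phi>" "nsrc l3 = p1" "face X 1 0 \<rhd>\<^bsub>Cat E\<^esub> l3 = c 1 0 1 \<lhd>\<^bsub>Cat E\<^esub> a1"
      "q2 \<cdot>\<^bsub>Cat E\<^esub> \<delta> = ntrg l3" "(c 1 0 1 \<lhd>\<^bsub>Cat E\<^esub> a2) \<lhd>\<^bsub>Cat E\<^esub> \<delta> = face X 1 1 \<rhd>\<^bsub>Cat E\<^esub> l3"
    and pb: "pullback (Cat E) (face X 1 0) (face N 1 1) p1 a1" "pullback (Cat E) (face N 1 0) (face X 1 1) a2 q2"
    and \<delta>: "internal_functor E \<delta>" "fdom \<delta> = fdom p1" "fcod \<delta> = fdom a2"
    using crossing unfolding crossing_def Let_def Cat_simps hom1_Cat by blast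
  from composite obtain w v y where M: "lleg M = face N 1 1 \<cdot>\<^bsub>Cat E\<^esub> a2" "rleg M = face X 1 0 \<cdot>\<^bsub>Cat E\<^esub> q2"
      "pullback (Cat E) (rleg M) (lleg M) (mfst M) (msnd M)"
      "internal_functor E (munit M)" "fdom (munit M) = fcod (face N 1 1)" "fcod (munit M) = fdom a2"
      "a2 \<cdot>\<^bsub>Cat E\<^esub> munit M = degen N 0 0" "q2 \<cdot>\<^bsub>Cat E\<^esub> munit M = degen X 0 0"
      "internal_functor E (mmult M)" "fdom (mmult M) = fdom (mfst M)" "fcod (mmult M) = fdom a2"
      "internal_functor E w" "fdom w = fdom (mfst M)" "fcod w = fdom p1"
      "p1 \<cdot>\<^bsub>Cat E\<^esub> w = q2 \<cdot>\<^bsub>Cat E\<^esub> mfst M" "a1 \<cdot>\<^bsub>Cat E\<^esub> w = a2 \<cdot>\<^bsub>Cat E\<^esub> msnd M"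
      "internal_functor E v" "fdom v = fdom (mfst M)" "fcod v = fdom (face N 2 2)"
      "face N 2 2 \<cdot>\<^bsub>Cat E\<^esub> v = a2 \<cdot>\<^bsub>Cat E\<^esub> mfst M"
      "face N 2 0 \<cdot>\<^bsub>Cat E\<^esub> v = a2 \<cdot>\<^bsub>Cat E\<^esub> (\<delta> \<cdot>\<^bsub>Cat E\<^esub> w)"
      "internal_functor E y" "fdom y = fdom (mfst M)" "fcod y = fdom (face X 2 2)"
      "face X 2 2 \<cdot>\<^bsub>Cat E\<^esub> y = q2 \<cdot>\<^bsub>Cat E\<^esub> (\<delta> \<cdot>\<^bsub>Cat E\<^esub> w)" "face X 2 0 \<cdot>\<^bsub>Cat E\<^esub> y = q2 \<cdot>\<^bsub>Cat E\<^esub> msnd M"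
      "a2 \<cdot>\<^bsub>Cat E\<^esub> mmult M = face N 2 1 \<cdot>\<^bsub>Cat E\<^esub> v" "q2 \<cdot>\<^bsub>Cat E\<^esub> mmult M = face X 2 1 \<cdot>\<^bsub>Cat E\<^esub> y"
    unfolding composite_monad_def monad_of_def span_monad.simps Cat_simps hom1_Cat by (elim conjE exE) (rule that)
  from restricted obtain b d c' z where R:
      "pullback (Cat E) (obj_incl E (level X 0)) (lleg M) b d"
      "pullback (Cat E) (rleg M \<cdot>\<^bsub>Cat E\<^esub> d) (obj_incl E (level X 0)) c' (face C 1 0)"
      "face C 1 1 = b \<cdot>\<^bsub>Cat E\<^esub> c'"
      "d \<cdot>\<^bsub>Cat E\<^esub> (c' \<cdot>\<^bsub>Cat E\<^esub> degen C 0 0) = munit M \<cdot>\<^bsub>Cat E\<^esub> obj_incl E (level X 0)"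
      "internal_functor E z" "fdom z = fdom (face C 2 2)" "fcod z = fdom (mfst M)"
      "mfst M \<cdot>\<^bsub>Cat E\<^esub> z = d \<cdot>\<^bsub>Cat E\<^esub> (c' \<cdot>\<^bsub>Cat E\<^esub> face C 2 2)"
      "msnd M \<cdot>\<^bsub>Cat E\<^esub> z = d \<cdot>\<^bsub>Cat E\<^esub> (c' \<cdot>\<^bsub>Cat E\<^esub> face C 2 0)"
      "d \<cdot>\<^bsub>Cat E\<^esub> (c' \<cdot>\<^bsub>Cat E\<^esub> face C 2 1) = mmult M \<cdot>\<^bsub>Cat E\<^esub> z"
    unfolding restricted_monad_def monad_of_def span_monad.simps Cat_simps hom1_Cat by metis
  \<comment> \<open>Among the goals below, 5 to 7 are the universal property of the cotensor with
    \<open>[1]\<close>, and 9 is composition in the nerve.\<close>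
  interpret K: corner_construction E "level X 0" "level X 1" "level X 2" "level C 1" "level C 2" "level N 1" "level N 2"
    "face X 1 1" "face X 1 0" "degen X 0 0" "face X 2 2" "face X 2 0" "face X 2 1"
    "face C 1 1" "face C 1 0" "degen C 0 0" "face C 2 2" "face C 2 0" "face C 2 1"
    "face N 1 1" "face N 1 0" "degen N 0 0" "face N 2 2" "face N 2 0" "face N 2 1"
    \<Phi> "c 1 0 1" l3 p1 a1 a2 q2 \<delta> "lleg M" "rleg M" "mfst M" "msnd M" "munit M" "mmult M" w v y b d c' z
  proof (intro corner_construction.intro corner_construction_axioms.intro base_axioms Xt Ct Nt, goal_cases)
    case (5 a)
    then show ?case
      using cotensor_obj[OF N(3), of a] by metis
  next
    case (6 n n')
    then show ?case
      by (intro cotensor_obj_eq[OF N(3), of n n'])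
  next
    case (7 n n' f g)
    then show ?case
      using cotensor_arr[OF N(3), of n n' f g] unfolding N(7,8) by metis
  next
    case (9 x)
    then show ?case
      by (rule N(10))
  qed (use N(4-9) opfib l3 pb \<delta> M R truncated_category.face_simps[OF Xt] truncated_category.face_simps[OF Ct]
      truncated_category.face_simps[OF Nt] in \<open>simp_all only:\<close>)
  show ?thesis
    using K.corners_intro[OF degeneracies[OF X] category_object_pullback[OF X] category_object_pullback[OF C] unit]
    by blast
qed

theorem theorem5p4p4:
  fixes E :: "('o, 'm) cat"
    and X C :: "(('o, 'm) icat, ('o, 'm) ifun) simp"
    and \<Phi> :: "('o, 'm) inat set"
  assumes cat: "category E" and pb: "has_pullbacks E"
    and crossed: "crossed_internal_category (Cat E) X \<Phi>"
    and corners: "is_Cnr E X \<Phi> C"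
  shows "((\<exists>Q. codescent_object (Cat E) X Q) \<longleftrightarrow> (\<exists>Q. codescent_object (Cat E) C Q)) \<and>
         (\<forall>Q. codescent_object (Cat E) X Q \<longleftrightarrow> codescent_object (Cat E) C Q)"
proof -
  interpret base E
    using cat by (rule base.intro)
  have C0: "level C 0 = disc E (C0 (level X 0))"
    using corners by (simp add: is_Cnr_def)
  obtain l r k \<theta> where "corners E (level X 0) (level X 1) (level X 2) (level C 1) (level C 2)
    (face X 1 1) (face X 1 0) (degen X 0 0) (face X 2 2) (face X 2 0) (face X 2 1)
    (face C 1 1) (face C 1 0) (degen C 0 0) (face C 2 2) (face C 2 0) (face C 2 1) \<Phi> l r k \<theta>"
    using corners_of_is_Cnr[OF cat crossed corners] by blast
  \<comment> \<open>The equivalence is obtained for each \<open>Q\<close> separately, so the one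
    about existence follows from it.\<close>
  then have "codescent_object (Cat E) X Q \<longleftrightarrow> codescent_object (Cat E) C Q" for Q
    unfolding codescent_object_def is_codescent_iff_codescent_on C0 by (rule corners.codescent_iff)
  then show ?thesis
    by blast
qed

end
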